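(* Let $(M,g)$ be a Riemannian manifold of dimension $m$. Let $X_0,X_1$ be real valued z-KROK random fields on $M$, let $0\le t\le1$, and let $\epsilon$ be a random variable with values in $\{0,1\}$, independent of $X_0,X_1$, with $\epsilon=0$ with probability $1-t$ and $\epsilon=1$ with probability $t$. Assume that $X_t:=(1-\epsilon)X_0+\epsilon X_1$ is z-KROK. For $i\in\{0,1,t\}$ let $Z_1^{(i)},\dots,Z_m^{(i)}$ be i.i.d. copies of the random set $X_i^{-1}(0)$. Then for all $p\in M$ $$\delta_{Z_1^{(t)}\cap\cdots\cap Z_m^{(t)}}(p)\ \ge\ \Big(\delta_{Z_1^{(0)}\cap\cdots\cap Z_m^{(0)}}(p)\Big)^{1-t}\Big(\delta_{Z_1^{(1)}\cap\cdots\cap Z_m^{(1)}}(p)\Big)^{t}.$$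
   Context: Random fields. $M$ is a smooth manifold of dimension $m$, possibly non-compact, with Riemannian metric $g$. $C^1(M,\mathbb{R}^k)$ carries the weak Whitney topology; a random field $X$ is a measurable map from a probability space into it; $[Y]$ denotes the law of a random element $Y$. For $f\in C^1(M,\mathbb{R}^k)$ let $J_pf:=\|d_pf^1\wedge\cdots\wedge d_pf^k\|$, with the norm on $\Lambda^kT^*_pM$ induced by $g$ through $\langle v_1\wedge\dots\wedge v_k,w_1\wedge\dots\wedge w_k\rangle=\det(\langle v_i,w_j\rangle)_{i,j}$. A regular conditional probability of $X$ given $X(p)$ is a map $(x,B)\mapsto\mu(p,x)(B)$ ($x\in\mathbb{R}^k$, $B\subset C^1(M,\mathbb{R}^k)$ Borel) such that each $\mu(p,x)$ is a Borel probability measure, $x\mapsto\mu(p,x)(B)$ is Borel, and $\mathbb{P}\{X\in B,\,X(p)\in V\}=\int_V\mu(p,x)(B)\,d[X(p)](x)$ for all Borel $B$ and $V\subset\mathbb{R}^k$. $X$ is z-KROK if: (i) $X$ is a random element of $C^1(M,\mathbb{R}^k)$; (ii) almost surely $0$ is a regular value of $X$; (iii) for every $p\in M$ the law of $X(p)$ is absolutely continuous with density $\rho_{X(p)}:\mathbb{R}^k\to[0,+\infty)$; (iv) $(p,x)\mapsto\rho_{X(p)}(x)$ on $M\times\mathbb{R}^k$ is continuous at $(p,0)$ for all $p\in M$; (v) there are regular conditional probabilities $\mu(p,\cdot)$ of $X$ given $X(p)$, $p\in M$, such that the measures $J_p\cdot\mu(p,x)$, $B\mapsto\int_BJ_pf\,d\mu(p,x)(f)$,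 are finite and $(p,x)\mapsto J_p\cdot\mu(p,x)$, with values in the finite positive Borel measures on $C^1(M,\mathbb{R}^k)$ with the weak topology (tested on bounded continuous functions), is continuous at $(p,0)$ for all $p\in M$. With this $\mu$, write $\mathbb{E}\{\Phi(X)\,|\,X(p)=0\}:=\int\Phi\,d\mu(p,0)$. Density of expected volume. For a field $X$ with zero set $Z=X^{-1}(0)$, $\delta_Z(p):=\delta_X(p):=\mathbb{E}\{J_pX\,|\,X(p)=0\}\,\rho_{X(p)}(0)$. For an intersection of zero sets of independent z-KROK fields $W_1,\dots,W_n$, $\delta_{W_1^{-1}(0)\cap\dots\cap W_n^{-1}(0)}:=\delta_{(W_1,\dots,W_n)}$ is the density of the concatenated field, for which $\rho_{(W_1,\dots,W_n)(p)}(0)=\prod_i\rho_{W_i(p)}(0)$ and the conditional law given that all $W_i(p)=0$ is the product of the conditional laws $\mu_i(p,0)$. Here $Z_1^{(i)},\dots,Z_m^{(i)}$ are the zero sets of $m$ i.i.d. copies of $X_i$. *)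

theory Defs
  imports "HOL-Probability.Probability"
begin

section \<open>Manifolds\<close>

(* Only meaningful for open S. *)
primrec Ck_on ::
    "nat \<Rightarrow> 'e::euclidean_space set \<Rightarrow> ('e \<Rightarrow> 'f::real_normed_vector) \<Rightarrow> bool" where
  "Ck_on 0 S f \<longleftrightarrow> continuous_on S f"
| "Ck_on (Suc n) S f \<longleftrightarrow>
     f differentiable_on S \<and> (\<forall>v. Ck_on n S (\<lambda>x. frechet_derivative f (at x) v))"

definition smooth_on :: "'e::euclidean_space set \<Rightarrow> ('e \<Rightarrow> 'f::real_normed_vector) \<Rightarrow> bool" where
  "smooth_on S f \<longleftrightarrow> (\<forall>n. Ck_on n S f)"

(* A chart is given by its domain and its coordinate map; the values of the
   coordinate map outside the domain are irrelevant. *)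
type_synonym ('a, 'm) chart = "'a set \<times> ('a \<Rightarrow> (real, 'm) vec)"

definition chart_inv :: "('a, 'm::finite) chart \<Rightarrow> real^'m \<Rightarrow> 'a" where
  "chart_inv c = inv_into (fst c) (snd c)"

definition is_chart :: "('a::topological_space, 'm::finite) chart \<Rightarrow> bool" where
  "is_chart c \<longleftrightarrow> open (fst c) \<and> open (snd c ` fst c) \<and>
     homeomorphism (fst c) (snd c ` fst c) (snd c) (chart_inv c)"

(* A is a smooth atlas making the whole type 'a (Hausdorff and second countable
   by its sort) a smooth manifold of dimension CARD('m). *)
definition smooth_manifold ::
    "('a::{t2_space, second_countable_topology}, 'm::finite) chart set \<Rightarrow> bool" where
  "smooth_manifold A \<longleftrightarrow>
     (\<forall>c\<in>A. is_chart c) \<and> (\<Union>c\<in>A. fst c) = UNIV \<and>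
     (\<forall>c\<in>A. \<forall>c'\<in>A. smooth_on (snd c ` (fst c \<inter> fst c')) (snd c' \<circ> chart_inv c))"

(* Matrix of the differential of f at p in the chart c.  Its k-th row holds the
   coordinates of the covector d_p f^k in the basis dx^1, ..., dx^m of the chart. *)
definition jac ::
    "('a, 'm::finite) chart \<Rightarrow> ('a \<Rightarrow> real^'k) \<Rightarrow> 'a \<Rightarrow> real^'m^'k::finite" where
  "jac c f p = matrix (frechet_derivative (f \<circ> chart_inv c) (at (snd c p)))"

(* g c p is the matrix of components g_ij of the metric at p in the chart c; the last
   clause is the transformation law of a covariant 2-tensor. *)
definition riemannian_metric ::
    "('a, 'm::finite) chart set \<Rightarrow> (('a, 'm) chart \<Rightarrow> 'a \<Rightarrow> real^'m^'m) \<Rightarrow> bool" where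
  "riemannian_metric A g \<longleftrightarrow>
     (\<forall>c\<in>A. smooth_on (snd c ` fst c) (g c \<circ> chart_inv c) \<and>
        (\<forall>p\<in>fst c. transpose (g c p) = g c p \<and> (\<forall>v. v \<noteq> 0 \<longrightarrow> 0 < v \<bullet> (g c p *v v)))) \<and>
     (\<forall>c\<in>A. \<forall>c'\<in>A. \<forall>p\<in>fst c \<inter> fst c'.
        g c p = transpose (jac c (snd c') p) ** g c' p ** jac c (snd c') p)"

(* The inner product induced by g on cotangent spaces has the components g^ij of the
   inverse matrix. *)
definition cotangent_inner ::
    "(('a, 'm::finite) chart \<Rightarrow> 'a \<Rightarrow> real^'m^'m) \<Rightarrow> ('a, 'm) chart \<Rightarrow> 'a
      \<Rightarrow> real^'m \<Rightarrow> real^'m \<Rightarrow> real" where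
  "cotangent_inner g c p v w = v \<bullet> (matrix_inv (g c p) *v w)"

definition wedge_norm ::
    "(('a, 'm::finite) chart \<Rightarrow> 'a \<Rightarrow> real^'m^'m) \<Rightarrow> ('a, 'm) chart \<Rightarrow> 'a
      \<Rightarrow> real^'m^'k::finite \<Rightarrow> real" where
  "wedge_norm g c p V = sqrt (det (\<chi> i j. cotangent_inner g c p (V $ i) (V $ j)))"

(* J_p f = || d_p f^1 /\ ... /\ d_p f^k ||, computed in some chart around p;
   the lemma J_chart_independent below shows that the chart does not matter. *)
definition J ::
    "('a, 'm::finite) chart set \<Rightarrow> (('a, 'm) chart \<Rightarrow> 'a \<Rightarrow> real^'m^'m) \<Rightarrow> 'a
      \<Rightarrow> ('a \<Rightarrow> real^'k::finite) \<Rightarrow> real" where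
  "J A g p f = (let c = SOME c. c \<in> A \<and> p \<in> fst c in wedge_norm g c p (jac c f p))"


section \<open>The space of continuously differentiable maps\<close>

definition C1 :: "('a, 'm::finite) chart set \<Rightarrow> ('a \<Rightarrow> real^'k::finite) set" where
  "C1 A = {f. \<forall>c\<in>A. Ck_on 1 (snd c ` fst c) (f \<circ> chart_inv c)}"

definition whitney_nbhd ::
    "('a, 'm::finite) chart set \<Rightarrow> ('a \<Rightarrow> real^'k::finite) \<Rightarrow> ('a, 'm) chart \<Rightarrow> 'a set \<Rightarrow> real
      \<Rightarrow> ('a \<Rightarrow> real^'k) set" where
  "whitney_nbhd A f c K e =
     {h \<in> C1 A. \<forall>p\<in>K. norm (h p - f p) < e \<and> norm (jac c h p - jac c f p) < e}"

definition weak_whitney ::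
    "('a::topological_space, 'm::finite) chart set \<Rightarrow> ('a \<Rightarrow> real^'k::finite) topology" where
  "weak_whitney A = topology_generated_by
     {whitney_nbhd A f c K e | f c K e. f \<in> C1 A \<and> c \<in> A \<and> compact K \<and> K \<subseteq> fst c \<and> 0 < e}"

definition C1_borel ::
    "('a::topological_space, 'm::finite) chart set \<Rightarrow> ('a \<Rightarrow> real^'k::finite) measure" where
  "C1_borel A = sigma (C1 A) {U. openin (weak_whitney A) U}"

definition regular_value_0 ::
    "('a, 'm::finite) chart set \<Rightarrow> ('a \<Rightarrow> real^'k::finite) \<Rightarrow> bool" where
  "regular_value_0 A f \<longleftrightarrow>
     (\<forall>p. f p = 0 \<longrightarrow> (\<forall>c\<in>A. p \<in> fst c \<longrightarrow> surj ((*v) (jac c f p))))"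


section \<open>z-KROK fields\<close>

definition regular_cond_prob ::
    "('a::topological_space, 'm::finite) chart set \<Rightarrow> 'w measure \<Rightarrow> ('w \<Rightarrow> 'a \<Rightarrow> real^'k::finite)
      \<Rightarrow> 'a \<Rightarrow> (real^'k \<Rightarrow> ('a \<Rightarrow> real^'k) measure) \<Rightarrow> bool" where
  "regular_cond_prob A P X p \<kappa> \<longleftrightarrow>
     (\<forall>x. prob_space (\<kappa> x) \<and> sets (\<kappa> x) = sets (C1_borel A)) \<and>
     (\<forall>B\<in>sets (C1_borel A). (\<lambda>x. emeasure (\<kappa> x) B) \<in> borel_measurable borel) \<and>
     (\<forall>B\<in>sets (C1_borel A). \<forall>V\<in>sets borel.
        emeasure P {w \<in> space P. X w \<in> B \<and> X w p \<in> V} =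
        (\<integral>\<^sup>+x\<in>V. emeasure (\<kappa> x) B \<partial>distr P borel (\<lambda>w. X w p)))"

(* Continuity at z for the weak topology on finite Borel measures, i.e. the initial
   topology of the integrals of bounded continuous functions. *)
definition weakly_cont_at ::
    "'f topology \<Rightarrow> ('x::t2_space \<Rightarrow> 'f measure) \<Rightarrow> 'x \<Rightarrow> bool" where
  "weakly_cont_at T \<nu> z \<longleftrightarrow>
     (\<forall>\<phi>. continuous_map T euclideanreal \<phi> \<and> bounded (\<phi> ` topspace T) \<longrightarrow>
        isCont (\<lambda>x. \<integral>f. \<phi> f \<partial>\<nu> x) z)"

(* X is z-KROK, the versions of the density and of the conditional law required
   by the definition being \<rho> p = density of X(p) and \<mu> p x. *)
definition zKROK_with ::
    "('a::{t2_space, second_countable_topology}, 'm::finite) chart set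
      \<Rightarrow> (('a, 'm) chart \<Rightarrow> 'a \<Rightarrow> real^'m^'m)
      \<Rightarrow> 'w measure \<Rightarrow> ('w \<Rightarrow> 'a \<Rightarrow> real^'k::finite)
      \<Rightarrow> ('a \<Rightarrow> real^'k \<Rightarrow> real) \<Rightarrow> ('a \<Rightarrow> real^'k \<Rightarrow> ('a \<Rightarrow> real^'k) measure) \<Rightarrow> bool" where
  "zKROK_with A g P X \<rho> \<mu> \<longleftrightarrow>
     prob_space P \<and> X \<in> measurable P (C1_borel A) \<and>
     (AE w in P. regular_value_0 A (X w)) \<and>
     (\<forall>p. (\<forall>x. 0 \<le> \<rho> p x) \<and> distributed P lborel (\<lambda>w. X w p) (\<lambda>x. ennreal (\<rho> p x))) \<and>
     (\<forall>p. isCont (\<lambda>(q, x). \<rho> q x) (p, 0)) \<and>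
     (\<forall>p. regular_cond_prob A P X p (\<mu> p)) \<and>
     (\<forall>p x. finite_measure (density (\<mu> p x) (\<lambda>f. ennreal (J A g p f)))) \<and>
     (\<forall>p. weakly_cont_at (weak_whitney A)
             (\<lambda>(q, x). density (\<mu> q x) (\<lambda>f. ennreal (J A g q f))) (p, 0))"

definition zKROK ::
    "('a::{t2_space, second_countable_topology}, 'm::finite) chart set
      \<Rightarrow> (('a, 'm) chart \<Rightarrow> 'a \<Rightarrow> real^'m^'m)
      \<Rightarrow> 'w measure \<Rightarrow> ('w \<Rightarrow> 'a \<Rightarrow> real^'k::finite) \<Rightarrow> bool" where
  "zKROK A g P X \<longleftrightarrow> (\<exists>\<rho> \<mu>. zKROK_with A g P X \<rho> \<mu>)"


section \<open>Density of expected volume\<close>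

(* E{J_p X | X(p) = 0} \<rho>_{X(p)}(0), in terms of the versions \<rho>, \<mu> for X. *)
definition zero_density ::
    "('a, 'm::finite) chart set \<Rightarrow> (('a, 'm) chart \<Rightarrow> 'a \<Rightarrow> real^'m^'m)
      \<Rightarrow> ('a \<Rightarrow> real^'k::finite \<Rightarrow> real) \<Rightarrow> ('a \<Rightarrow> real^'k \<Rightarrow> ('a \<Rightarrow> real^'k) measure)
      \<Rightarrow> 'a \<Rightarrow> real" where
  "zero_density A g \<rho> \<mu> p = (\<integral>f. J A g p f \<partial>\<mu> p 0) * \<rho> p 0"

definition concat_field :: "('n::finite \<Rightarrow> 'a \<Rightarrow> real^1) \<Rightarrow> 'a \<Rightarrow> real^'n" where
  "concat_field f = (\<lambda>p. \<chi> j. f j p $ 1)"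

(* The zero density of the concatenation of independent real fields W_j with versions
   \<rho> j, \<mu> j: its density at 0 is the product of the \<rho> j p 0, and the law of
   (W_j)_j given that all W_j(p) vanish is the product of the \<mu> j p 0. *)
definition intersection_density ::
    "('a, 'm::finite) chart set \<Rightarrow> (('a, 'm) chart \<Rightarrow> 'a \<Rightarrow> real^'m^'m)
      \<Rightarrow> ('n::finite \<Rightarrow> 'a \<Rightarrow> real^1 \<Rightarrow> real)
      \<Rightarrow> ('n \<Rightarrow> 'a \<Rightarrow> real^1 \<Rightarrow> ('a \<Rightarrow> real^1) measure) \<Rightarrow> 'a \<Rightarrow> real" where
  "intersection_density A g \<rho> \<mu> p =
     (\<integral>f. J A g p (concat_field f) \<partial>(\<Pi>\<^sub>M j\<in>UNIV. \<mu> j p 0)) * (\<Prod>j\<in>UNIV. \<rho> j p 0)"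

definition iid_copies ::
    "('a::topological_space, 'm::finite) chart set \<Rightarrow> 'w measure \<Rightarrow> ('w \<Rightarrow> 'a \<Rightarrow> real^'k::finite)
      \<Rightarrow> 'v measure \<Rightarrow> ('n \<Rightarrow> 'v \<Rightarrow> 'a \<Rightarrow> real^'k) \<Rightarrow> bool" where
  "iid_copies A P X Q W \<longleftrightarrow>
     prob_space Q \<and> prob_space.indep_vars Q (\<lambda>_. C1_borel A) W UNIV \<and>
     (\<forall>j. distr Q (C1_borel A) (W j) = distr P (C1_borel A) X)"

(* Real power of a nonnegative base with 0^0 = 1, whereas 0 powr 0 = 0. *)
definition rpow :: "real \<Rightarrow> real \<Rightarrow> real" where
  "rpow x a = (if a = 0 then 1 else x powr a)"


section \<open>Consistency of the definitions\<close>

lemma intersection_density_concat: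
  fixes \<mu> :: "'n::finite \<Rightarrow> 'a::topological_space \<Rightarrow> real^1 \<Rightarrow> ('a \<Rightarrow> real^1) measure"
  assumes "concat_field \<in> measurable (\<Pi>\<^sub>M j\<in>UNIV. \<mu> j p 0) (C1_borel A)"
    and "J A g p \<in> borel_measurable (C1_borel A :: ('a \<Rightarrow> real^'n) measure)"
  shows "intersection_density A g \<rho> \<mu> p =
    zero_density A g (\<lambda>p x. \<Prod>j\<in>UNIV. \<rho> j p (vec (x $ j)))
      (\<lambda>p x. distr (\<Pi>\<^sub>M j\<in>UNIV. \<mu> j p (vec (x $ j))) (C1_borel A) concat_field) p"
proof -
  have v: "(vec 0 :: real^1) = 0" by (simp add: vec_eq_iff)
  show ?thesis
    unfolding intersection_density_def zero_density_def
    using assms by (simp add: v integral_distr)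
qed

lemma jac_change_chart:
  fixes A :: "('a::{t2_space, second_countable_topology}, 'm::finite) chart set"
    and f :: "'a \<Rightarrow> real^'k::finite"
  assumes A: "smooth_manifold A" and c: "c \<in> A" "c' \<in> A" and p: "p \<in> fst c" "p \<in> fst c'"
    and f: "f \<in> C1 A"
  shows "jac c f p = jac c' f p ** jac c (snd c') p"
proof -
  let ?x = "snd c p" and ?T = "snd c' \<circ> chart_inv c"
  have h: "homeomorphism (fst c) (snd c ` fst c) (snd c) (chart_inv c)"
    and h': "homeomorphism (fst c') (snd c' ` fst c') (snd c') (chart_inv c')"
    and o: "open (fst c)" "open (fst c')" "open (snd c ` fst c)" "open (snd c' ` fst c')"
    using A c unfolding smooth_manifold_def is_chart_def by auto
  have inv: "\<And>q. q \<in> fst c \<Longrightarrow> chart_inv c (snd c q) = q"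
    and inv': "\<And>q. q \<in> fst c' \<Longrightarrow> chart_inv c' (snd c' q) = q"
    using h h' by (auto simp: homeomorphism_def)
  let ?S = "snd c ` (fst c \<inter> fst c')"
  have "openin (top_of_set (snd c ` fst c)) ?S"
    using homeomorphism_imp_open_map[OF h, of "fst c \<inter> fst c'"] o by auto
  then have oS: "open ?S" using o openin_open_trans by blast
  have xS: "?x \<in> ?S" using p by auto
  have "Ck_on 1 ?S ?T" using A c unfolding smooth_manifold_def smooth_on_def by blast
  then have "?T differentiable_on ?S" by simp
  then have dT: "?T differentiable (at ?x)"
    using oS xS differentiable_on_eq_differentiable_at by blast
  have Tx: "?T ?x = snd c' p" using p inv by simp
  have "(f \<circ> chart_inv c') differentiable_on (snd c' ` fst c')"
    using f c unfolding C1_def by simp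
  then have df: "(f \<circ> chart_inv c') differentiable (at (?T ?x))"
    using o p Tx by (simp add: differentiable_on_eq_differentiable_at)
  have "((f \<circ> chart_inv c') \<circ> ?T has_derivative
      frechet_derivative (f \<circ> chart_inv c') (at (?T ?x)) \<circ> frechet_derivative ?T (at ?x)) (at ?x)"
    using dT df by (intro diff_chain_at) (simp_all add: frechet_derivative_works[symmetric])
  then have "((f \<circ> chart_inv c) has_derivative
      frechet_derivative (f \<circ> chart_inv c') (at (?T ?x)) \<circ> frechet_derivative ?T (at ?x)) (at ?x)"
    by (rule has_derivative_transform_within_open[OF _ oS xS]) (auto simp: inv inv')
  then have "frechet_derivative (f \<circ> chart_inv c) (at ?x) =
      frechet_derivative (f \<circ> chart_inv c') (at (?T ?x)) \<circ> frechet_derivative ?T (at ?x)"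
    by (rule frechet_derivative_at[symmetric])
  then show ?thesis
    unfolding jac_def Tx
    using matrix_compose[OF linear_frechet_derivative[OF dT]
        linear_frechet_derivative[OF df[unfolded Tx]]]
    by simp
qed

lemma posdef_invertible:
  fixes G :: "real^'m^'m::finite"
  assumes "\<And>v. v \<noteq> 0 \<Longrightarrow> 0 < v \<bullet> (G *v v)"
  shows "invertible G"
proof -
  have "\<And>v. G *v v = 0 \<Longrightarrow> v = 0" using assms by (metis inner_zero_right less_irrefl)
  then show ?thesis
    by (simp add: invertible_left_inverse matrix_left_invertible_ker)
qed

lemma matrix_inv_mult:
  fixes G :: "real^'m^'m::finite"
  assumes "invertible G"
  shows "G ** matrix_inv G = mat 1" and "matrix_inv G ** G = mat 1"
  using someI_ex[OF assms[unfolded invertible_def]] unfolding matrix_inv_def by auto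

lemma wedge_norm_chart_independent:
  fixes A :: "('a::{t2_space, second_countable_topology}, 'm::finite) chart set"
    and f :: "'a \<Rightarrow> real^'k::finite"
  assumes A: "smooth_manifold A" and g: "riemannian_metric A g"
    and c: "c \<in> A" "c' \<in> A" and p: "p \<in> fst c" "p \<in> fst c'" and f: "f \<in> C1 A"
  shows "wedge_norm g c p (jac c f p) = wedge_norm g c' p (jac c' f p)"
proof -
  define T where "T = jac c (snd c') p"
  have D: "jac c f p = jac c' f p ** T"
    unfolding T_def by (rule jac_change_chart[OF A c p f])
  have G: "g c p = transpose T ** g c' p ** T"
    unfolding T_def using g c p unfolding riemannian_metric_def by blast
  have iG: "invertible (g c p)" "invertible (g c' p)"
    using g c p unfolding riemannian_metric_def by (blast intro: posdef_invertible)+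
  have "det (g c p) = det T * det (g c' p) * det T" unfolding G by (simp add: det_mul)
  then have "det T \<noteq> 0" using iG by (auto simp: invertible_det_nz)
  then have iT: "invertible (transpose T)" by (simp add: invertible_det_nz)
  have key: "(transpose T *v a) \<bullet> (matrix_inv (g c p) *v (transpose T *v b)) =
      a \<bullet> (matrix_inv (g c' p) *v b)" for a b
  proof -
    define y where "y = matrix_inv (g c p) *v (transpose T *v b)"
    have "g c p *v y = transpose T *v b"
      unfolding y_def by (simp add: matrix_vector_mul_assoc matrix_mul_assoc matrix_inv_mult iG)
    then have "transpose T *v (g c' p *v (T *v y)) = transpose T *v b"
      unfolding G by (simp add: matrix_vector_mul_assoc matrix_mul_assoc)
    then have "g c' p *v (T *v y) = b"
      using iT by (metis matrix_inv_mult(2) matrix_vector_mul_assoc matrix_vector_mul_lid)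
    then have "T *v y = matrix_inv (g c' p) *v b"
      using iG by (metis matrix_inv_mult(2) matrix_vector_mul_assoc matrix_vector_mul_lid)
    then show ?thesis
      unfolding y_def[symmetric] by (metis dot_lmul_matrix transpose_matrix_vector transpose_transpose)
  qed
  have row: "jac c f p $ i = transpose T *v (jac c' f p $ i)" for i
    unfolding D
    by (simp add: vec_eq_iff matrix_matrix_mult_def matrix_vector_mult_def transpose_def mult.commute)
  show ?thesis
    unfolding wedge_norm_def cotangent_inner_def row key ..
qed

lemma J_chart_independent:
  fixes A :: "('a::{t2_space, second_countable_topology}, 'm::finite) chart set"
    and f :: "'a \<Rightarrow> real^'k::finite"
  assumes "smooth_manifold A" "riemannian_metric A g" "c \<in> A" "p \<in> fst c" "f \<in> C1 A"
  shows "J A g p f = wedge_norm g c p (jac c f p)"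
proof -
  have "(SOME c. c \<in> A \<and> p \<in> fst c) \<in> A \<and> p \<in> fst (SOME c. c \<in> A \<and> p \<in> fst c)"
    using assms by (intro someI[of "\<lambda>c. c \<in> A \<and> p \<in> fst c"]) simp
  then show ?thesis
    unfolding J_def Let_def using assms by (intro wedge_norm_chart_independent) auto
qed

lemma topspace_weak_whitney:
  assumes "smooth_manifold A"
  shows "topspace (weak_whitney A) = C1 A"
proof -
  have "A \<noteq> {}" using assms unfolding smooth_manifold_def by auto
  then obtain c where c: "c \<in> A" by blast
  have "f \<in> \<Union> {whitney_nbhd A f c K e | f c K e.
      f \<in> C1 A \<and> c \<in> A \<and> compact K \<and> K \<subseteq> fst c \<and> 0 < e}" if "f \<in> C1 A" for f
  proof -
    have "f \<in> whitney_nbhd A f c {} 1" using that by (simp add: whitney_nbhd_def)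
    then show ?thesis using that c by (blast intro: compact_empty zero_less_one)
  qed
  then show ?thesis
    unfolding weak_whitney_def topology_generated_by_topspace by (auto simp: whitney_nbhd_def)
qed

end

theory Submission
  imports Defs
begin

text \<open>
  In a chart around $p$, the density at $p$ of the intersection of $m$ independent zero sets with
  common law is a positive constant times $\int |\det(v_1,\dots,v_m)|\, d\lambda(v_1)\cdots
  d\lambda(v_m)$, where $\lambda$ is $\rho(p,0)$ times the image under $f \mapsto d_pf$ of the
  conditional law given that the field vanishes at $p$. Only $|v|\,\lambda(dv)$ is determined by
  the law of the field. It satisfies $\lambda_t = (1-t)\lambda_0 + t\lambda_1$: the corresponding
  identity for the conditional laws given $X(p) = x$ holds for almost every $x$, and both sides
  are continuous at $x = 0$.

  After approximation by finitely supported measures, it remains to see that the polynomial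
  $\sum |\det(v_{i_1},\dots,v_{i_m})|\, z_{i_1}\cdots z_{i_m}$ is log-concave on the positive
  orthant. This is the Brunn--Minkowski inequality for zonotopes, and is proved as in the Bochner
  method for the Alexandrov--Fenchel inequality (equivalently, the theory of Lorentzian
  polynomials): after fixing all but two of the arguments the resulting quadratic form is shown to
  be hyperbolic, by induction on the number of free arguments. In the plane this is the conditional
  negativity of the kernel $|s - t|$. In the inductive step the form becomes, in a weighted inner
  product, a reversible Markov kernel $N$, and the induction hypothesis summed over one argument
  says that $N \le N^2$. So the spectrum of $N$ avoids $(0,1)$; since $1$ is a simple eigenvalue,
  $N$ is nonpositive on the orthogonal complement of the constants.
\<close>

subsection \<open>Reversible kernels and planar determinants\<close>

text \<open>Cut the cotangent space into cells by direction and let \<open>w\<close> list their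
  masses under the norm-weighted law, factor \<open>\<rho> p 0\<close> included. For fine cells the
  intersection density is, up to a constant, a homogeneous polynomial of degree
  \<open>CARD('m)\<close> in \<open>w\<close>. Mixing the fields mixes \<open>w\<close> linearly, so
  the theorem is log-concavity of this polynomial along one segment. The weight by the norm comes
  from homogeneity: the absolute determinant has degree one in each row, so the norms go into the
  measures and a bounded function of directions remains to be approximated. It is also the weight
  for which z-KROK gives finiteness and weak continuity. Concavity on a segment needs the quadratic
  form only against the base point \<open>z\<close> itself. Hence each inductive statement compares
  \<open>x\<close> with \<open>z\<close>: rescaling by \<open>z\<close> turns the base point into
  the constant vector, the eigenvector for 1. An eigenvalue \<open>l\<close> satisfies
  \<open>l \<le> l\<^sup>2\<close>; that 1 is simple is connectivity of the kernel, which comes from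
  basis exchange among the vectors.\<close>

lemma compact_supported_box:
  fixes I :: "'i set" and b :: "'i \<Rightarrow> real"
  shows "compact {u. \<forall>i. u i \<in> (if i \<in> I then {- b i..b i} else {0})}"
proof -
  have "compactin (product_topology (\<lambda>_::'i. euclideanreal) UNIV)
      (PiE UNIV (\<lambda>i. if i \<in> I then {- b i..b i} else {0}))"
    by (auto simp: compactin_PiE)
  then show ?thesis
    by (simp add: euclidean_product_topology PiE_def Pi_def)
qed

text \<open>
  For the inner product weighted by the row sums, \<^term>\<open>N\<close> divided by its row sums is a self-adjoint
  operator, and the last assumption says that it is bounded by its square. The proof maximizes the
  Rayleigh quotient on the complement of the constants.
\<close>

lemma reversible_kernel_hyperbolic:
  fixes N :: "'i \<Rightarrow> 'i \<Rightarrow> real"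
  defines "m \<equiv> \<lambda>I i. \<Sum>j\<in>I. N i j"
  assumes fin: "finite I" and sym: "\<And>i j. N i j = N j i" and nonneg: "\<And>i j. 0 \<le> N i j"
    and pos: "\<And>i. i \<in> I \<Longrightarrow> 0 < m I i"
    and conn: "\<And>i j. i \<in> I \<Longrightarrow> j \<in> I \<Longrightarrow> 0 < N i j \<or> (\<exists>k\<in>I. 0 < N i k \<and> 0 < N j k)"
    and low: "\<And>u. (\<Sum>i\<in>I. \<Sum>j\<in>I. N i j * u i * u j) \<le> (\<Sum>k\<in>I. (\<Sum>j\<in>I. N k j * u j)\<^sup>2 / m I k)"
  shows "(\<Sum>i\<in>I. \<Sum>j\<in>I. N i j * u i * u j) * (\<Sum>i\<in>I. m I i) \<le> (\<Sum>i\<in>I. m I i * u i)\<^sup>2"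
proof -
  define Q where "Q = (\<lambda>u v. \<Sum>i\<in>I. \<Sum>j\<in>I. N i j * u i * v j)"
  define E where "E = (\<lambda>u v. \<Sum>i\<in>I. m I i * u i * v i)"
  define L where "L = (\<lambda>u. \<Sum>i\<in>I. m I i * u i)"
  have Q_sym: "Q u v = Q v u" for u v
    unfolding Q_def by (subst sum.swap) (intro sum.cong refl, simp add: sym mult_ac)
  have Q_const: "Q u (\<lambda>_. c) = c * L u" for u c
    unfolding Q_def L_def m_def sum_distrib_left sum_distrib_right
    by (intro sum.cong refl) (simp add: mult_ac)
  have Q_add: "Q (\<lambda>i. u i + c * v i) (\<lambda>i. u i + c * v i) = Q u u + 2 * c * Q u v + c\<^sup>2 * Q v v" for u v c
  proof -
    have "Q (\<lambda>i. u i + c * v i) (\<lambda>i. u i + c * v i) = Q u u + c * Q u v + c * Q v u + c\<^sup>2 * Q v v"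
      unfolding Q_def sum_distrib_left sum.distrib[symmetric]
      by (intro sum.cong refl) (simp add: algebra_simps power2_eq_square)
    then show ?thesis using Q_sym[of v u] by simp
  qed
  have E_add: "E (\<lambda>i. u i + c * v i) (\<lambda>i. u i + c * v i) = E u u + 2 * c * E u v + c\<^sup>2 * E v v" for u v c
    unfolding E_def sum_distrib_left sum.distrib[symmetric]
    by (intro sum.cong refl) (simp add: algebra_simps power2_eq_square)
  have L_add: "L (\<lambda>i. u i + c * v i) = L u + c * L v" for u v c
    unfolding L_def sum_distrib_left sum.distrib[symmetric]
    by (intro sum.cong refl) (simp add: algebra_simps)
  \<comment> \<open>Dirichlet form of the chain. It gives \<open>Q \<le> E\<close>, so no eigenvalue
    exceeds 1, and its vanishing characterizes the eigenvectors for 1.\<close>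
  have E_diff: "E u u - Q u u = (\<Sum>i\<in>I. \<Sum>j\<in>I. N i j * (u i - u j)\<^sup>2) / 2" for u
  proof -
    have 1: "E u u = (\<Sum>i\<in>I. \<Sum>j\<in>I. N i j * (u i)\<^sup>2)"
      unfolding E_def m_def sum_distrib_right
      by (intro sum.cong refl) (simp add: power2_eq_square mult_ac)
    have 2: "E u u = (\<Sum>i\<in>I. \<Sum>j\<in>I. N i j * (u j)\<^sup>2)"
      unfolding 1 by (subst sum.swap) (intro sum.cong refl, simp add: sym)
    have "(\<Sum>i\<in>I. \<Sum>j\<in>I. N i j * (u i - u j)\<^sup>2) =
        (\<Sum>i\<in>I. \<Sum>j\<in>I. N i j * (u i)\<^sup>2) + (\<Sum>i\<in>I. \<Sum>j\<in>I. N i j * (u j)\<^sup>2) - 2 * Q u u"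
      unfolding Q_def sum_distrib_left sum.distrib[symmetric] sum_subtractf[symmetric]
      by (intro sum.cong refl) (simp add: algebra_simps power2_eq_square)
    then show ?thesis using 1 2 by simp
  qed
  have E_term: "0 \<le> m I i * u i * u i" if "i \<in> I" for u i
    using pos[OF that] by (simp add: mult.assoc)
  have neg: "Q w w \<le> 0" if L0: "L w = 0" for w
  proof (rule ccontr)
    assume "\<not> Q w w \<le> 0"
    then have Qw: "0 < Q w w" by simp
    \<comment> \<open>The index type may be infinite, so vectors are cut off outside
      \<open>I\<close>; the resulting box is compact by Tychonoff. Its bound is forced by
      \<open>E u u = 1\<close>, which makes each \<open>m I i * u i * u i\<close> at most 1.\<close>
    define C where "C = {u. \<forall>i. u i \<in> (if i \<in> I then {- sqrt (1 / m I i)..sqrt (1 / m I i)} else {0})}"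
    define S where "S = C \<inter> ({u. E u u = 1} \<inter> {u. L u = 0})"
    have co: "continuous_on UNIV (\<lambda>u. u i)" for i :: 'i
      by (rule continuous_on_product_coordinates)
    have "closed ({u. E u u = 1} \<inter> {u. L u = 0})"
      unfolding E_def L_def
      by (intro closed_Int closed_Collect_eq continuous_intros co)
    then have "compact S"
      unfolding S_def C_def by (intro compact_Int_closed compact_supported_box)
    have Q_le_E: "Q u u \<le> E u u" for u
    proof -
      have "0 \<le> (\<Sum>i\<in>I. \<Sum>j\<in>I. N i j * (u i - u j)\<^sup>2)"
        by (intro sum_nonneg) (simp add: nonneg)
      then show ?thesis using E_diff[of u] by linarith
    qed
    have S_I: "u \<in> S" if "\<And>i. i \<notin> I \<Longrightarrow> u i = 0" "E u u = 1" "L u = 0" for u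
    proof -
      have "\<bar>u i\<bar> \<le> sqrt (1 / m I i)" if i: "i \<in> I" for i
      proof -
        have "m I i * u i * u i \<le> E u u"
          unfolding E_def using i fin
          by (intro member_le_sum) (auto intro: E_term)
        then have "(u i)\<^sup>2 \<le> 1 / m I i"
          using pos[OF i] \<open>E u u = 1\<close> by (simp add: field_simps power2_eq_square)
        then show ?thesis using real_le_rsqrt[of "\<bar>u i\<bar>"] by simp
      qed
      then show ?thesis using that by (auto simp: S_def C_def abs_le_iff minus_le_iff)
    qed
    \<comment> \<open>Competitors need not vanish off \<open>I\<close>; cutting them off changes
      none of the forms, which see only the values on \<open>I\<close>.\<close>
    define res where "res = (\<lambda>c u i. if i \<in> I then c * u i else (0::real))"
    have E_res: "E (res c u) (res c u) = c\<^sup>2 * E u u" and Q_res: "Q (res c u) (res c u) = c\<^sup>2 * Q u u"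
      and L_res: "L (res c u) = c * L u" for c u
      unfolding E_def Q_def L_def sum_distrib_left
      by (auto intro!: sum.cong simp: power2_eq_square res_def)
    have scaled: "res (1 / sqrt (E u u)) u \<in> S" if "0 < E u u" "L u = 0" for u
    proof (rule S_I)
      show "E (res (1 / sqrt (E u u)) u) (res (1 / sqrt (E u u)) u) = 1"
        unfolding E_res using that by (simp add: power_divide)
    qed (use that in \<open>auto simp: L_res, simp add: res_def\<close>)
    have Ew: "0 < E w w" using Qw Q_le_E[of w] by linarith
    then have "S \<noteq> {}" using scaled[of w] L0 by blast
    moreover have "continuous_on S (\<lambda>u. Q u u)"
      unfolding Q_def
      by (intro continuous_intros continuous_on_subset[OF co]) auto
    ultimately obtain u where u: "u \<in> S" and max: "\<And>v. v \<in> S \<Longrightarrow> Q v v \<le> Q u u"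
      using continuous_attains_sup[OF \<open>compact S\<close>] by blast
    have Eu: "E u u = 1" and Lu: "L u = 0" using u by (auto simp: S_def)
    define l where "l = Q u u"
    have bound: "Q v v \<le> l * E v v" if "L v = 0" for v
    proof (cases "0 < E v v")
      case True
      have "Q (res (1 / sqrt (E v v)) v) (res (1 / sqrt (E v v)) v) \<le> l"
        unfolding l_def using scaled[OF True that] by (rule max)
      then show ?thesis unfolding Q_res using True by (simp add: power_divide field_simps)
    next
      case False
      moreover have "0 \<le> E v v"
        unfolding E_def by (intro sum_nonneg E_term)
      ultimately show ?thesis using Q_le_E[of v] by simp
    qed
    have l0: "0 < l" using bound[OF L0] Qw Ew by (smt (verit) mult_nonpos_nonneg)
    have l1: "l \<le> 1" using Q_le_E[of u] Eu by (simp add: l_def)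
    have stat: "Q u v = l * E u v" if v: "L v = 0" for v
    proof -
      have *: "2 * c * (Q u v - l * E u v) + c\<^sup>2 * (Q v v - l * E v v) \<le> 0" for c
      proof -
        have "Q (\<lambda>i. u i + c * v i) (\<lambda>i. u i + c * v i) \<le> l * E (\<lambda>i. u i + c * v i) (\<lambda>i. u i + c * v i)"
          by (rule bound) (simp add: L_add Lu v)
        then show ?thesis unfolding Q_add E_add Eu l_def[symmetric] by (simp add: algebra_simps)
      qed
      \<comment> \<open>First variation at the maximizer: \<open>B\<close> is the linear and
        \<open>D\<close> the quadratic coefficient in \<open>c\<close>. The choice
        \<open>c = B / (D + 1)\<close> lets the linear term win unless \<open>B = 0\<close>; the
        added 1 keeps the denominator positive when \<open>D = 0\<close>.\<close>
      define B where "B = Q u v - l * E u v"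
      define D where "D = l * E v v - Q v v"
      have D: "0 \<le> D" using bound[OF v] by (simp add: D_def)
      have "2 * c * B \<le> c\<^sup>2 * D" for c
        using *[of c] by (simp add: B_def D_def algebra_simps)
      from this[of "B / (D + 1)"] have "2 * B\<^sup>2 / (D + 1) \<le> B\<^sup>2 / (D + 1) * (D / (D + 1))"
        by (simp add: power2_eq_square)
      also have "\<dots> \<le> B\<^sup>2 / (D + 1) * 1"
        using D by (intro mult_left_mono) auto
      finally have "B\<^sup>2 / (D + 1) \<le> 0" by simp
      then have "B = 0" using D by (auto simp: field_simps power2_eq_square divide_le_0_iff mult_le_0_iff)
      then show ?thesis by (simp add: B_def)
    qed
    \<comment> \<open>The normalized kernel applied to \<open>u\<close>. It is again orthogonal to
      the constants, so stationarity can be tested against the residual \<open>r = a - l * u\<close>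
      itself. This yields \<open>E r r = 0\<close>, so \<open>u\<close> is an eigenvector on
      \<open>I\<close>.\<close>
    define a where "a = (\<lambda>k. (\<Sum>j\<in>I. N k j * u j) / m I k)"
    have Ea: "E v a = Q v u" for v
      unfolding E_def Q_def a_def
    proof (intro sum.cong refl)
      fix i assume "i \<in> I"
      then have "m I i * v i * ((\<Sum>j\<in>I. N i j * u j) / m I i) = v i * (\<Sum>j\<in>I. N i j * u j)"
        using pos[of i] by simp
      then show "m I i * v i * ((\<Sum>j\<in>I. N i j * u j) / m I i) = (\<Sum>j\<in>I. N i j * v i * u j)"
        by (simp add: sum_distrib_left mult_ac)
    qed
    have "L a = E (\<lambda>_. 1) a" by (simp add: E_def L_def)
    then have La: "L a = 0" using Ea Q_const[of u 1] Q_sym Lu by simp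
    define r where "r = (\<lambda>i. a i + (- l) * u i)"
    have "Q u r = l * E u r" by (rule stat) (use L_add[of a "- l" u] La Lu in \<open>simp add: r_def\<close>)
    moreover have "Q u r = E r a" using Ea Q_sym by simp
    moreover have "E r r = E r a - l * E u r"
      unfolding E_def r_def sum_distrib_left sum_subtractf[symmetric]
      by (intro sum.cong refl) (simp add: algebra_simps)
    ultimately have "E r r = 0" by simp
    then have "\<forall>i\<in>I. m I i * r i * r i = 0"
      unfolding E_def using fin E_term by (subst (asm) sum_nonneg_eq_0_iff) auto
    then have ai: "a i = l * u i" if "i \<in> I" for i
      using that pos[OF that] by (auto simp: r_def)
    \<comment> \<open>On an eigenvector the assumption \<open>low\<close> reads
      \<open>l \<le> l\<^sup>2\<close>; with \<open>0 < l \<le> 1\<close> only \<open>l = 1\<close>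
      is left.\<close>
    have "l \<le> (\<Sum>k\<in>I. (\<Sum>j\<in>I. N k j * u j)\<^sup>2 / m I k)"
      using low[of u] by (simp add: l_def Q_def)
    also have "\<dots> = (\<Sum>k\<in>I. l\<^sup>2 * (m I k * u k * u k))"
    proof (intro sum.cong refl)
      fix k assume k: "k \<in> I"
      then have "(\<Sum>j\<in>I. N k j * u j) = l * u k * m I k"
        using ai[OF k] pos[OF k] by (simp add: a_def field_simps)
      then show "(\<Sum>j\<in>I. N k j * u j)\<^sup>2 / m I k = l\<^sup>2 * (m I k * u k * u k)"
        using pos[OF k] by (simp add: power2_eq_square field_simps)
    qed
    also have "\<dots> = l\<^sup>2" using Eu by (simp add: E_def sum_distrib_left[symmetric])
    finally have "1 \<le> l" using l0 by (simp add: power2_eq_square)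
    then have "E u u - Q u u = 0" using l1 Eu by (simp add: l_def)
    \<comment> \<open>A vanishing Dirichlet form makes \<open>u\<close> constant along edges, hence
      constant by \<open>conn\<close>, hence zero by \<open>L u = 0\<close>, contradicting
      \<open>E u u = 1\<close>.\<close>
    then have "(\<Sum>i\<in>I. \<Sum>j\<in>I. N i j * (u i - u j)\<^sup>2) = 0" using E_diff by simp
    then have "\<forall>i\<in>I. \<forall>j\<in>I. N i j * (u i - u j)\<^sup>2 = 0"
      using fin nonneg by (simp add: sum_nonneg_eq_0_iff sum_nonneg)
    then have eq: "u i = u j" if "i \<in> I" "j \<in> I" "0 < N i j" for i j
      using that by (metis eq_iff_diff_eq_0 less_irrefl mult_eq_0_iff zero_eq_power2)
    have const: "u i = u j" if "i \<in> I" "j \<in> I" for i j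
      using conn[OF that] eq that by metis
    have "I \<noteq> {}" using Eu by (auto simp: E_def)
    then obtain i0 where i0: "i0 \<in> I" by blast
    have "L u = (\<Sum>i\<in>I. m I i) * u i0"
      unfolding L_def sum_distrib_right by (intro sum.cong refl) (use const[OF _ i0] in simp)
    moreover have "0 < (\<Sum>i\<in>I. m I i)" using fin pos \<open>I \<noteq> {}\<close> by (intro sum_pos) auto
    ultimately have "u i0 = 0" using Lu by simp
    then have "u i = 0" if "i \<in> I" for i using const[OF that i0] by simp
    then have "E u u = 0" by (simp add: E_def)
    then show False using Eu by simp
  qed
  define s where "s = (\<Sum>i\<in>I. m I i)"
  show ?thesis
  proof (cases "I = {}")
    case False
    then have s: "0 < s" unfolding s_def using fin pos by (intro sum_pos) auto
    \<comment> \<open>Adding \<open>c\<close> subtracts the weighted mean, projecting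
      \<open>u\<close> onto the complement of the constants.\<close>
    define c where "c = - (L u / s)"
    have L1: "L (\<lambda>_. 1) = s" by (simp add: L_def s_def)
    have "Q (\<lambda>i. u i + c * 1) (\<lambda>i. u i + c * 1) \<le> 0"
      by (rule neg) (use s in \<open>simp only: L_add[of u c "\<lambda>_. 1"] L1, simp add: c_def\<close>)
    then have "Q u u + 2 * c * L u + c\<^sup>2 * s \<le> 0"
      using Q_add[of u c "\<lambda>_. 1"] Q_const[of u 1] Q_const[of "\<lambda>_. 1" 1] L1 by simp
    then have "Q u u * s \<le> (L u)\<^sup>2"
      using s by (simp add: c_def field_simps power2_eq_square)
    then show ?thesis by (simp add: Q_def L_def s_def)
  qed simp
qed

text \<open>The kernel is the Gram matrix of the indicators of the intervals from 0 to
  \<open>a i\<close>. The induction peels off layers: the lowest one, of height \<open>c\<close>,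
  contributes \<open>c\<close> times a square, after which the index attaining the minimum has a
  zero row and drops out.\<close>

lemma min_kernel_psd:
  fixes a \<xi> :: "'i \<Rightarrow> real"
  assumes "finite I" and "\<And>i. i \<in> I \<Longrightarrow> 0 \<le> a i"
  shows "0 \<le> (\<Sum>i\<in>I. \<Sum>j\<in>I. \<xi> i * \<xi> j * min (a i) (a j))"
  using assms
proof (induction I arbitrary: a rule: finite_psubset_induct)
  case (psubset I)
  show ?case
  proof (cases "I = {}")
    case False
    define c where "c = Min (a ` I)"
    have "c \<in> a ` I" unfolding c_def using psubset.hyps False by (intro Min_in) auto
    then obtain k where k: "k \<in> I" "a k = c" by auto
    have c: "c \<le> a i" if "i \<in> I" for i using that psubset.hyps by (simp add: c_def)
    let ?f = "\<lambda>i j. \<xi> i * \<xi> j * min (a i - c) (a j - c)"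
    have sq: "c * (\<Sum>i\<in>I. \<xi> i)\<^sup>2 = (\<Sum>i\<in>I. \<Sum>j\<in>I. c * (\<xi> i * \<xi> j))"
      unfolding power2_eq_square sum_product unfolding sum_distrib_left ..
    have "(\<Sum>i\<in>I. \<Sum>j\<in>I. \<xi> i * \<xi> j * min (a i) (a j)) =
        c * (\<Sum>i\<in>I. \<xi> i)\<^sup>2 + (\<Sum>i\<in>I. \<Sum>j\<in>I. ?f i j)"
      unfolding sq sum.distrib[symmetric]
      by (intro sum.cong refl) (simp add: algebra_simps min_def)
    moreover have "(\<Sum>i\<in>I. \<Sum>j\<in>I. ?f i j) = (\<Sum>i\<in>I - {k}. \<Sum>j\<in>I - {k}. ?f i j)"
    proof -
      have "(\<Sum>j\<in>I. ?f i j) = (\<Sum>j\<in>I - {k}. ?f i j)" if "i \<in> I" for i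
        using psubset.hyps k c[OF that] by (simp add: sum.remove)
      moreover have "(\<Sum>j\<in>I. ?f k j) = 0"
        using k c by (intro sum.neutral) auto
      ultimately show ?thesis using psubset.hyps k by (simp add: sum.remove)
    qed
    moreover have "0 \<le> (\<Sum>i\<in>I - {k}. \<Sum>j\<in>I - {k}. ?f i j)"
      using k c by (intro psubset.IH) auto
    moreover have "0 \<le> c" using k psubset.prems by auto
    ultimately show ?thesis by simp
  qed simp
qed

text \<open>Since \<open>\<bar>s - t\<bar> = s + t - 2 * min s t\<close>, and the terms in one
  variable alone are killed by \<open>sum0\<close>, this is positivity of the min kernel.\<close>

lemma abs_diff_conditionally_negative:
  fixes \<tau> \<xi> :: "'i \<Rightarrow> real"
  assumes fin: "finite I" and sum0: "(\<Sum>i\<in>I. \<xi> i) = 0"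
  shows "(\<Sum>i\<in>I. \<Sum>j\<in>I. \<xi> i * \<xi> j * \<bar>\<tau> i - \<tau> j\<bar>) \<le> 0"
proof -
  \<comment> \<open>The shift makes all points nonnegative, as the min kernel requires, and
    preserves differences. The inserted 0 covers empty \<open>I\<close>.\<close>
  define c where "c = Min (insert 0 (\<tau> ` I))"
  have c: "c \<le> \<tau> i" if "i \<in> I" for i using that fin by (simp add: c_def)
  have "(\<Sum>i\<in>I. \<Sum>j\<in>I. \<xi> i * \<xi> j * \<bar>\<tau> i - \<tau> j\<bar>) =
      (\<Sum>i\<in>I. \<Sum>j\<in>I. (\<xi> i * (\<tau> i - c)) * \<xi> j) + (\<Sum>i\<in>I. \<Sum>j\<in>I. \<xi> i * (\<xi> j * (\<tau> j - c)))
      - 2 * (\<Sum>i\<in>I. \<Sum>j\<in>I. \<xi> i * \<xi> j * min (\<tau> i - c) (\<tau> j - c))"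
    unfolding sum_distrib_left sum.distrib[symmetric] sum_subtractf[symmetric]
    by (intro sum.cong refl) (simp add: algebra_simps min_def abs_if)
  also have "\<dots> = - 2 * (\<Sum>i\<in>I. \<Sum>j\<in>I. \<xi> i * \<xi> j * min (\<tau> i - c) (\<tau> j - c))"
    unfolding sum_product[symmetric] sum0 by simp
  finally show ?thesis
    using min_kernel_psd[OF fin, of "\<lambda>i. \<tau> i - c" \<xi>] c by simp
qed

text \<open>A reversed Cauchy--Schwarz inequality. It suffices that the form is nonpositive on a
  hyperplane which \<open>x\<close> reaches by subtracting a multiple of \<open>y\<close>. The
  kernel of one row of \<open>K\<close> serves: there the form turns into that of
  \<open>\<bar>s - t\<bar>\<close> evaluated at slopes.\<close>

lemma planar_det_hyperbolic:
  fixes a b x y :: "'i \<Rightarrow> real"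
  defines "K \<equiv> \<lambda>i j. \<bar>a i * b j - b i * a j\<bar>"
  assumes fin: "finite I" and y: "\<And>i. i \<in> I \<Longrightarrow> 0 \<le> y i"
  shows "(\<Sum>i\<in>I. \<Sum>j\<in>I. K i j * x i * x j) * (\<Sum>i\<in>I. \<Sum>j\<in>I. K i j * y i * y j)
      \<le> (\<Sum>i\<in>I. \<Sum>j\<in>I. K i j * x i * y j)\<^sup>2"
proof -
  define Q where "Q = (\<lambda>u v. \<Sum>i\<in>I. \<Sum>j\<in>I. K i j * u i * v j)"
  have K_sym: "K i j = K j i" for i j
    unfolding K_def by (subst abs_minus_commute) (simp add: mult.commute)
  have Q_sym: "Q u v = Q v u" for u v
    unfolding Q_def by (subst sum.swap) (intro sum.cong refl, simp add: K_sym mult_ac)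
  have neg: "Q w w \<le> 0" if k: "a k \<noteq> 0 \<or> b k \<noteq> 0" and w: "(\<Sum>j\<in>I. K k j * w j) = 0" for k w
  proof -
    \<comment> \<open>Coordinates adapted to the \<open>k\<close>-th vector: \<open>p\<close> and
      \<open>s\<close> are the components along it and across it, scaled by its length, and
      \<open>n\<close> is its squared length. In particular
      \<open>\<bar>s j\<bar> = K k j\<close>.\<close>
    define n where "n = (a k)\<^sup>2 + (b k)\<^sup>2"
    define s where "s = (\<lambda>i. a k * b i - b k * a i)"
    define p where "p = (\<lambda>i. a k * a i + b k * b i)"
    have n: "0 < n" using k by (simp add: n_def sum_power2_gt_zero_iff)
    have w0: "(\<Sum>j\<in>I. \<bar>s j\<bar> * w j) = 0" using w by (simp add: K_def s_def)
    have K_eq: "K i j = \<bar>p i * s j - s i * p j\<bar> / n" for i j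
    proof -
      have "n * (a i * b j - b i * a j) = p i * s j - s i * p j"
        by (simp add: n_def p_def s_def power2_eq_square algebra_simps)
      then have "a i * b j - b i * a j = (p i * s j - s i * p j) / n"
        using n by (simp add: field_simps)
      then show ?thesis using n by (simp add: K_def)
    qed
    \<comment> \<open>For vectors with slopes, \<open>K i j\<close> is \<open>\<bar>s i\<bar> *
      \<bar>s j\<bar> * \<bar>\<tau> i - \<tau> j\<bar> / n\<close>. Vectors parallel to the
      \<open>k\<close>-th one have no slope and enter through \<open>h\<close>; their cross terms
      vanish because \<open>\<xi>\<close> sums to zero.\<close>
    define \<xi> where "\<xi> = (\<lambda>i. \<bar>s i\<bar> * w i)"
    define \<tau> where "\<tau> = (\<lambda>i. p i / s i)"
    define h where "h = (\<lambda>i. if s i = 0 then \<bar>p i\<bar> * w i else 0)"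
    have "K i j * w i * w j = (\<xi> i * \<xi> j * \<bar>\<tau> i - \<tau> j\<bar> + h i * \<xi> j + \<xi> i * h j) / n" for i j
    proof (cases "s i = 0 \<or> s j = 0")
      case True
      then show ?thesis by (auto simp: K_eq \<xi>_def h_def abs_mult)
    next
      case False
      then have "p i * s j - s i * p j = s i * s j * (\<tau> i - \<tau> j)" by (simp add: \<tau>_def field_simps)
      then show ?thesis using False by (simp add: K_eq \<xi>_def h_def abs_mult)
    qed
    then have "Q w w = ((\<Sum>i\<in>I. \<Sum>j\<in>I. \<xi> i * \<xi> j * \<bar>\<tau> i - \<tau> j\<bar>)
        + (\<Sum>i\<in>I. \<Sum>j\<in>I. h i * \<xi> j) + (\<Sum>i\<in>I. \<Sum>j\<in>I. \<xi> i * h j)) / n"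
      by (simp add: Q_def sum_divide_distrib sum.distrib add_divide_distrib)
    also have "\<dots> = (\<Sum>i\<in>I. \<Sum>j\<in>I. \<xi> i * \<xi> j * \<bar>\<tau> i - \<tau> j\<bar>) / n"
      unfolding sum_product[symmetric] using w0 by (simp add: \<xi>_def)
    also have "\<dots> \<le> 0"
      using abs_diff_conditionally_negative[OF fin, of \<xi> \<tau>] w0 n
      by (simp add: \<xi>_def divide_le_0_iff)
    finally show ?thesis .
  qed
  have "Q x x * Q y y \<le> (Q x y)\<^sup>2"
  proof (cases "Q y y = 0")
    case False
    have "Q y y = (\<Sum>i\<in>I. y i * (\<Sum>j\<in>I. K i j * y j))"
      by (simp add: Q_def sum_distrib_left mult_ac)
    then obtain k where k: "k \<in> I" "(\<Sum>j\<in>I. K k j * y j) \<noteq> 0"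
      using False by (metis (no_types, lifting) mult_zero_right sum.neutral)
    have "a k \<noteq> 0 \<or> b k \<noteq> 0" using k by (auto simp: K_def)
    \<comment> \<open>Chosen so that \<open>x - c * y\<close> is annihilated by row
      \<open>k\<close>.\<close>
    moreover define c where "c = (\<Sum>j\<in>I. K k j * x j) / (\<Sum>j\<in>I. K k j * y j)"
    moreover have "(\<Sum>j\<in>I. K k j * (x j - c * y j)) = (\<Sum>j\<in>I. K k j * x j) - c * (\<Sum>j\<in>I. K k j * y j)"
      unfolding sum_distrib_left sum_subtractf[symmetric]
      by (intro sum.cong refl) (simp add: algebra_simps)
    ultimately have "Q (\<lambda>j. x j - c * y j) (\<lambda>j. x j - c * y j) \<le> 0"
      using k by (intro neg[of k]) auto
    moreover have "Q (\<lambda>j. x j - c * y j) (\<lambda>j. x j - c * y j) =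
        Q x x - c * Q x y - c * Q y x + c\<^sup>2 * Q y y"
      unfolding Q_def sum_distrib_left sum.distrib[symmetric] sum_subtractf[symmetric]
      by (intro sum.cong refl) (simp add: algebra_simps power2_eq_square)
    moreover have Qy: "0 < Q y y"
      using False y by (auto simp: Q_def K_def less_le intro!: sum_nonneg)
    ultimately have "Q x x * Q y y \<le> (2 * c * Q x y - c\<^sup>2 * Q y y) * Q y y"
      using Q_sym[of y x] by (intro mult_right_mono) auto
    also have "\<dots> = (Q x y)\<^sup>2 - (Q x y - c * Q y y)\<^sup>2"
      by (simp add: algebra_simps power2_eq_square)
    finally show ?thesis by (simp add: order_trans)
  qed simp
  then show ?thesis by (simp add: Q_def)
qed

subsection \<open>Hyperbolicity of iterated sums\<close>

text \<open>For permutation-invariant \<open>T\<close> and \<open>K\<close> in \<open>I\<close>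
  these are polarizations: with \<open>N = n + length K\<close>, the partial derivative of the
  polynomial \<open>multisum I z T N []\<close> in the variables listed in \<open>K\<close> is
  \<open>fact N / fact n\<close> times \<open>multisum I z T n K\<close>.\<close>

primrec multisum ::
    "'i set \<Rightarrow> ('i \<Rightarrow> real) \<Rightarrow> ('i list \<Rightarrow> real) \<Rightarrow> nat \<Rightarrow> 'i list \<Rightarrow> real" where
  "multisum I z T 0 K = T K"
| "multisum I z T (Suc n) K = (\<Sum>i\<in>I. z i * multisum I z T n (i # K))"

lemma multisum_mset_cong:
  assumes "\<And>xs ys. mset xs = mset ys \<Longrightarrow> T xs = T ys" and "mset K = mset K'"
  shows "multisum I z T n K = multisum I z T n K'"
  using assms(2) by (induction n arbitrary: K K') (auto intro!: assms(1) sum.cong arg_cong2[where f = "(*)"])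

lemma multisum_nonneg:
  assumes "\<And>xs. 0 \<le> T xs" and "\<And>i. 0 \<le> z i"
  shows "0 \<le> multisum I z T n K"
  using assms by (induction n arbitrary: K) (auto intro!: sum_nonneg)

text \<open>For positive weights positivity depends on the support of \<open>T\<close> alone. Thus
  it becomes a statement about lists, to which exchange applies, and it holds on a whole segment
  once it holds at one point.\<close>

lemma multisum_pos_iff:
  assumes fin: "finite I" and T: "\<And>xs. 0 \<le> T xs" and z: "\<And>i. 0 < z i"
  shows "0 < multisum I z T n K \<longleftrightarrow> (\<exists>L. set L \<subseteq> I \<and> length L = n \<and> 0 < T (L @ K))"
proof (induction n arbitrary: K)
  case (Suc n)
  have S: "0 \<le> multisum I z T n K" for K
    by (intro multisum_nonneg T less_imp_le[OF z])
  have "0 < multisum I z T (Suc n) K \<longleftrightarrow> (\<exists>i\<in>I. 0 < multisum I z T n (i # K))"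
  proof
    assume "0 < multisum I z T (Suc n) K"
    then obtain i where "i \<in> I" "z i * multisum I z T n (i # K) \<noteq> 0"
      using sum.neutral[of I "\<lambda>i. z i * multisum I z T n (i # K)"] by auto
    then show "\<exists>i\<in>I. 0 < multisum I z T n (i # K)"
      using S[of "i # K"] by (intro bexI[of _ i]) auto
  next
    assume "\<exists>i\<in>I. 0 < multisum I z T n (i # K)"
    then obtain i where "i \<in> I" "0 < z i * multisum I z T n (i # K)" using z by auto
    moreover have "z i * multisum I z T n (i # K) \<le> multisum I z T (Suc n) K"
      using \<open>i \<in> I\<close> fin S less_imp_le[OF z] unfolding multisum.simps
      by (intro member_le_sum) auto
    ultimately show "0 < multisum I z T (Suc n) K" by linarith
  qed
  also have "\<dots> \<longleftrightarrow> (\<exists>i\<in>I. \<exists>L. set L \<subseteq> I \<and> length L = n \<and> 0 < T ((L @ [i]) @ K))"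
    by (simp add: Suc.IH)
  also have "\<dots> \<longleftrightarrow> (\<exists>L. set L \<subseteq> I \<and> length L = Suc n \<and> 0 < T (L @ K))"
  proof safe
    fix L assume "set L \<subseteq> I" "length L = Suc n" "0 < T (L @ K)"
    moreover then obtain L' i where "L = L' @ [i]" by (cases L rule: rev_cases) auto
    ultimately show "\<exists>i\<in>I. \<exists>L. set L \<subseteq> I \<and> length L = n \<and> 0 < T ((L @ [i]) @ K)" by auto
  next
    fix i L assume "i \<in> I" "set L \<subseteq> I" "n = length L" "0 < T ((L @ [i]) @ K)"
    then show "\<exists>La. set La \<subseteq> I \<and> length La = Suc (length L) \<and> 0 < T (La @ K)"
      by (intro exI[of _ "L @ [i]"]) auto
  qed
  finally show ?case .
qed simp

text \<open>\<open>base\<close> is the case of two free arguments, and \<open>exch\<close> supplies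
  the connectivity of the kernel. Freezing one more argument \<open>k\<close> gives an instance of
  the induction hypothesis. Summed over \<open>k\<close> with weights \<open>z k\<close>, these
  instances bound the kernel by its square, because one more free argument is exactly such a
  weighted sum.\<close>

lemma multisum_hyperbolic:
  fixes T :: "'i list \<Rightarrow> real"
  assumes fin: "finite I" and T: "\<And>xs. 0 \<le> T xs" and z: "\<And>i. 0 < z i"
    and perm: "\<And>xs ys. mset xs = mset ys \<Longrightarrow> T xs = T ys"
    and base: "\<And>K x. set K \<subseteq> I \<Longrightarrow> length K + 2 = m \<Longrightarrow>
      (\<Sum>i\<in>I. \<Sum>j\<in>I. T (i # j # K) * x i * x j) * (\<Sum>i\<in>I. \<Sum>j\<in>I. T (i # j # K) * z i * z j)
      \<le> (\<Sum>i\<in>I. \<Sum>j\<in>I. T (i # j # K) * x i * z j)\<^sup>2"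
    and exch: "\<And>K i j L L'. length L = length L' \<Longrightarrow> length L + length K + 1 = m \<Longrightarrow>
      set L \<subseteq> I \<Longrightarrow> 0 < T (L @ i # K) \<Longrightarrow> 0 < T (L' @ j # K) \<Longrightarrow>
      0 < T (L @ j # K) \<or> (\<exists>L''. set L'' \<subseteq> I \<and> Suc (length L'') = length L \<and> 0 < T (L'' @ i # j # K))"
    and K: "set K \<subseteq> I" "length K + n + 2 = m"
  shows "(\<Sum>i\<in>I. \<Sum>j\<in>I. multisum I z T n (i # j # K) * x i * x j) * multisum I z T (Suc (Suc n)) K
      \<le> (\<Sum>i\<in>I. x i * multisum I z T (Suc n) (i # K))\<^sup>2"
  using K
proof (induction n arbitrary: K x)
  case 0
  have "T (j # i # K) = T (i # j # K)" for i j by (rule perm) simp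
  then show ?case
    using base[of K x] 0 by (simp add: sum_distrib_left mult_ac)
next
  case (Suc n)
  define S where "S = multisum I z T"
  have S_Suc: "S (Suc n) L = (\<Sum>i\<in>I. z i * S n (i # L))" for n L by (simp add: S_def)
  have S_nn: "0 \<le> S n L" for n L
    unfolding S_def by (intro multisum_nonneg T less_imp_le[OF z])
  have S_perm: "mset L = mset L' \<Longrightarrow> S n L = S n L'" for n L L'
    unfolding S_def by (rule multisum_mset_cong[OF perm])
  have S_pos: "0 < S n L \<longleftrightarrow> (\<exists>L'. set L' \<subseteq> I \<and> length L' = n \<and> 0 < T (L' @ L))" for n L
    unfolding S_def by (rule multisum_pos_iff[OF fin T z])
  have S0: "S n (i # L) = 0" if "S (Suc n) L = 0" "i \<in> I" for n L i
  proof -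
    have "\<forall>i\<in>I. z i * S n (i # L) = 0"
      using that(1) fin S_nn less_imp_le[OF z] by (simp add: S_Suc sum_nonneg_eq_0_iff)
    then show ?thesis using that(2) z[of i] by auto
  qed
  have sw: "S n (i # j # L) = S n (j # i # L)" for n i j L by (rule S_perm) simp
  \<comment> \<open>The kernel is normalized by its row sums, so indices with zero row sum are
    dropped. By nonnegativity all entries of such rows vanish, and no sum changes.\<close>
  define J where "J = {i \<in> I. 0 < S (Suc (Suc n)) (i # K)}"
  have J: "J \<subseteq> I" "finite J" using fin by (auto simp: J_def)
  have notJ: "S (Suc (Suc n)) (i # K) = 0" if "i \<in> I - J" for i
    using that S_nn[of "Suc (Suc n)" "i # K"] by (auto simp: J_def)
  define N where "N = (\<lambda>i j. z i * z j * S (Suc n) (i # j # K))"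
  have N_sym: "N i j = N j i" for i j by (simp add: N_def sw[of _ i j] mult_ac)
  have N0: "N i j = 0" if "i \<in> I - J" "j \<in> I" for i j
    using S0[OF notJ[OF that(1)] that(2)] by (simp add: N_def sw[of _ i j])
  have sumJ: "(\<Sum>j\<in>J. N i j * u j) = (\<Sum>j\<in>I. N i j * u j)" if "i \<in> I" for i u
    using J fin N0 N_sym that by (intro sum.mono_neutral_left) auto
  have sumJ2: "(\<Sum>i\<in>J. \<Sum>j\<in>J. N i j * u i * u j) = (\<Sum>i\<in>I. \<Sum>j\<in>I. N i j * u i * u j)" for u
  proof -
    have "(\<Sum>i\<in>J. \<Sum>j\<in>J. N i j * u i * u j) = (\<Sum>i\<in>J. u i * (\<Sum>j\<in>J. N i j * u j))"
      by (simp add: sum_distrib_left mult_ac)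
    also have "\<dots> = (\<Sum>i\<in>J. u i * (\<Sum>j\<in>I. N i j * u j))"
      using J by (intro sum.cong refl) (use sumJ in auto)
    also have "\<dots> = (\<Sum>i\<in>I. u i * (\<Sum>j\<in>I. N i j * u j))"
      using J fin N0 by (intro sum.mono_neutral_left) (auto intro!: sum.neutral)
    finally show ?thesis by (simp add: sum_distrib_left mult_ac)
  qed
  have rowI: "(\<Sum>j\<in>I. N i j) = z i * S (Suc (Suc n)) (i # K)" for i
    by (simp only: N_def S_Suc[of "Suc n"] sum_distrib_left sw[of _ i] mult.assoc)
  have row: "(\<Sum>j\<in>J. N i j) = z i * S (Suc (Suc n)) (i # K)" if "i \<in> I" for i
    using sumJ[OF that, of "\<lambda>_. 1"] rowI by simp
  \<comment> \<open>Scaling by \<^term>\<open>z\<close> turns \<^term>\<open>z\<close> itself into the constant eigenvector of the kernel \<^term>\<open>N\<close>.\<close>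
  define u where "u = (\<lambda>i. x i / z i)"
  have zu: "z i * u i = x i" for i using z[of i] by (simp add: u_def)
  have "(\<Sum>i\<in>J. \<Sum>j\<in>J. N i j * u i * u j) * (\<Sum>i\<in>J. \<Sum>j\<in>J. N i j)
      \<le> (\<Sum>i\<in>J. (\<Sum>j\<in>J. N i j) * u i)\<^sup>2"
  proof (rule reversible_kernel_hyperbolic)
    show "0 \<le> N i j" for i j
      using S_nn less_imp_le[OF z] by (simp add: N_def)
    show "0 < (\<Sum>j\<in>J. N i j)" if "i \<in> J" for i
      using that z row[of i] by (simp add: J_def)
    show "0 < N i j \<or> (\<exists>k\<in>J. 0 < N i k \<and> 0 < N j k)" if "i \<in> J" "j \<in> J" for i j
    proof -
      have "i \<in> I" "j \<in> I" "0 < S (Suc (Suc n)) (i # K)" "0 < S (Suc (Suc n)) (j # K)"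
        using that by (auto simp: J_def)
      then obtain L L' where L: "set L \<subseteq> I" "length L = Suc (Suc n)" "0 < T (L @ i # K)"
        and L': "length L' = Suc (Suc n)" "0 < T (L' @ j # K)"
        unfolding S_pos by blast
      \<comment> \<open>The two outcomes are the two ways of being connected: if \<open>j\<close>
        replaces an entry of \<open>L\<close>, then \<open>i\<close> and \<open>j\<close> are joined
        by an edge; if \<open>j\<close> replaces \<open>i\<close>, then any entry of
        \<open>L\<close> is a common neighbour.\<close>
      have "0 < T (L @ j # K) \<or> (\<exists>L''. set L'' \<subseteq> I \<and> Suc (length L'') = length L \<and> 0 < T (L'' @ i # j # K))"
        using L L' Suc.prems by (intro exch) auto
      then show ?thesis
      proof
        assume "\<exists>L''. set L'' \<subseteq> I \<and> Suc (length L'') = length L \<and> 0 < T (L'' @ i # j # K)"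
        then have "0 < S (Suc n) (i # j # K)" unfolding S_pos using L by auto
        then show ?thesis using z by (simp add: N_def)
      next
        assume j: "0 < T (L @ j # K)"
        obtain k L1 where k: "L = k # L1" using L by (cases L) auto
        have kI: "k \<in> I" using k L by auto
        have *: "0 < S (Suc n) (i' # k # K)" if "0 < T (L @ i' # K)" for i'
        proof -
          have "T (L1 @ i' # k # K) = T (L @ i' # K)" by (rule perm) (simp add: k)
          then show ?thesis unfolding S_pos using that L k by auto
        qed
        have "0 < N i k" "0 < N j k" using *[OF L(3)] *[OF j] z by (auto simp: N_def)
        moreover have "k \<in> J" using N0[of k i] N_sym[of i k] \<open>0 < N i k\<close> \<open>i \<in> I\<close> kI by auto
        ultimately show ?thesis by blast
      qed
    qed
    show "(\<Sum>i\<in>J. \<Sum>j\<in>J. N i j * u i * u j) \<le> (\<Sum>k\<in>J. (\<Sum>j\<in>J. N k j * u j)\<^sup>2 / (\<Sum>j\<in>J. N k j))" for u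
    proof -
      define x where "x = (\<lambda>i. z i * u i)"
      define q where "q = (\<lambda>k. \<Sum>i\<in>I. \<Sum>j\<in>I. S n (i # j # k # K) * x i * x j)"
      \<comment> \<open>The induction hypothesis at \<open>k # K\<close>, divided by the row sum and
        rescaled by \<open>z k\<close>. The left sides add up to the form of
        \<open>N\<close>.\<close>
      have q: "z k * q k \<le> (\<Sum>j\<in>J. N k j * u j)\<^sup>2 / (\<Sum>j\<in>J. N k j)" if k: "k \<in> J" for k
      proof -
        have kI: "k \<in> I" and d: "0 < S (Suc (Suc n)) (k # K)" using k by (auto simp: J_def)
        have "q k * S (Suc (Suc n)) (k # K) \<le> (\<Sum>i\<in>I. x i * S (Suc n) (i # k # K))\<^sup>2"
          unfolding q_def S_def using Suc.prems kI by (intro Suc.IH) auto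
        then have "z k * q k \<le> z k * ((\<Sum>i\<in>I. x i * S (Suc n) (i # k # K))\<^sup>2 / S (Suc (Suc n)) (k # K))"
          using d z[of k] by (intro mult_left_mono) (auto simp: field_simps)
        also have "\<dots> = (z k * (\<Sum>i\<in>I. x i * S (Suc n) (i # k # K)))\<^sup>2 / (z k * S (Suc (Suc n)) (k # K))"
          using z[of k] by (simp add: power2_eq_square field_simps)
        also have "z k * (\<Sum>i\<in>I. x i * S (Suc n) (i # k # K)) = (\<Sum>j\<in>I. N k j * u j)"
          unfolding sum_distrib_left by (intro sum.cong refl) (simp add: N_def x_def sw[of _ k] mult_ac)
        finally show ?thesis using sumJ[OF kI] row[OF kI] by simp
      qed
      have "(\<Sum>i\<in>J. \<Sum>j\<in>J. N i j * u i * u j) = (\<Sum>i\<in>I. \<Sum>j\<in>I. \<Sum>k\<in>I. z k * (S n (k # i # j # K) * x i * x j))"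
        unfolding sumJ2 by (intro sum.cong refl) (simp add: N_def S_Suc x_def sum_distrib_left sum_distrib_right mult_ac)
      also have "\<dots> = (\<Sum>i\<in>I. \<Sum>k\<in>I. \<Sum>j\<in>I. z k * (S n (k # i # j # K) * x i * x j))"
        by (rule sum.cong[OF refl sum.swap])
      also have "\<dots> = (\<Sum>k\<in>I. \<Sum>i\<in>I. \<Sum>j\<in>I. z k * (S n (k # i # j # K) * x i * x j))"
        by (rule sum.swap)
      also have "\<dots> = (\<Sum>k\<in>I. z k * q k)"
        unfolding q_def sum_distrib_left
      proof (intro sum.cong refl)
        fix k i j
        have "S n (k # i # j # K) = S n (i # j # k # K)" by (rule S_perm) simp
        then show "z k * (S n (k # i # j # K) * x i * x j) = z k * (S n (i # j # k # K) * x i * x j)" by simp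
      qed
      also have "\<dots> = (\<Sum>k\<in>J. z k * q k)"
      proof (rule sum.mono_neutral_right)
        show "\<forall>k\<in>I - J. z k * q k = 0"
        proof
          fix k assume "k \<in> I - J"
          then have "S n (i # j # k # K) = 0" if "i \<in> I" "j \<in> I" for i j
            using that S0 notJ by metis
          then show "z k * q k = 0" by (simp add: q_def)
        qed
      qed (use J fin in auto)
      also have "\<dots> \<le> (\<Sum>k\<in>J. (\<Sum>j\<in>J. N k j * u j)\<^sup>2 / (\<Sum>j\<in>J. N k j))"
        by (rule sum_mono[OF q])
      finally show ?thesis .
    qed
  qed (use J N_sym in auto)
  moreover have "(\<Sum>i\<in>J. \<Sum>j\<in>J. N i j * u i * u j) = (\<Sum>i\<in>I. \<Sum>j\<in>I. S (Suc n) (i # j # K) * x i * x j)"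
    unfolding sumJ2 by (intro sum.cong refl) (simp add: N_def zu[symmetric] mult_ac)
  moreover have "(\<Sum>i\<in>J. \<Sum>j\<in>J. N i j) = S (Suc (Suc (Suc n))) K"
  proof -
    have "(\<Sum>i\<in>J. \<Sum>j\<in>J. N i j) = (\<Sum>i\<in>J. z i * S (Suc (Suc n)) (i # K))"
      using J row by (intro sum.cong refl) auto
    also have "\<dots> = S (Suc (Suc (Suc n))) K"
      unfolding S_Suc[of "Suc (Suc n)"] using J fin notJ by (intro sum.mono_neutral_left) auto
    finally show ?thesis .
  qed
  moreover have "(\<Sum>i\<in>J. (\<Sum>j\<in>J. N i j) * u i) = (\<Sum>i\<in>I. x i * S (Suc (Suc n)) (i # K))"
  proof -
    have "(\<Sum>i\<in>J. (\<Sum>j\<in>J. N i j) * u i) = (\<Sum>i\<in>J. x i * S (Suc (Suc n)) (i # K))"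
      using J row by (intro sum.cong refl) (auto simp: zu[symmetric] mult_ac)
    also have "\<dots> = (\<Sum>i\<in>I. x i * S (Suc (Suc n)) (i # K))"
      using J fin notJ by (intro sum.mono_neutral_left) auto
    finally show ?thesis .
  qed
  ultimately show ?case by (simp only: S_def)
qed

subsection \<open>Determinants of lists of vectors\<close>

text \<open>The index type has no order, whereas freezing arguments one at a time calls for lists.
  Any enumeration will do: on lists of full length another one changes \<open>list_det\<close> at
  most by a sign.\<close>

definition list_pos :: "'m::finite \<Rightarrow> nat" where
  "list_pos = (SOME h. bij_betw h UNIV {..<CARD('m)})"

lemma bij_list_pos: "bij_betw (list_pos :: 'm::finite \<Rightarrow> nat) UNIV {..<CARD('m)}"
proof -
  have "\<exists>h :: 'm \<Rightarrow> nat. bij_betw h UNIV {..<CARD('m)}"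
    using ex_bij_betw_finite_nat[of "UNIV :: 'm set"] by (simp add: lessThan_atLeast0)
  then show ?thesis unfolding list_pos_def by (rule someI_ex)
qed

lemma list_pos_less [simp]: "list_pos (i :: 'm::finite) < CARD('m)"
  using bij_betwE[OF bij_list_pos[where ?'m = 'm]] by auto

lemma list_pos_surj:
  assumes "n < CARD('m::finite)"
  obtains i :: "'m::finite" where "list_pos i = n"
  using bij_betw_imp_surj_on[OF bij_list_pos[where ?'m = 'm]] assms that
  by (metis imageE lessThan_iff)

lemma list_pos_eq_iff [simp]: "list_pos i = list_pos j \<longleftrightarrow> i = j"
  using bij_betw_imp_inj_on[OF bij_list_pos] by (auto dest: injD)

definition list_det :: "(real^'m::finite) list \<Rightarrow> real" where
  "list_det xs = det (\<chi> i. xs ! list_pos i)"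

lemma linear_list_det_update:
  fixes xs :: "(real^'m::finite) list"
  assumes len: "length xs = CARD('m)" and n: "n < CARD('m)"
  shows "linear (\<lambda>v. list_det (xs[n := v]))"
proof -
  obtain k :: 'm where k: "list_pos k = n" using n by (rule list_pos_surj)
  have eq: "list_det (xs[n := v]) = det (\<chi> i. if i = k then v else xs ! list_pos i)" for v
    unfolding list_det_def using len k
    by (intro arg_cong[where f = det]) (auto simp: vec_eq_iff nth_list_update)
  show ?thesis
  proof (rule linearI)
    show "list_det (xs[n := v + w]) = list_det (xs[n := v]) + list_det (xs[n := w])" for v w
      unfolding eq using det_row_add[of k "\<lambda>_. v" "\<lambda>_. w"] .
    show "list_det (xs[n := c *\<^sub>R v]) = c *\<^sub>R list_det (xs[n := v])" for c v
      unfolding eq using det_row_mul[of k c "\<lambda>_. v" "\<lambda>i. xs ! list_pos i"]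
      unfolding scalar_mult_eq_scaleR by simp
  qed
qed

lemma list_det_eq_nth:
  fixes xs :: "(real^'m::finite) list"
  assumes "p < CARD('m)" "q < CARD('m)" "p \<noteq> q" "xs ! p = xs ! q"
  shows "list_det xs = 0"
proof -
  obtain i :: 'm where i: "list_pos i = p" using assms by (metis list_pos_surj)
  obtain j :: 'm where j: "list_pos j = q" using assms by (metis list_pos_surj)
  show ?thesis
    unfolding list_det_def using assms i j by (intro det_identical_rows[of i j]) (auto simp: row_def)
qed

lemma list_det_nz_iff:
  fixes xs :: "(real^'m::finite) list"
  assumes len: "length xs = CARD('m)"
  shows "list_det xs \<noteq> 0 \<longleftrightarrow> span (set xs) = UNIV"
proof -
  let ?A = "(\<chi> i. xs ! list_pos i) :: real^'m^'m"
  have "rows ?A = (\<lambda>i::'m. xs ! list_pos i) ` UNIV" by (auto simp: rows_def row_def)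
  also have "\<dots> = (!) xs ` range (list_pos :: 'm \<Rightarrow> nat)" by auto
  also have "range (list_pos :: 'm \<Rightarrow> nat) = {..<CARD('m)}"
    using bij_betw_imp_surj_on[OF bij_list_pos] .
  also have "(!) xs ` {..<CARD('m)} = set xs" using len by (auto simp: set_conv_nth)
  finally show ?thesis
    by (simp add: list_det_def invertible_det_nz[symmetric] invertible_left_inverse
        matrix_left_invertible_span_rows)
qed

lemma abs_list_det_mset_cong:
  fixes xs ys :: "(real^'m::finite) list"
  assumes eq: "mset xs = mset ys" and len: "length ys = CARD('m)"
  shows "\<bar>list_det xs\<bar> = \<bar>list_det ys\<bar>"
proof -
  obtain p where p: "p permutes {..<length ys}" "permute_list p ys = xs"
    using mset_eq_permutation[OF eq] by blast
  let ?h = "list_pos :: 'm \<Rightarrow> nat"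
  let ?g = "inv_into UNIV ?h"
  have hg: "?h (?g n) = n" if "n < CARD('m)" for n
    using bij_betw_inv_into_right[OF bij_list_pos] that by auto
  define \<sigma> where "\<sigma> = (\<lambda>i. ?g (p (?h i)))"
  have pl: "p (?h i) < CARD('m)" for i
    using permutes_in_image[OF p(1), of "?h i"] by (simp add: len)
  have h\<sigma>: "?h (\<sigma> i) = p (?h i)" for i
    unfolding \<sigma>_def by (rule hg[OF pl])
  have "inj \<sigma>"
   proof (rule injI)
    fix i j assume "\<sigma> i = \<sigma> j"
    then have "p (?h i) = p (?h j)" using h\<sigma> by metis
    then show "i = j" using injD[OF permutes_inj[OF p(1)], of "?h i" "?h j"] by simp
  qed
  then have "\<sigma> permutes UNIV" by (intro bij_imp_permutes) (simp_all add: finite_UNIV_inj_surj bij_def)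
  moreover have "list_det xs = det (\<chi> i. (\<chi> i. ys ! ?h i) $ \<sigma> i)"
    unfolding list_det_def by (simp add: p(2)[symmetric] permute_list_nth[OF p(1)] len h\<sigma>)
  ultimately have "list_det xs = of_int (sign \<sigma>) * list_det ys"
    unfolding list_det_def[of ys] by (simp only: det_permute_rows)
  then show ?thesis by (simp add: abs_mult sign_def)
qed

text \<open>With all but two rows frozen the determinant is an alternating form on the quotient by
  their span. If it is not zero, that quotient is a plane and the form is an area form, a
  determinant in two coordinates. This reduces the base case of the induction to the plane.\<close>

lemma list_det_two_form:
  fixes K :: "(real^'m::finite) list"
  assumes len: "length K + 2 = CARD('m)"
  obtains a b :: "real^'m \<Rightarrow> real"
    where "\<And>v w. \<bar>list_det (v # w # K)\<bar> = \<bar>a v * b w - b v * a w\<bar>"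
proof (cases "\<forall>v w. list_det (v # w # K) = 0")
  case True
  then show thesis using that[of "\<lambda>_. 0" "\<lambda>_. 0"] by simp
next
  case False
  define \<omega> where "\<omega> = (\<lambda>v w. list_det (v # w # K))"
  from False obtain u u' where u: "\<omega> u u' \<noteq> 0" by (auto simp: \<omega>_def)
  have lin1: "linear (\<lambda>v. \<omega> v w)" for w
    using linear_list_det_update[of "0 # w # K" 0] len by (simp add: \<omega>_def)
  have lin2: "linear (\<lambda>w. \<omega> v w)" for v
    using linear_list_det_update[of "v # 0 # K" 1] len by (simp add: \<omega>_def)
  have alt: "\<omega> v v = 0" for v
    unfolding \<omega>_def using len by (intro list_det_eq_nth[of 0 1]) auto
  have "\<omega> (v + w) (v + w) = \<omega> v v + \<omega> v w + \<omega> w v + \<omega> w w" for v w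
    by (simp add: linear_add[OF lin1] linear_add[OF lin2])
  then have anti: "\<omega> v w = - \<omega> w v" for v w
    unfolding alt by (metis add.left_neutral add.right_neutral eq_neg_iff_add_eq_0)
  have zero: "\<omega> k w = 0" if "k \<in> set K" for k w
  proof -
    obtain n where "n < length K" "K ! n = k" using \<open>k \<in> set K\<close> by (auto simp: in_set_conv_nth)
    then show ?thesis
      unfolding \<omega>_def using len by (intro list_det_eq_nth[of 0 "n + 2"]) auto
  qed
  \<comment> \<open>Both sides are linear in \<^term>\<open>v\<close>, so it suffices to check a spanning set.\<close>
  have pluecker: "\<omega> u u' * \<omega> v w = \<omega> v u' * \<omega> u w - \<omega> u v * \<omega> w u'" for v w
  proof (rule linear_eq_on[of "\<lambda>v. \<omega> u u' * \<omega> v w" "\<lambda>v. \<omega> v u' * \<omega> u w - \<omega> u v * \<omega> w u'" _ "set (u # u' # K)"])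
    show "linear (\<lambda>v. \<omega> u u' * \<omega> v w)"
      using linear_compose_scale_right[OF lin1, of "\<omega> u u'" w] by simp
    show "linear (\<lambda>v. \<omega> v u' * \<omega> u w - \<omega> u v * \<omega> w u')"
      by (rule linearI)
        (simp_all add: linear_add[OF lin1] linear_add[OF lin2] linear_cmul[OF lin1] linear_cmul[OF lin2] algebra_simps)
    show "v \<in> span (set (u # u' # K))"
      using u len list_det_nz_iff[of "u # u' # K"] by (auto simp: \<omega>_def)
    fix k assume "k \<in> set (u # u' # K)"
    then consider "k = u" | "k = u'" | "k \<in> set K" by auto
    then show "\<omega> u u' * \<omega> k w = \<omega> k u' * \<omega> u w - \<omega> u k * \<omega> w u'"
    proof cases
      case 2
      then show ?thesis using anti[of u' w] alt by simp
    next
      case 3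
      then show ?thesis using zero[OF 3] anti[of u k] by simp
    qed (simp add: alt)
  qed
  have eq: "\<omega> v w = \<omega> v u' * (\<omega> u w / \<omega> u u') - \<omega> u v / \<omega> u u' * \<omega> w u'" for v w
    using pluecker[of v w] u by (simp add: field_simps)
  \<comment> \<open>Coordinates of \<open>v\<close> in the basis \<open>u\<close>, \<open>u'\<close>
    modulo the span of \<open>K\<close>: the first keeps the factor \<open>\<omega> u u'\<close>,
    the second is divided by it, so that each product carries it once.\<close>
  show thesis
  proof (rule that[of "\<lambda>v. \<omega> v u'" "\<lambda>v. \<omega> u v / \<omega> u u'"])
    fix v w
    have "list_det (v # w # K) = \<omega> v w" by (simp add: \<omega>_def)
    then show "\<bar>list_det (v # w # K)\<bar> = \<bar>\<omega> v u' * (\<omega> u w / \<omega> u u') - \<omega> u v / \<omega> u u' * \<omega> w u'\<bar>"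
      by (simp only: eq[of v w])
  qed
qed

text \<open>Steinitz exchange at the first entry of \<open>L\<close> whose addition brings
  \<open>j\<close> into the span; being the first, it lies in the span of \<open>j\<close> and of
  what precedes it.\<close>

lemma span_exchange_list:
  assumes "j \<in> span (A \<union> set L)" and "j \<notin> span A"
  shows "\<exists>L1 l L2. L = L1 @ l # L2 \<and> l \<in> span (insert j (A \<union> set L1))"
  using assms
proof (induction L arbitrary: A)
  case (Cons l L)
  show ?case
  proof (cases "j \<in> span (insert l A)")
    case True
    then have "l \<in> span (insert j (A \<union> set []))" using in_span_insert[OF True Cons.prems(2)] by simp
    then show ?thesis by (metis append_Nil)
  next
    case False
    moreover have "j \<in> span (insert l A \<union> set L)" using Cons.prems by simp
    ultimately obtain L1 l' L2 where "L = L1 @ l' # L2" "l' \<in> span (insert j (insert l A \<union> set L1))"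
      using Cons.IH by blast
    then have "l # L = (l # L1) @ l' # L2 \<and> l' \<in> span (insert j (A \<union> set (l # L1)))" by simp
    then show ?thesis by blast
  qed
qed simp

text \<open>The second determinant makes \<open>j\<close> independent of \<open>K\<close>. If
  \<open>j\<close> lies outside the span of \<open>K\<close> and \<open>L\<close>, it can replace
  \<open>i\<close>; otherwise Steinitz exchange lets it replace an entry of \<open>L\<close> while
  \<open>i\<close> stays.\<close>

lemma list_det_exchange:
  fixes K L L' :: "(real^'m::finite) list"
  assumes len: "length L = length L'" "length L + length K + 1 = CARD('m)"
    and i: "list_det (L @ i # K) \<noteq> 0" and j: "list_det (L' @ j # K) \<noteq> 0"
  shows "list_det (L @ j # K) \<noteq> 0 \<or>
    (\<exists>L''. set L'' \<subseteq> set L \<and> Suc (length L'') = length L \<and> list_det (L'' @ i # j # K) \<noteq> 0)"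
proof -
  have span_i: "span (set (L @ i # K)) = UNIV" and span_j: "span (set (L' @ j # K)) = UNIV"
    using i j len by (auto simp: list_det_nz_iff)
  have extend: "span B = UNIV" if "span (insert b C) = UNIV" "b \<in> span B" "C \<subseteq> B" for b and B C :: "(real^'m) set"
  proof -
    have "insert b C \<subseteq> span B" using that span_superset by blast
    then show ?thesis using that(1) by (metis span_minimal subspace_span top.extremum_uniqueI)
  qed
  have jK: "j \<notin> span (set K)"
  proof
    assume "j \<in> span (set K)"
    then have "j \<in> span (set (L' @ K))" using span_mono[of "set K" "set (L' @ K)"] by auto
    then have "span (set (L' @ K)) = UNIV"
      using extend[of j "set (L' @ K)" "set (L' @ K)"] span_j by simp
    then have "CARD('m) \<le> card (set (L' @ K))"
      using dim_le_card'[of "set (L' @ K)"] dim_span[of "set (L' @ K)"] by (simp add: dim_UNIV)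
    also have "\<dots> \<le> length (L' @ K)" by (rule card_length)
    finally show False using len by simp
  qed
  show ?thesis
  proof (cases "j \<in> span (set K \<union> set L)")
    case False
    have *: "set (L @ k # K) = insert k (set K \<union> set L)" for k by auto
    have "j \<in> span (insert i (set K \<union> set L))" using span_i unfolding * by (rule ssubst) (rule UNIV_I)
    then have ij: "i \<in> span (insert j (set K \<union> set L))" by (rule in_span_insert) (rule False)
    have "span (insert j (set K \<union> set L)) = UNIV"
      by (rule extend[of i "set K \<union> set L"]) (fact span_i[unfolded *], fact ij, rule subset_insertI)
    then have "span (set (L @ j # K)) = UNIV" unfolding * .
    then show ?thesis using len by (simp add: list_det_nz_iff)
  next
    case True
    then obtain L1 l L2 where L: "L = L1 @ l # L2" "l \<in> span (insert j (set K \<union> set L1))"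
      using span_exchange_list[OF _ jK, of L] by blast
    have "l \<in> span (set ((L1 @ L2) @ i # j # K))"
      using L(2) span_mono[of "insert j (set K \<union> set L1)" "set ((L1 @ L2) @ i # j # K)"] by auto
    then have "span (set ((L1 @ L2) @ i # j # K)) = UNIV"
    proof (rule extend[rotated])
      have "insert l (set (L1 @ L2 @ i # K)) = set (L @ i # K)" using L(1) by auto
      then show "span (insert l (set (L1 @ L2 @ i # K))) = UNIV" using span_i by simp
    qed auto
    moreover have "length ((L1 @ L2) @ i # j # K) = CARD('m)" using len L(1) by simp
    ultimately have "list_det ((L1 @ L2) @ i # j # K) \<noteq> 0" using list_det_nz_iff by blast
    then show ?thesis using L(1) by (intro disjI2 exI[of _ "L1 @ L2"]) auto
  qed
qed

subsection \<open>Log-concavity\<close>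

text \<open>The value 0 at other lengths makes permutation invariance hold for all lists, as the
  lemmas on \<open>multisum\<close> assume.\<close>

definition abs_list_det :: "(real^'m::finite) list \<Rightarrow> real" where
  "abs_list_det xs = (if length xs = CARD('m) then \<bar>list_det xs\<bar> else 0)"

lemma abs_list_det_hyperbolic:
  fixes I :: "(real^'m::finite) set"
  assumes fin: "finite I" and z: "\<And>v. 0 < z v" and K: "set K \<subseteq> I" "length K + n + 2 = CARD('m)"
  shows "(\<Sum>v\<in>I. \<Sum>w\<in>I. multisum I z abs_list_det n (v # w # K) * x v * x w) *
      multisum I z abs_list_det (Suc (Suc n)) K
    \<le> (\<Sum>v\<in>I. x v * multisum I z abs_list_det (Suc n) (v # K))\<^sup>2"
proof (rule multisum_hyperbolic[OF fin _ z _ _ _ K])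
  show "0 \<le> abs_list_det xs" for xs :: "(real^'m) list" by (simp add: abs_list_det_def)
  show "abs_list_det xs = abs_list_det ys" if "mset xs = mset ys" for xs ys :: "(real^'m) list"
    using that mset_eq_length[OF that] abs_list_det_mset_cong[OF that] by (simp add: abs_list_det_def)
next
  fix K :: "(real^'m) list" and x
  assume len: "length K + 2 = CARD('m)"
  obtain a b where ab: "\<And>v w. \<bar>list_det (v # w # K)\<bar> = \<bar>a v * b w - b v * a w\<bar>"
    using list_det_two_form[OF len] by blast
  have eq: "abs_list_det (v # w # K) = \<bar>a v * b w - b v * a w\<bar>" for v w
    using len ab by (simp add: abs_list_det_def)
  show "(\<Sum>v\<in>I. \<Sum>w\<in>I. abs_list_det (v # w # K) * x v * x w) *
      (\<Sum>v\<in>I. \<Sum>w\<in>I. abs_list_det (v # w # K) * z v * z w)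
    \<le> (\<Sum>v\<in>I. \<Sum>w\<in>I. abs_list_det (v # w # K) * x v * z w)\<^sup>2"
    unfolding eq by (rule planar_det_hyperbolic[OF fin less_imp_le[OF z]])
next
  fix K L L' :: "(real^'m) list" and v w
  assume len: "length L = length L'" "length L + length K + 1 = CARD('m)" and L: "set L \<subseteq> I"
    and "0 < abs_list_det (L @ v # K)" "0 < abs_list_det (L' @ w # K)"
  then have "list_det (L @ v # K) \<noteq> 0" "list_det (L' @ w # K) \<noteq> 0"
    by (auto simp: abs_list_det_def split: if_splits)
  from list_det_exchange[OF len this] show "0 < abs_list_det (L @ w # K) \<or>
    (\<exists>L''. set L'' \<subseteq> I \<and> Suc (length L'') = length L \<and> 0 < abs_list_det (L'' @ v # w # K))"
  proof
    assume "list_det (L @ w # K) \<noteq> 0"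
    then show ?thesis using len by (simp add: abs_list_det_def)
  next
    assume "\<exists>L''. set L'' \<subseteq> set L \<and> Suc (length L'') = length L \<and> list_det (L'' @ v # w # K) \<noteq> 0"
    then obtain L'' where "set L'' \<subseteq> set L" "Suc (length L'') = length L" "list_det (L'' @ v # w # K) \<noteq> 0"
      by blast
    then show ?thesis using len L by (intro disjI2 exI[of _ L'']) (auto simp: abs_list_det_def)
  qed
qed

text \<open>By symmetry all \<open>n\<close> free arguments contribute equally, whence the factor
  \<open>n\<close>. At \<open>n = 0\<close> this factor removes the term with the truncated
  \<open>n - 1\<close>.\<close>

lemma multisum_has_real_derivative:
  assumes perm: "\<And>xs ys. mset xs = mset ys \<Longrightarrow> T xs = T ys"
  shows "((\<lambda>s. multisum I (\<lambda>i. a i + s * x i) T n K) has_real_derivative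
    real n * (\<Sum>i\<in>I. x i * multisum I (\<lambda>i. a i + s * x i) T (n - 1) (i # K))) (at s)"
proof (induction n arbitrary: K)
  case (Suc n)
  let ?S = "multisum I (\<lambda>i. a i + s * x i) T"
  have "((\<lambda>s. (a i + s * x i) * multisum I (\<lambda>i. a i + s * x i) T n (i # K)) has_real_derivative
      x i * ?S n (i # K) + (a i + s * x i) * (real n * (\<Sum>j\<in>I. x j * ?S (n - 1) (j # i # K)))) (at s)" for i
    by (rule DERIV_cong[OF DERIV_mult[OF _ Suc.IH]]) (auto intro!: derivative_eq_intros simp: algebra_simps)
  then have "((\<lambda>s. multisum I (\<lambda>i. a i + s * x i) T (Suc n) K) has_real_derivative
      (\<Sum>i\<in>I. x i * ?S n (i # K) +
        (a i + s * x i) * (real n * (\<Sum>j\<in>I. x j * ?S (n - 1) (j # i # K))))) (at s)"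
    unfolding multisum.simps by (rule DERIV_sum)
  also have "(\<Sum>i\<in>I. x i * ?S n (i # K) +
        (a i + s * x i) * (real n * (\<Sum>j\<in>I. x j * ?S (n - 1) (j # i # K)))) =
      (\<Sum>i\<in>I. x i * ?S n (i # K)) +
      real n * (\<Sum>i\<in>I. \<Sum>j\<in>I. x j * ((a i + s * x i) * ?S (n - 1) (j # i # K)))"
    by (simp add: sum.distrib sum_distrib_left mult_ac)
  also have "(\<Sum>i\<in>I. \<Sum>j\<in>I. x j * ((a i + s * x i) * ?S (n - 1) (j # i # K))) =
      (\<Sum>j\<in>I. \<Sum>i\<in>I. x j * ((a i + s * x i) * ?S (n - 1) (j # i # K)))"
    by (rule sum.swap)
  also have "real n * \<dots> = real n * (\<Sum>j\<in>I. x j * (\<Sum>i\<in>I. (a i + s * x i) * ?S (n - 1) (i # j # K)))"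
  proof -
    have "?S (n - 1) (j # i # K) = ?S (n - 1) (i # j # K)" for i j
      by (rule multisum_mset_cong[OF perm]) auto
    then show ?thesis by (simp add: sum_distrib_left)
  qed
  also have "\<dots> = real n * (\<Sum>j\<in>I. x j * ?S n (j # K))"
    by (cases n) simp_all
  finally show ?case by (rule DERIV_cong) (simp add: algebra_simps)
qed simp

text \<open>On the segment, with \<open>m\<close> the dimension, the first derivative of
  \<open>f\<close> is \<open>m * r\<close> and the second \<open>m * (m - 1) * q\<close>.
  Hyperbolicity in the direction \<open>b - a\<close> says \<open>q * f \<le> r\<^sup>2\<close>, so
  the second derivative of \<open>ln f\<close> is nonpositive.\<close>

lemma multisum_abs_list_det_log_concave_pos:
  fixes I :: "(real^'m::finite) set"
  assumes fin: "finite I" and a: "\<And>v. 0 < a v" and b: "\<And>v. 0 < b v" and t: "0 \<le> t" "t \<le> 1"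
  defines "F \<equiv> \<lambda>z. multisum I z abs_list_det CARD('m) []"
  shows "F a powr (1 - t) * F b powr t \<le> F (\<lambda>v. (1 - t) * a v + t * b v)"
proof -
  have T: "0 \<le> abs_list_det xs" for xs :: "(real^'m) list" by (simp add: abs_list_det_def)
  have perm: "abs_list_det xs = abs_list_det ys" if "mset xs = mset ys" for xs ys :: "(real^'m) list"
    using that mset_eq_length[OF that] abs_list_det_mset_cong[OF that] by (simp add: abs_list_det_def)
  define x where "x = (\<lambda>v. b v - a v)"
  define z where "z = (\<lambda>s v. a v + s * x v)"
  have z_pos: "0 < z s v" if "s \<in> {0..1}" for s v
  proof -
    have "z s v = (1 - s) * a v + s * b v" by (simp add: z_def x_def algebra_simps)
    also have "\<dots> > 0"
      using that a[of v] b[of v]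
      by (cases "s = 0") (auto intro!: add_nonneg_pos)
    finally show ?thesis .
  qed
  have F_pos: "0 < F y \<longleftrightarrow> (\<exists>L. set L \<subseteq> I \<and> length L = CARD('m) \<and> 0 < abs_list_det (L @ []))"
    if "\<And>v. 0 < y v" for y
    unfolding F_def by (rule multisum_pos_iff[OF fin T that])
  have z1: "z 1 = b" and z0: "z 0 = a" and zt: "z t = (\<lambda>v. (1 - t) * a v + t * b v)"
    by (auto simp: z_def x_def algebra_simps)
  show ?thesis
  proof (cases "0 < F a")
    case False
    \<comment> \<open>As \<open>0 powr r = 0\<close> for every \<open>r\<close>, the left side
      vanishes in this case, even for \<open>t = 1\<close>.\<close>
    have "0 \<le> F y" if "\<And>v. 0 < y v" for y
      unfolding F_def by (intro multisum_nonneg T less_imp_le that)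
    then have "0 \<le> F (z t)" "F a = 0" using z_pos t a False by (auto simp: less_le)
    then show ?thesis by (simp add: zt)
  next
    case True
    then have Fz: "0 < F (z s)" if "s \<in> {0..1}" for s
      using F_pos[OF a] F_pos[OF z_pos[OF that]] by simp
    let ?m = "CARD('m)"
    define f where "f = (\<lambda>s. F (z s))"
    define f' where "f' = (\<lambda>s. real ?m * (\<Sum>v\<in>I. x v * multisum I (z s) abs_list_det (?m - 1) [v]))"
    define f'' where "f'' = (\<lambda>s. real ?m * (\<Sum>v\<in>I. x v * (real (?m - 1) *
      (\<Sum>w\<in>I. x w * multisum I (z s) abs_list_det (?m - 1 - 1) [w, v]))))"
    have der_f: "(f has_real_derivative f' s) (at s)" for s
      unfolding f_def f'_def F_def z_def by (rule multisum_has_real_derivative[OF perm])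
    have der_f': "(f' has_real_derivative f'' s) (at s)" for s
      unfolding f'_def f''_def z_def
      by (intro DERIV_cmult DERIV_sum multisum_has_real_derivative[OF perm])
    have ff: "f s * f'' s \<le> (f' s)\<^sup>2" if s: "s \<in> {0..1}" for s
    proof (cases "?m = 1")
      case False
      have "2 \<le> ?m" using False by (metis One_nat_def Suc_1 Suc_leI le_neq_implies_less zero_less_card_finite)
      then obtain n where n: "?m = Suc (Suc n)" by (metis Suc_1 Suc_le_D add_2_eq_Suc le_Suc_ex)
      define q where "q = (\<Sum>v\<in>I. \<Sum>w\<in>I. multisum I (z s) abs_list_det n [v, w] * x v * x w)"
      define r where "r = (\<Sum>v\<in>I. x v * multisum I (z s) abs_list_det (Suc n) [v])"
      have h: "q * f s \<le> r\<^sup>2"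
        unfolding q_def r_def f_def F_def n
        using z_pos[OF s] by (intro abs_list_det_hyperbolic fin) (auto simp: n)
      have "f'' s = real ?m * (real (Suc n) * q)"
      proof -
        have "multisum I (z s) abs_list_det n [w, v] = multisum I (z s) abs_list_det n [v, w]" for v w
          by (rule multisum_mset_cong[OF perm]) auto
        then show ?thesis
          by (simp add: f''_def q_def n sum_distrib_left mult_ac del: of_nat_Suc)
      qed
      moreover have "f' s = real ?m * r" by (simp add: f'_def r_def n)
      \<comment> \<open>Here \<open>m - 1\<close> is enlarged to \<open>m\<close>; keeping it would
        give concavity of the \<open>m\<close>-th root, the full Brunn--Minkowski
        inequality.\<close>
      moreover have "real (Suc n) * (q * f s) \<le> real ?m * r\<^sup>2"
      proof -
        have "real (Suc n) * (q * f s) \<le> real (Suc n) * r\<^sup>2" using h by (intro mult_left_mono) auto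
        also have "\<dots> \<le> real ?m * r\<^sup>2" by (intro mult_right_mono) (auto simp: n)
        finally show ?thesis .
      qed
      ultimately show ?thesis
        using mult_left_mono[of "real (Suc n) * (q * f s)" "real ?m * r\<^sup>2" "real ?m"]
        by (simp add: power2_eq_square mult_ac del: of_nat_Suc)
    qed (simp add: f''_def)
    have "concave_on {0..1} (\<lambda>s. ln (f s))"
    proof (rule f''_le0_imp_concave)
      show "((\<lambda>s. ln (f s)) has_real_derivative f' s / f s) (at s)" if "s \<in> {0..1}" for s
        by (rule DERIV_cong[OF DERIV_chain2[where f = ln and g = f, OF DERIV_ln_divide der_f]])
          (use Fz[OF that] in \<open>simp_all add: f_def\<close>)
      show "((\<lambda>s. f' s / f s) has_real_derivative (f'' s * f s - f' s * f' s) / (f s * f s)) (at s)"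
        if "s \<in> {0..1}" for s
        using Fz[OF that] by (intro DERIV_divide der_f der_f') (simp add: f_def)
      show "(f'' s * f s - f' s * f' s) / (f s * f s) \<le> 0" if "s \<in> {0..1}" for s
        using ff[OF that] by (intro divide_nonpos_nonneg) (auto simp: power2_eq_square mult.commute)
    qed simp
    from concave_onD[OF this t, of 0 1]
    have "(1 - t) * ln (f 0) + t * ln (f 1) \<le> ln (f t)" by simp
    then have "exp ((1 - t) * ln (f 0) + t * ln (f 1)) \<le> exp (ln (f t))" by simp
    moreover have "0 < f 0" "0 < f 1" "0 < f t" using Fz t by (auto simp: f_def)
    ultimately have "f 0 powr (1 - t) * f 1 powr t \<le> f t"
      by (simp add: powr_def exp_add)
    then show ?thesis by (simp add: f_def z0 z1 zt)
  qed
qed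

lemma multisum_tendsto:
  assumes "\<And>i. i \<in> I \<Longrightarrow> ((\<lambda>e. z e i) \<longlongrightarrow> y i) F"
  shows "((\<lambda>e. multisum I (z e) T n K) \<longlongrightarrow> multisum I y T n K) F"
  using assms by (induction n arbitrary: K) (auto intro!: tendsto_intros)

text \<open>Vanishing weights are reached by adding \<open>e\<close> to all weights and letting
  \<open>e\<close> decrease to 0. Exponents strictly between 0 and 1 keep \<open>powr\<close>
  continuous at base 0.\<close>

lemma multisum_abs_list_det_log_concave:
  fixes I :: "(real^'m::finite) set"
  assumes fin: "finite I" and a: "\<And>v. 0 \<le> a v" and b: "\<And>v. 0 \<le> b v" and t: "0 < t" "t < 1"
  defines "F \<equiv> \<lambda>z. multisum I z abs_list_det CARD('m) []"
  shows "F a powr (1 - t) * F b powr t \<le> F (\<lambda>v. (1 - t) * a v + t * b v)"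
proof (rule tendsto_le)
  let ?R = "at_right (0::real)"
  have F_nn: "\<forall>\<^sub>F e in ?R. 0 \<le> F (\<lambda>v. y v + e)" if "\<And>v. 0 \<le> y v" for y
    unfolding eventually_at_right_field F_def
    by (intro exI[of _ 1]) (auto intro!: multisum_nonneg add_nonneg_nonneg that simp: abs_list_det_def)
  have lim: "((\<lambda>e. y v + e) \<longlongrightarrow> y v) ?R" for y :: "real^'m \<Rightarrow> real" and v
    by (rule tendsto_eq_intros refl | simp)+
  have F_lim: "((\<lambda>e. F (\<lambda>v. y v + e)) \<longlongrightarrow> F y) ?R" for y
    unfolding F_def by (intro multisum_tendsto lim)
  show "((\<lambda>e. F (\<lambda>v. ((1 - t) * a v + t * b v) + e)) \<longlongrightarrow> F (\<lambda>v. (1 - t) * a v + t * b v)) ?R"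
    by (rule F_lim)
  show "((\<lambda>e. F (\<lambda>v. a v + e) powr (1 - t) * F (\<lambda>v. b v + e) powr t) \<longlongrightarrow> F a powr (1 - t) * F b powr t) ?R"
    using t a b by (intro tendsto_intros tendsto_powr' F_lim disjI2 conjI F_nn) auto
  show "\<forall>\<^sub>F e in ?R. F (\<lambda>v. a v + e) powr (1 - t) * F (\<lambda>v. b v + e) powr t
      \<le> F (\<lambda>v. ((1 - t) * a v + t * b v) + e)"
    unfolding eventually_at_right_field
  proof (intro exI[of _ 1] conjI allI impI)
    fix e :: real assume "0 < e"
    then have "F (\<lambda>v. a v + e) powr (1 - t) * F (\<lambda>v. b v + e) powr t
        \<le> F (\<lambda>v. (1 - t) * (a v + e) + t * (b v + e))"
      unfolding F_def using t a b
      by (intro multisum_abs_list_det_log_concave_pos fin) (auto intro: add_nonneg_pos)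
    also have "(\<lambda>v. (1 - t) * (a v + e) + t * (b v + e)) = (\<lambda>v. ((1 - t) * a v + t * b v) + e)"
      by (auto simp: algebra_simps)
    finally show "F (\<lambda>v. a v + e) powr (1 - t) * F (\<lambda>v. b v + e) powr t
      \<le> F (\<lambda>v. ((1 - t) * a v + t * b v) + e)" .
  qed simp
qed simp

lemma multisum_eq_sum_lists:
  assumes fin: "finite I"
  shows "multisum I z T n K = (\<Sum>L\<in>{L. set L \<subseteq> I \<and> length L = n}. prod_list (map z L) * T (L @ K))"
proof (induction n arbitrary: K)
  case 0
  have "{L. set L \<subseteq> I \<and> length L = 0} = {[]}" by auto
  then show ?case by simp
next
  case (Suc n)
  let ?A = "\<lambda>n. {L. set L \<subseteq> I \<and> length L = n}"
  \<comment> \<open>The index chosen first by \<open>multisum\<close> is pushed onto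
    \<open>K\<close> first, so it ends up last in \<open>L\<close>.\<close>
  have "?A (Suc n) = (\<lambda>(i, L). L @ [i]) ` (I \<times> ?A n)"
  proof safe
    fix L assume "set L \<subseteq> I" "length L = Suc n"
    moreover from this obtain L' i where "L = L' @ [i]" by (cases L rule: rev_cases) auto
    ultimately show "L \<in> (\<lambda>(i, L). L @ [i]) ` (I \<times> ?A n)" by force
  qed auto
  moreover have "inj_on (\<lambda>(i, L). L @ [i]) (I \<times> ?A n)" by (auto simp: inj_on_def)
  ultimately have "(\<Sum>L\<in>?A (Suc n). prod_list (map z L) * T (L @ K)) =
      (\<Sum>(i, L)\<in>I \<times> ?A n. prod_list (map z (L @ [i])) * T ((L @ [i]) @ K))"
    by (simp add: sum.reindex case_prod_unfold)
  also have "\<dots> = (\<Sum>i\<in>I. \<Sum>L\<in>?A n. z i * (prod_list (map z L) * T (L @ i # K)))"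
    using fin by (simp add: sum.cartesian_product mult_ac)
  finally show ?case by (simp add: Suc.IH sum_distrib_left)
qed

lemma prod_list_map_list_pos:
  fixes L :: "'i list"
  assumes len: "length L = CARD('m::finite)"
  shows "prod_list (map z L) = (\<Prod>j::'m\<in>UNIV. z (L ! list_pos j))"
proof -
  have "prod_list (map z L) = (\<Prod>n<CARD('m). z (L ! n))"
    using len by (simp add: prod.list_conv_set_nth lessThan_atLeast0)
  also have "\<dots> = (\<Prod>j::'m\<in>UNIV. z (L ! list_pos j))"
    by (rule prod.reindex_bij_betw[OF bij_list_pos, symmetric])
  finally show ?thesis .
qed

subsection \<open>Differentials at a point\<close>

text \<open>The segment from \<open>G\<close> to the identity stays positive definite, hence
  invertible, so the determinant cannot change sign along it.\<close>

lemma posdef_det_pos: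
  fixes G :: "real^'m^'m::finite"
  assumes pos: "\<And>v. v \<noteq> 0 \<Longrightarrow> 0 < v \<bullet> (G *v v)"
  shows "0 < det G"
proof (rule ccontr)
  assume neg: "\<not> 0 < det G"
  define H where "H = (\<lambda>s::real. (\<chi> i j. (1 - s) * G $ i $ j + s * mat 1 $ i $ j) :: real^'m^'m)"
  have "H s = (1 - s) *\<^sub>R G + s *\<^sub>R mat 1" for s by (simp add: H_def vec_eq_iff)
  then have Hv: "H s *v v = (1 - s) *\<^sub>R (G *v v) + s *\<^sub>R v" for s v
    by (simp add: matrix_vector_mult_add_rdistrib scaleR_matrix_vector_assoc[symmetric])
  have "det (H s) \<noteq> 0" if "0 \<le> s" "s \<le> 1" for s
  proof -
    have "0 < v \<bullet> (H s *v v)" if "v \<noteq> 0" for v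
      unfolding Hv inner_add_right inner_scaleR_right
      using pos[OF that] \<open>v \<noteq> 0\<close> \<open>0 \<le> s\<close> \<open>s \<le> 1\<close>
      by (cases "s = 1") (auto intro!: add_pos_nonneg)
    then have "invertible (H s)" by (rule posdef_invertible)
    then show ?thesis by (simp add: invertible_det_nz)
  qed
  moreover have "\<exists>s\<ge>0. s \<le> 1 \<and> det (H s) = 0"
  proof (rule IVT')
    have "H 0 = G" "H 1 = mat 1" by (simp_all add: H_def vec_eq_iff)
    then show "det (H 0) \<le> 0" "0 \<le> det (H 1)" using neg by auto
    show "continuous_on {0..1} (\<lambda>s. det (H s))"
      unfolding det_def H_def by (auto intro!: continuous_intros)
  qed simp
  ultimately show False by blast
qed

lemma posdef_matrix_inv:
  fixes G :: "real^'m^'m::finite"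
  assumes pos: "\<And>v. v \<noteq> 0 \<Longrightarrow> 0 < v \<bullet> (G *v v)" and v: "v \<noteq> 0"
  shows "0 < v \<bullet> (matrix_inv G *v v)"
proof -
  have inv: "G *v (matrix_inv G *v v) = v"
    using matrix_inv_mult(1)[OF posdef_invertible[OF pos]]
    by (simp add: matrix_vector_mul_assoc)
  then have "matrix_inv G *v v \<noteq> 0" using v by auto
  from pos[OF this] show ?thesis by (simp add: inv inner_commute)
qed

lemma posdef_norm_bound:
  fixes G :: "real^'m^'m::finite"
  assumes pos: "\<And>v. v \<noteq> 0 \<Longrightarrow> 0 < v \<bullet> (G *v v)"
  obtains C where "0 < C" "\<And>v. norm v \<le> C * sqrt (v \<bullet> (G *v v))"
proof -
  have "continuous_on (sphere 0 1) (\<lambda>v. v \<bullet> (G *v v))"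
    by (intro continuous_intros matrix_vector_mult_linear_continuous_on)
  moreover have "sphere (0::real^'m) 1 \<noteq> {}" by simp
  ultimately obtain u where u: "u \<in> sphere 0 1"
    and min: "\<And>v. v \<in> sphere 0 1 \<Longrightarrow> u \<bullet> (G *v u) \<le> v \<bullet> (G *v v)"
    using continuous_attains_inf[of "sphere 0 1" "\<lambda>v. v \<bullet> (G *v v)"] by (auto simp: compact_sphere)
  define c where "c = u \<bullet> (G *v u)"
  have c: "0 < c" unfolding c_def using u by (intro pos) auto
  have "norm v \<le> 1 / sqrt c * sqrt (v \<bullet> (G *v v))" for v
  proof (cases "v = 0")
    case False
    have "c \<le> (v /\<^sub>R norm v) \<bullet> (G *v (v /\<^sub>R norm v))"
      unfolding c_def by (rule min) (use False in simp)
    also have "\<dots> = v \<bullet> (G *v v) / (norm v)\<^sup>2"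
      by (simp add: matrix_vector_mult_scaleR power2_eq_square divide_inverse mult_ac)
    finally have "c * (norm v)\<^sup>2 \<le> v \<bullet> (G *v v)"
      using False by (simp add: pos_le_divide_eq)
    then have "sqrt (c * (norm v)\<^sup>2) \<le> sqrt (v \<bullet> (G *v v))" by (rule real_sqrt_le_mono)
    then show ?thesis using c by (simp add: real_sqrt_mult field_simps)
  qed simp
  then show thesis using that[of "1 / sqrt c"] c by simp
qed

text \<open>A crude form of Hadamard's inequality, read off the Leibniz formula; it provides the
  uniform bound for dominated convergence.\<close>

lemma abs_det_le_prod_norm:
  fixes V :: "real^'m^'m::finite"
  shows "\<bar>det V\<bar> \<le> fact CARD('m) * (\<Prod>i\<in>UNIV. norm (V $ i))"
proof -
  have "\<bar>det V\<bar> \<le> (\<Sum>p | p permutes (UNIV :: 'm set). \<bar>of_int (sign p) * (\<Prod>i\<in>UNIV. V $ i $ p i)\<bar>)"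
    unfolding det_def by (rule sum_abs)
  also have "\<dots> \<le> (\<Sum>p | p permutes (UNIV :: 'm set). \<Prod>i\<in>UNIV. norm (V $ i))"
    by (intro sum_mono) (auto simp: abs_mult sign_def abs_prod intro!: prod_mono component_le_norm_cart)
  also have "\<dots> = fact CARD('m) * (\<Prod>i\<in>UNIV. norm (V $ i))"
    by (simp add: card_permutations)
  finally show ?thesis .
qed

text \<open>The same choice as inside \<open>J\<close>, so that \<open>J\<close> unfolds to an
  expression in this chart.\<close>

definition base_chart :: "('a, 'm) chart set \<Rightarrow> 'a \<Rightarrow> ('a, 'm::finite) chart" where
  "base_chart A p = (SOME c. c \<in> A \<and> p \<in> fst c)"

definition covector :: "('a, 'm) chart set \<Rightarrow> 'a \<Rightarrow> ('a \<Rightarrow> real^1) \<Rightarrow> real^'m::finite" where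
  "covector A p f = jac (base_chart A p) f p $ 1"

lemma base_chart:
  assumes "smooth_manifold A"
  shows "base_chart A p \<in> A" "p \<in> fst (base_chart A p)"
proof -
  have "\<exists>c. c \<in> A \<and> p \<in> fst c" using assms UNIV_I[of p] unfolding smooth_manifold_def by blast
  from someI_ex[OF this] show "base_chart A p \<in> A" "p \<in> fst (base_chart A p)"
    by (auto simp: base_chart_def)
qed

lemma J_real_field:
  fixes f :: "'a \<Rightarrow> real^1"
  shows "J A g p f =
    sqrt (covector A p f \<bullet> (matrix_inv (g (base_chart A p) p) *v covector A p f))"
  by (simp add: J_def base_chart_def covector_def wedge_norm_def cotangent_inner_def det_1 Let_def)

lemma jac_concat_field:
  fixes A :: "('a::{t2_space, second_countable_topology}, 'm::finite) chart set"
    and f :: "'n::finite \<Rightarrow> 'a \<Rightarrow> real^1"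
  assumes A: "smooth_manifold A" and c: "c \<in> A" "p \<in> fst c" and f: "\<And>j. f j \<in> C1 A"
  shows "jac c (concat_field f) p $ j = jac c (f j) p $ 1"
proof -
  let ?x = "snd c p"
  define F where "F = (\<lambda>j. f j \<circ> chart_inv c)"
  have o: "open (snd c ` fst c)" using A c by (auto simp: smooth_manifold_def is_chart_def)
  have "F j differentiable_on (snd c ` fst c)" for j
    using f[of j] c unfolding C1_def F_def by simp
  then have "F j differentiable (at ?x)" for j
    using c o by (simp add: differentiable_on_eq_differentiable_at)
  then have "(F j has_derivative frechet_derivative (F j) (at ?x)) (at ?x)" for j
    by (simp add: frechet_derivative_works[symmetric])
  then have comp: "((\<lambda>x. F j x $ 1) has_derivative (\<lambda>v. frechet_derivative (F j) (at ?x) v $ 1)) (at ?x)" for j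
    by (rule bounded_linear.has_derivative[OF bounded_linear_vec_nth])
  have "((\<lambda>x. \<chi> j. F j x $ 1) has_derivative (\<lambda>v. \<chi> j. frechet_derivative (F j) (at ?x) v $ 1)) (at ?x)"
  proof (subst has_derivative_componentwise_within, intro ballI)
    fix b :: "real^'n" assume "b \<in> Basis"
    then obtain i where "b = axis i 1" by (auto simp: Basis_vec_def)
    then show "((\<lambda>x. (\<chi> j. F j x $ 1) \<bullet> b) has_derivative
        (\<lambda>v. (\<chi> j. frechet_derivative (F j) (at ?x) v $ 1) \<bullet> b)) (at ?x)"
      using comp[of i] by (simp add: inner_axis)
  qed
  from frechet_derivative_at[OF this]
  have "frechet_derivative (\<lambda>x. \<chi> j. F j x $ 1) (at ?x) =
      (\<lambda>v. \<chi> j. frechet_derivative (F j) (at ?x) v $ 1)"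
    by (rule sym)
  moreover have "concat_field f \<circ> chart_inv c = (\<lambda>x. \<chi> j. F j x $ 1)"
    by (rule ext) (simp add: concat_field_def F_def)
  ultimately have "frechet_derivative (concat_field f \<circ> chart_inv c) (at ?x) =
      (\<lambda>v. \<chi> j. frechet_derivative (F j) (at ?x) v $ 1)"
    by simp
  then show ?thesis by (simp add: jac_def F_def matrix_def vec_eq_iff)
qed

text \<open>There are as many fields as dimensions, so the Gram matrix is a product of square
  matrices and the metric splits off as a constant depending on \<open>p\<close> only.\<close>

lemma J_concat_field:
  fixes A :: "('a::{t2_space, second_countable_topology}, 'm::finite) chart set"
    and f :: "'m \<Rightarrow> 'a \<Rightarrow> real^1"
  assumes A: "smooth_manifold A" and f: "\<And>j. f j \<in> C1 A"
  shows "J A g p (concat_field f) =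
    sqrt (det (matrix_inv (g (base_chart A p) p))) * \<bar>det (\<chi> j. covector A p (f j))\<bar>"
proof -
  let ?c = "base_chart A p"
  let ?G = "matrix_inv (g ?c p)"
  let ?V = "(\<chi> j. covector A p (f j)) :: real^'m^'m"
  have V: "jac ?c (concat_field f) p = ?V"
    by (subst vec_eq_iff) (simp add: covector_def jac_concat_field[OF A base_chart[OF A] f])
  have "(\<chi> i j. ?V $ i \<bullet> (?G *v ?V $ j)) = ?V ** (?G ** transpose ?V)"
    by (simp add: vec_eq_iff matrix_matrix_mult_def matrix_vector_mult_def transpose_def inner_vec_def)
  then have "J A g p (concat_field f) = sqrt (det ?V * (det ?G * det ?V))"
    unfolding J_def Let_def base_chart_def[symmetric] wedge_norm_def cotangent_inner_def V
    by (simp add: det_mul)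
  also have "det ?V * (det ?G * det ?V) = det ?G * (det ?V)\<^sup>2"
    by (simp add: power2_eq_square mult_ac)
  finally show ?thesis by (simp add: real_sqrt_mult)
qed

section \<open>Continuous and Borel functionals on the space of continuously differentiable
  maps\<close>

lemma space_C1_borel [simp]: "space (C1_borel A) = C1 A"
  unfolding C1_borel_def by (rule space_measure_of_conv)

lemma continuous_map_whitney_borel_measurable:
  fixes \<Phi> :: "('a::{t2_space, second_countable_topology} \<Rightarrow> real^'k::finite) \<Rightarrow> 'b::topological_space"
  assumes A: "smooth_manifold A" and \<Phi>: "continuous_map (weak_whitney A) euclidean \<Phi>"
  shows "\<Phi> \<in> borel_measurable (C1_borel A)"
proof (rule borel_measurableI)
  fix S :: "'b set" assume "open S"
  then have "openin (weak_whitney A) {f \<in> topspace (weak_whitney A). \<Phi> f \<in> S}"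
    using \<Phi> by (simp add: openin_continuous_map_preimage)
  moreover have "{U :: ('a \<Rightarrow> real^'k) set. openin (weak_whitney A) U} \<subseteq> Pow (C1 A)"
    using openin_subset topspace_weak_whitney[OF A] by blast
  then have "sets (C1_borel A) = sigma_sets (C1 A) {U :: ('a \<Rightarrow> real^'k) set. openin (weak_whitney A) U}"
    unfolding C1_borel_def by (rule sets_measure_of)
  moreover have "\<Phi> -` S \<inter> C1 A = {f \<in> C1 A. \<Phi> f \<in> S}" by blast
  ultimately show "\<Phi> -` S \<inter> space (C1_borel A) \<in> sets (C1_borel A)"
    by (simp add: topspace_weak_whitney[OF A] sigma_sets.Basic)
qed

text \<open>A functional governed by the value and the differential at one point is tested by a
  neighbourhood with compact set \<open>{p}\<close>.\<close>

lemma continuous_map_whitneyI: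
  fixes \<Phi> :: "('a::{t2_space, second_countable_topology} \<Rightarrow> real^'k::finite) \<Rightarrow> 'b::metric_space"
  assumes A: "smooth_manifold A" and c: "c \<in> A" "p \<in> fst c"
    and \<Phi>: "\<And>f h. dist (\<Phi> h) (\<Phi> f) \<le> max (norm (h p - f p)) (norm (jac c h p - jac c f p))"
  shows "continuous_map (weak_whitney A) euclidean \<Phi>"
  unfolding continuous_map_def
proof (intro conjI allI impI)
  fix U :: "'b set" assume "openin euclidean U"
  then have U: "open U" by simp
  show "openin (weak_whitney A) {f \<in> topspace (weak_whitney A). \<Phi> f \<in> U}"
  proof (subst openin_subopen, intro ballI)
    fix f assume "f \<in> {f \<in> topspace (weak_whitney A). \<Phi> f \<in> U}"
    then have f: "f \<in> C1 A" "\<Phi> f \<in> U" using topspace_weak_whitney[OF A] by auto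
    then obtain e where e: "0 < e" "\<And>y. dist y (\<Phi> f) < e \<Longrightarrow> y \<in> U" using U by (metis open_dist)
    have "openin (weak_whitney A) (whitney_nbhd A f c {p} e)"
      unfolding weak_whitney_def using f c e(1)
      by (intro topology_generated_by_Basis CollectI exI conjI refl) auto
    moreover have "f \<in> whitney_nbhd A f c {p} e" using f e by (simp add: whitney_nbhd_def)
    moreover have "whitney_nbhd A f c {p} e \<subseteq> {f \<in> topspace (weak_whitney A). \<Phi> f \<in> U}"
    proof
      fix h assume "h \<in> whitney_nbhd A f c {p} e"
      then have "h \<in> C1 A" "dist (\<Phi> h) (\<Phi> f) < e" using \<Phi>[of h f] by (auto simp: whitney_nbhd_def)
      then show "h \<in> {f \<in> topspace (weak_whitney A). \<Phi> f \<in> U}"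
        using e topspace_weak_whitney[OF A] by auto
    qed
    ultimately show "\<exists>T. openin (weak_whitney A) T \<and> f \<in> T \<and> T \<subseteq> {f \<in> topspace (weak_whitney A). \<Phi> f \<in> U}"
      by blast
  qed
qed simp

lemma continuous_map_eval:
  fixes A :: "('a::{t2_space, second_countable_topology}, 'm::finite) chart set"
  assumes "smooth_manifold A"
  shows "continuous_map (weak_whitney A) euclidean (\<lambda>f :: 'a \<Rightarrow> real^'k::finite. f p)"
  by (rule continuous_map_whitneyI[OF assms base_chart[OF assms], of _ p]) (simp add: dist_norm)

lemma continuous_map_covector:
  fixes A :: "('a::{t2_space, second_countable_topology}, 'm::finite) chart set"
  assumes "smooth_manifold A"
  shows "continuous_map (weak_whitney A) euclidean (covector A p)"
proof (rule continuous_map_whitneyI[OF assms base_chart[OF assms], of _ p])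
  fix f h :: "'a \<Rightarrow> real^1"
  have "norm ((jac (base_chart A p) h p - jac (base_chart A p) f p) $ 1) \<le>
      norm (jac (base_chart A p) h p - jac (base_chart A p) f p)"
    by (rule Finite_Cartesian_Product.norm_nth_le)
  then show "dist (covector A p h) (covector A p f) \<le>
      max (norm (h p - f p)) (norm (jac (base_chart A p) h p - jac (base_chart A p) f p))"
    by (simp add: covector_def dist_norm)
qed

lemma measurable_eval:
  assumes "smooth_manifold A"
  shows "(\<lambda>f. f p) \<in> borel_measurable (C1_borel A)"
  by (rule continuous_map_whitney_borel_measurable[OF assms continuous_map_eval[OF assms]])

lemma measurable_covector:
  assumes "smooth_manifold A"
  shows "covector A p \<in> borel_measurable (C1_borel A)"
  by (rule continuous_map_whitney_borel_measurable[OF assms continuous_map_covector[OF assms]])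

subsection \<open>Mixtures of conditional laws\<close>

text \<open>Conditional laws and densities are determined for almost every value only; this carries
  identities between them to the single value 0.\<close>

lemma isCont_AE_eq_0:
  fixes h :: "'a::euclidean_space \<Rightarrow> real"
  assumes cont: "isCont h z" and ae: "AE x in lborel. h x = 0"
  shows "h z = 0"
proof (rule ccontr)
  assume "h z \<noteq> 0"
  from continuous_at_avoid[OF cont this] obtain e
    where e: "0 < e" "\<And>y. dist z y < e \<Longrightarrow> h y \<noteq> 0" by blast
  have "AE x in lborel. x \<notin> ball z e"
    using ae by eventually_elim (use e(2) in auto)
  then have "ball z e \<in> null_sets lborel" by (subst (asm) AE_iff_null_sets[symmetric]) auto
  then have "negligible (ball z e)" by (simp add: negligible_iff_null_sets null_sets_completionI)
  then show False using e(1) open_not_negligible[of "ball z e"] by simp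
qed

lemma nn_integral_mixture:
  assumes sets: "sets M0 = sets M" "sets M1 = sets M"
    and mix: "\<And>B. B \<in> sets M \<Longrightarrow> emeasure M B = a * emeasure M0 B + b * emeasure M1 B"
    and h: "h \<in> borel_measurable M"
  shows "(\<integral>\<^sup>+x. h x \<partial>M) = a * (\<integral>\<^sup>+x. h x \<partial>M0) + b * (\<integral>\<^sup>+x. h x \<partial>M1)"
  using h
proof (induction rule: borel_measurable_induct)
  case (cong f h)
  have "space M0 = space M" "space M1 = space M" using sets by (auto dest: sets_eq_imp_space_eq)
  then have "(\<integral>\<^sup>+x. f x \<partial>N) = (\<integral>\<^sup>+x. h x \<partial>N)" if "N \<in> {M, M0, M1}" for N
    using that cong(3) by (intro nn_integral_cong) auto
  then show ?case using cong by simp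
next
  case (set B)
  then show ?case using mix sets by simp
next
  case (mult u c)
  moreover have "u \<in> borel_measurable M0" "u \<in> borel_measurable M1"
    using mult sets by (simp_all cong: measurable_cong_sets)
  ultimately show ?case by (simp add: nn_integral_cmult algebra_simps)
next
  case (add u v)
  moreover have "u \<in> borel_measurable M0" "u \<in> borel_measurable M1"
    "v \<in> borel_measurable M0" "v \<in> borel_measurable M1"
    using add sets by (simp_all cong: measurable_cong_sets)
  ultimately show ?case by (simp add: nn_integral_add algebra_simps)
next
  case (seq U)
  have U: "U i \<in> borel_measurable M0" "U i \<in> borel_measurable M1" for i
    using seq(1)[of i] sets by (simp_all cong: measurable_cong_sets)
  have inc: "incseq (\<lambda>i. c * (\<integral>\<^sup>+x. U i x \<partial>N))" for c N
    using seq(3) by (auto simp: incseq_def le_fun_def intro!: mult_left_mono nn_integral_mono)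
  have S: "(SUP i. U i) = (\<lambda>x. SUP i. U i x)" by (auto simp: image_comp)
  have "(\<integral>\<^sup>+x. (SUP i. U i x) \<partial>M) = (SUP i. (\<integral>\<^sup>+x. U i x \<partial>M))"
    using seq by (intro nn_integral_monotone_convergence_SUP) auto
  also have "\<dots> = (SUP i. a * (\<integral>\<^sup>+x. U i x \<partial>M0) + b * (\<integral>\<^sup>+x. U i x \<partial>M1))"
    using seq by simp
  also have "\<dots> = (SUP i. a * (\<integral>\<^sup>+x. U i x \<partial>M0)) + (SUP i. b * (\<integral>\<^sup>+x. U i x \<partial>M1))"
    by (rule ennreal_SUP_add[OF inc inc])
  also have "\<dots> = a * (SUP i. \<integral>\<^sup>+x. U i x \<partial>M0) + b * (SUP i. \<integral>\<^sup>+x. U i x \<partial>M1)"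
    by (simp add: SUP_mult_left_ennreal)
  also have "(SUP i. \<integral>\<^sup>+x. U i x \<partial>M0) = (\<integral>\<^sup>+x. (SUP i. U i x) \<partial>M0)"
    using seq U by (intro nn_integral_monotone_convergence_SUP[symmetric]) auto
  also have "(SUP i. \<integral>\<^sup>+x. U i x \<partial>M1) = (\<integral>\<^sup>+x. (SUP i. U i x) \<partial>M1)"
    using seq U by (intro nn_integral_monotone_convergence_SUP[symmetric]) auto
  finally show ?case unfolding S .
qed

lemma regular_cond_prob_kernel:
  assumes "regular_cond_prob A P X p \<kappa>"
  shows "\<kappa> \<in> measurable borel (subprob_algebra (C1_borel A))"
  using assms unfolding regular_cond_prob_def
  by (intro measurable_subprob_algebra) (auto intro: prob_space_imp_subprob_space)

text \<open>Disintegration of an integral. Binding the kernel to the law of \<open>X(p)\<close>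
  restricted to \<open>V\<close> turns the defining identity for sets into an equality of measures,
  which can then be integrated against \<open>\<Psi>\<close>.\<close>

lemma regular_cond_prob_nn_integral:
  fixes A :: "('a::{t2_space, second_countable_topology}, 'm::finite) chart set"
    and X :: "'w \<Rightarrow> 'a \<Rightarrow> real^'k::finite"
  assumes A: "smooth_manifold A" and X: "X \<in> measurable P (C1_borel A)"
    and \<kappa>: "regular_cond_prob A P X p \<kappa>"
    and r: "distributed P lborel (\<lambda>w. X w p) (\<lambda>x. ennreal (r x))"
    and \<Psi>: "\<Psi> \<in> borel_measurable (C1_borel A)" and V: "V \<in> sets borel"
  shows "(\<integral>\<^sup>+x\<in>V. ennreal (r x) * (\<integral>\<^sup>+f. \<Psi> f \<partial>\<kappa> x) \<partial>lborel) =
    (\<integral>\<^sup>+f. \<Psi> f * indicator V (f p) \<partial>distr P (C1_borel A) X)"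
proof -
  note [measurable] = X \<Psi> V regular_cond_prob_kernel[OF \<kappa>] measurable_eval[OF A, of p]
  define L where "L = distr P borel (\<lambda>w. X w p)"
  have L_eq: "L = density lborel (\<lambda>x. ennreal (r x))"
    using distributed_distr_eq_density[OF r] by (simp add: L_def cong: distr_cong)
  have r_meas [measurable]: "(\<lambda>x. ennreal (r x)) \<in> borel_measurable borel"
    using distributed_borel_measurable[OF r] by simp
  have [measurable_cong]: "sets L = sets borel" by (simp add: L_def)
  define M where "M = density L (indicator V)"
  have [measurable_cong]: "sets M = sets borel" by (simp add: M_def L_def)
  have \<kappa>M: "\<kappa> \<in> measurable M (subprob_algebra (C1_borel A))"
    using regular_cond_prob_kernel[OF \<kappa>] measurable_cong_sets[of M borel]
    by (simp add: M_def L_def)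
  have spM: "space M \<noteq> {}" by (simp add: M_def L_def)
  have \<Psi>\<kappa> [measurable]: "(\<lambda>x. \<integral>\<^sup>+f. \<Psi> f \<partial>\<kappa> x) \<in> borel_measurable borel"
    by (rule measurable_compose[OF regular_cond_prob_kernel[OF \<kappa>] nn_integral_measurable_subprob_algebra[OF \<Psi>]])
  have "M \<bind> \<kappa> = density (distr P (C1_borel A) X) (\<lambda>f. indicator V (f p))"
  proof (rule measure_eqI)
    show sets_eq: "sets (M \<bind> \<kappa>) = sets (density (distr P (C1_borel A) X) (\<lambda>f. indicator V (f p)))"
      using sets_bind[OF sets_kernel[OF \<kappa>M] spM] by simp
    fix B assume "B \<in> sets (M \<bind> \<kappa>)"
    then have B [measurable]: "B \<in> sets (C1_borel A)" using sets_eq by simp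
    have \<kappa>B [measurable]: "(\<lambda>x. emeasure (\<kappa> x) B) \<in> borel_measurable borel"
      using \<kappa> B by (auto simp: regular_cond_prob_def)
    have "emeasure (M \<bind> \<kappa>) B = (\<integral>\<^sup>+x. emeasure (\<kappa> x) B \<partial>M)"
      by (rule emeasure_bind[OF spM \<kappa>M B])
    also have "\<dots> = (\<integral>\<^sup>+x. indicator V x * emeasure (\<kappa> x) B \<partial>L)"
      unfolding M_def
    proof (rule nn_integral_density)
      show "(\<lambda>x. emeasure (\<kappa> x) B) \<in> borel_measurable L"
        using \<kappa>B measurable_cong_sets[of L borel] by (simp add: L_def)
      show "(indicator V :: _ \<Rightarrow> ennreal) \<in> borel_measurable L"
        using V by (simp add: L_def)
    qed
    also have "\<dots> = (\<integral>\<^sup>+x\<in>V. emeasure (\<kappa> x) B \<partial>L)"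
      by (simp add: mult.commute)
    also have "\<dots> = emeasure P {w \<in> space P. X w \<in> B \<and> X w p \<in> V}"
      using \<kappa> B V by (auto simp: regular_cond_prob_def L_def)
    also have "{w \<in> space P. X w \<in> B \<and> X w p \<in> V} =
        X -` (B \<inter> {f \<in> space (C1_borel A). f p \<in> V}) \<inter> space P"
      using measurable_space[OF X] by auto
    also have "emeasure P \<dots> = emeasure (distr P (C1_borel A) X) (B \<inter> {f \<in> space (C1_borel A). f p \<in> V})"
      by (rule emeasure_distr[symmetric]) measurable
    also have "\<dots> = (\<integral>\<^sup>+f. indicator (B \<inter> {f \<in> space (C1_borel A). f p \<in> V}) f \<partial>distr P (C1_borel A) X)"
      by (rule nn_integral_indicator[symmetric]) measurable
    also have "\<dots> = (\<integral>\<^sup>+f. indicator V (f p) * indicator B f \<partial>distr P (C1_borel A) X)"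
      by (intro nn_integral_cong) (auto simp: indicator_def)
    also have "\<dots> = emeasure (density (distr P (C1_borel A) X) (\<lambda>f. indicator V (f p))) B"
      by (rule emeasure_density[symmetric]) measurable
    finally show "emeasure (M \<bind> \<kappa>) B = emeasure (density (distr P (C1_borel A) X) (\<lambda>f. indicator V (f p))) B" .
  qed
  then have "(\<integral>\<^sup>+f. \<Psi> f \<partial>(M \<bind> \<kappa>)) = (\<integral>\<^sup>+f. \<Psi> f \<partial>density (distr P (C1_borel A) X) (\<lambda>f. indicator V (f p)))"
    by simp
  also have "\<dots> = (\<integral>\<^sup>+f. \<Psi> f * indicator V (f p) \<partial>distr P (C1_borel A) X)"
    by (subst nn_integral_density) (auto simp: mult.commute)
  finally have "(\<integral>\<^sup>+x. \<integral>\<^sup>+f. \<Psi> f \<partial>\<kappa> x \<partial>M) = (\<integral>\<^sup>+f. \<Psi> f * indicator V (f p) \<partial>distr P (C1_borel A) X)"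
    by (simp add: nn_integral_bind[OF \<Psi> \<kappa>M])
  moreover have "(\<integral>\<^sup>+x. \<integral>\<^sup>+f. \<Psi> f \<partial>\<kappa> x \<partial>M) = (\<integral>\<^sup>+x\<in>V. ennreal (r x) * (\<integral>\<^sup>+f. \<Psi> f \<partial>\<kappa> x) \<partial>lborel)"
    unfolding M_def by (subst nn_integral_density) (auto simp: L_eq nn_integral_density mult_ac)
  ultimately show ?thesis by simp
qed

section \<open>Laws of the differential weighted by the Jacobian\<close>

lemma J_measurable:
  fixes A :: "('a::{t2_space, second_countable_topology}, 'm::finite) chart set"
  assumes A: "smooth_manifold A"
  shows "(J A g p :: ('a \<Rightarrow> real^1) \<Rightarrow> real) \<in> borel_measurable (C1_borel A)"
proof -
  note [measurable] = measurable_covector[OF A, of p]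
  have "(\<lambda>v. sqrt (v \<bullet> (matrix_inv (g (base_chart A p) p) *v v))) \<in> borel_measurable borel"
    by (intro borel_measurable_continuous_onI continuous_intros matrix_vector_mult_linear_continuous_on)
  then show ?thesis unfolding J_real_field[abs_def] by measurable
qed

lemma riemannian_metric_posdef:
  assumes "riemannian_metric A g" "smooth_manifold A" "v \<noteq> 0"
  shows "0 < v \<bullet> (g (base_chart A p) p *v v)"
  using assms base_chart[OF assms(2)] unfolding riemannian_metric_def by blast

lemma J_nonneg:
  fixes f :: "'a::{t2_space, second_countable_topology} \<Rightarrow> real^1"
  assumes "smooth_manifold A" and "riemannian_metric A g"
  shows "0 \<le> J A g p f"
proof -
  let ?v = "covector A p f"
  have "0 \<le> ?v \<bullet> (matrix_inv (g (base_chart A p) p) *v ?v)"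
    using posdef_matrix_inv[OF riemannian_metric_posdef[OF assms(2,1), where p = p], of ?v]
    by (cases "?v = 0") auto
  then show ?thesis by (simp add: J_real_field)
qed

text \<open>\<open>J\<close> is kept inside the measure because z-KROK asserts finiteness and weak
  continuity for the weighted conditional laws. Maps critical at \<open>p\<close> carry no
  mass.\<close>

definition weighted_law ::
    "('a, 'm) chart set \<Rightarrow> (('a, 'm) chart \<Rightarrow> 'a \<Rightarrow> real^'m^'m) \<Rightarrow> 'a \<Rightarrow> ('a \<Rightarrow> real^1) measure
      \<Rightarrow> (real^'m::finite) measure" where
  "weighted_law A g p N = distr (density N (\<lambda>f. ennreal (J A g p f))) borel (covector A p)"

text \<open>For continuous, bounded, nonnegative \<open>\<phi>\<close> and a z-KROK field this is,
  in \<open>x\<close>, the Lebesgue density of the measure sending \<open>V\<close> to the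
  expectation of \<open>J_p X\<close> times \<open>\<phi>\<close> of the differential on the event
  that \<open>X(p)\<close> lies in \<open>V\<close>. That measure depends on the law of
  \<open>X\<close> alone.\<close>

definition weighted_density ::
    "('a, 'm) chart set \<Rightarrow> (('a, 'm) chart \<Rightarrow> 'a \<Rightarrow> real^'m^'m) \<Rightarrow> 'a \<Rightarrow> (real^'m::finite \<Rightarrow> real)
      \<Rightarrow> ('a \<Rightarrow> real^1 \<Rightarrow> real) \<Rightarrow> ('a \<Rightarrow> real^1 \<Rightarrow> ('a \<Rightarrow> real^1) measure) \<Rightarrow> real^1 \<Rightarrow> real" where
  "weighted_density A g p \<phi> \<rho> \<mu> x = \<rho> p x * (\<integral>v. \<phi> v \<partial>weighted_law A g p (\<mu> p x))"

lemma zKROK_weighted_density: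
  fixes A :: "('a::{t2_space, second_countable_topology}, 'm::finite) chart set"
    and X :: "'w \<Rightarrow> 'a \<Rightarrow> real^1" and \<phi> :: "real^'m \<Rightarrow> real" and p :: 'a
  assumes A: "smooth_manifold A" and g: "riemannian_metric A g" and Z: "zKROK_with A g P X \<rho> \<mu>"
    and \<phi>: "continuous_on UNIV \<phi>" "\<And>v. 0 \<le> \<phi> v" "\<And>v. \<phi> v \<le> B"
  defines "F \<equiv> weighted_density A g p \<phi> \<rho> \<mu>"
  shows "isCont F 0" and "\<And>x. 0 \<le> F x" and "(\<lambda>x. ennreal (F x)) \<in> borel_measurable borel"
    and "V \<in> sets borel \<Longrightarrow> (\<integral>\<^sup>+x\<in>V. ennreal (F x) \<partial>lborel) =
      (\<integral>\<^sup>+f. ennreal (J A g p f * \<phi> (covector A p f)) * indicator V (f p) \<partial>distr P (C1_borel A) X)"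
proof -
  have \<phi>_meas [measurable]: "\<phi> \<in> borel_measurable borel"
    using \<phi>(1) by (rule borel_measurable_continuous_onI)
  note [measurable] = measurable_covector[OF A, of p] J_measurable[OF A, of g p]
  have \<mu>_sets [measurable_cong]: "sets (\<mu> p x) = sets (C1_borel A)" for x
    using Z unfolding zKROK_with_def regular_cond_prob_def by blast
  have rcp: "regular_cond_prob A P X p (\<mu> p)" using Z unfolding zKROK_with_def by blast
  have X: "X \<in> measurable P (C1_borel A)" using Z unfolding zKROK_with_def by blast
  have r: "distributed P lborel (\<lambda>w. X w p) (\<lambda>x. ennreal (\<rho> p x))" and r0: "0 \<le> \<rho> p x" for x
    using Z unfolding zKROK_with_def by blast+
  have r_cont: "isCont (\<lambda>(q, x). \<rho> q x) (p, 0)" using Z unfolding zKROK_with_def by blast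
  have r_meas [measurable]: "(\<lambda>x. ennreal (\<rho> p x)) \<in> borel_measurable borel"
    using distributed_borel_measurable[OF r] by simp
  have fin: "finite_measure (density (\<mu> p x) (\<lambda>f. ennreal (J A g p f)))" for x
    using Z unfolding zKROK_with_def by blast
  have weak: "weakly_cont_at (weak_whitney A)
      (\<lambda>(q, x). density (\<mu> q x) (\<lambda>f. ennreal (J A g q f))) (p, 0)"
    using Z unfolding zKROK_with_def by blast
  define I where "I = (\<lambda>x. \<integral>v. \<phi> v \<partial>weighted_law A g p (\<mu> p x))"
  have I_eq: "I x = (\<integral>f. \<phi> (covector A p f) \<partial>density (\<mu> p x) (\<lambda>f. ennreal (J A g p f)))" for x
    unfolding I_def weighted_law_def by (rule integral_distr) measurable
  have I0: "0 \<le> I x" for x unfolding I_def by (intro integral_nonneg_AE) (simp add: \<phi>)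
  have F_I: "F x = \<rho> p x * I x" for x by (simp add: F_def weighted_density_def I_def)
  show F0: "0 \<le> F x" for x using r0 I0 by (simp add: F_I)
  \<comment> \<open>Restricting joint continuity to the fibre over \<open>p\<close> leaves
    continuity in \<open>x\<close> at 0.\<close>
  have path: "isCont (\<lambda>x. (p, x)) (0 :: real^1)" by (intro continuous_intros)
  have "isCont (\<lambda>x. \<rho> p x) 0"
    using isCont_o2[OF path r_cont] by simp
  moreover have "isCont I 0"
  proof -
    have "continuous_map (weak_whitney A) euclideanreal (\<phi> \<circ> covector A p)"
      using \<phi>(1) by (intro continuous_map_compose[OF continuous_map_covector[OF A]]) simp
    moreover have "bounded ((\<phi> \<circ> covector A p) ` topspace (weak_whitney A))"
      unfolding bounded_iff using \<phi>(2,3) by (intro exI[of _ B]) auto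
    ultimately have "isCont (\<lambda>y. \<integral>f. (\<phi> \<circ> covector A p) f \<partial>(case y of (q, x) \<Rightarrow>
        density (\<mu> q x) (\<lambda>f. ennreal (J A g q f)))) (p, 0)"
      using weak unfolding weakly_cont_at_def by blast
    from isCont_o2[OF path this] show ?thesis by (simp add: I_eq[abs_def])
  qed
  ultimately show "isCont F 0" unfolding F_I[abs_def] by (rule isCont_mult)
  define \<Psi> where "\<Psi> = (\<lambda>f. ennreal (J A g p f * \<phi> (covector A p f)))"
  have \<Psi>_meas: "\<Psi> \<in> borel_measurable (C1_borel A)" unfolding \<Psi>_def by measurable
  have F_eq: "ennreal (F x) = ennreal (\<rho> p x) * (\<integral>\<^sup>+f. \<Psi> f \<partial>\<mu> p x)" for x
  proof -
    interpret D: finite_measure "density (\<mu> p x) (\<lambda>f. ennreal (J A g p f))" by (rule fin)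
    have "integrable (density (\<mu> p x) (\<lambda>f. ennreal (J A g p f))) (\<lambda>f. \<phi> (covector A p f))"
      by (rule D.integrable_const_bound[of _ B]) (use \<phi> in auto)
    then have "ennreal (I x) =
        (\<integral>\<^sup>+f. ennreal (\<phi> (covector A p f)) \<partial>density (\<mu> p x) (\<lambda>f. ennreal (J A g p f)))"
      unfolding I_eq by (intro nn_integral_eq_integral[symmetric]) (simp_all add: \<phi>)
    also have "\<dots> = (\<integral>\<^sup>+f. \<Psi> f \<partial>\<mu> p x)"
      unfolding \<Psi>_def
      by (subst nn_integral_density) (auto simp: ennreal_mult' J_nonneg[OF A g])
    finally have I: "ennreal (I x) = (\<integral>\<^sup>+f. \<Psi> f \<partial>\<mu> p x)" .
    have "ennreal (F x) = ennreal (\<rho> p x) * ennreal (I x)"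
      using r0 by (simp add: F_I ennreal_mult')
    then show ?thesis unfolding I .
  qed
  have "(\<lambda>x. \<integral>\<^sup>+f. \<Psi> f \<partial>\<mu> p x) \<in> borel_measurable borel"
    by (rule measurable_compose[OF regular_cond_prob_kernel[OF rcp]
          nn_integral_measurable_subprob_algebra[OF \<Psi>_meas]])
  then show "(\<lambda>x. ennreal (F x)) \<in> borel_measurable borel" unfolding F_eq by measurable
  show "(\<integral>\<^sup>+x\<in>V. ennreal (F x) \<partial>lborel) =
      (\<integral>\<^sup>+f. ennreal (J A g p f * \<phi> (covector A p f)) * indicator V (f p) \<partial>distr P (C1_borel A) X)"
    if "V \<in> sets borel"
    unfolding F_eq \<Psi>_def[symmetric, THEN fun_cong]
    using regular_cond_prob_nn_integral[OF A X rcp r \<Psi>_meas that] .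
qed

text \<open>The mixture is assumed for laws rather than for variables, since the independent copies
  live on probability spaces of their own.\<close>

lemma zKROK_mixture_integral:
  fixes A :: "('a::{t2_space, second_countable_topology}, 'm::finite) chart set"
    and W :: "'w \<Rightarrow> 'a \<Rightarrow> real^1" and W0 :: "'w0 \<Rightarrow> 'a \<Rightarrow> real^1" and W1 :: "'w1 \<Rightarrow> 'a \<Rightarrow> real^1"
    and \<phi> :: "real^'m \<Rightarrow> real"
  assumes A: "smooth_manifold A" and g: "riemannian_metric A g"
    and Z: "zKROK_with A g Q W \<rho> \<mu>" and Z0: "zKROK_with A g Q0 W0 \<rho>0 \<mu>0"
    and Z1: "zKROK_with A g Q1 W1 \<rho>1 \<mu>1" and ab: "0 \<le> a" "0 \<le> b"
    and law: "\<And>B. B \<in> sets (C1_borel A) \<Longrightarrow> emeasure (distr Q (C1_borel A) W) B =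
      ennreal a * emeasure (distr Q0 (C1_borel A) W0) B + ennreal b * emeasure (distr Q1 (C1_borel A) W1) B"
    and \<phi>: "continuous_on UNIV \<phi>" "\<And>v. 0 \<le> \<phi> v" "\<And>v. \<phi> v \<le> B"
  shows "\<rho> p 0 * (\<integral>v. \<phi> v \<partial>weighted_law A g p (\<mu> p 0)) =
    a * (\<rho>0 p 0 * (\<integral>v. \<phi> v \<partial>weighted_law A g p (\<mu>0 p 0))) +
    b * (\<rho>1 p 0 * (\<integral>v. \<phi> v \<partial>weighted_law A g p (\<mu>1 p 0)))"
proof -
  let ?F = "weighted_density A g p \<phi>"
  note zk = zKROK_weighted_density[OF A g _ \<phi>, where p = p]
  note F = zk[OF Z] and F0 = zk[OF Z0] and F1 = zk[OF Z1]
  note [measurable] = F(3) F0(3) F1(3) measurable_covector[OF A, of p] J_measurable[OF A, of g p]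
    measurable_eval[OF A, of p] borel_measurable_continuous_onI[OF \<phi>(1)]
  have mix_eq: "ennreal (a * ?F \<rho>0 \<mu>0 x + b * ?F \<rho>1 \<mu>1 x) =
      ennreal a * ennreal (?F \<rho>0 \<mu>0 x) + ennreal b * ennreal (?F \<rho>1 \<mu>1 x)" for x
    using ab F0(2) F1(2) by (simp add: ennreal_plus ennreal_mult')
  have meas: "(\<lambda>x. ennreal a * h0 x + ennreal b * h1 x) \<in> borel_measurable borel"
    if [measurable]: "h0 \<in> borel_measurable borel" "h1 \<in> borel_measurable borel"
    for h0 h1 :: "real^1 \<Rightarrow> ennreal"
    by measurable
  have "AE x in lborel. ennreal (?F \<rho> \<mu> x) = ennreal (a * ?F \<rho>0 \<mu>0 x + b * ?F \<rho>1 \<mu>1 x)"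
  proof (rule sigma_finite_measure.density_unique2[OF sigma_finite_lborel])
    show "(\<lambda>x. ennreal (?F \<rho> \<mu> x)) \<in> borel_measurable lborel"
      "(\<lambda>x. ennreal (a * ?F \<rho>0 \<mu>0 x + b * ?F \<rho>1 \<mu>1 x)) \<in> borel_measurable lborel"
      unfolding mix_eq using meas[OF F0(3) F1(3)] F(3) by simp_all
    fix V :: "(real^1) set" assume "V \<in> sets lborel"
    then have V [measurable]: "V \<in> sets borel" by simp
    let ?\<Psi> = "\<lambda>f. ennreal (J A g p f * \<phi> (covector A p f)) * indicator V (f p)"
    have "(\<integral>\<^sup>+x\<in>V. ennreal (?F \<rho> \<mu> x) \<partial>lborel) = (\<integral>\<^sup>+f. ?\<Psi> f \<partial>distr Q (C1_borel A) W)"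
      by (rule F(4)[OF V])
    also have "\<dots> = ennreal a * (\<integral>\<^sup>+f. ?\<Psi> f \<partial>distr Q0 (C1_borel A) W0)
        + ennreal b * (\<integral>\<^sup>+f. ?\<Psi> f \<partial>distr Q1 (C1_borel A) W1)"
    proof (rule nn_integral_mixture)
      show "?\<Psi> \<in> borel_measurable (distr Q (C1_borel A) W)" by measurable
    qed (simp_all add: law)
    also have "\<dots> = ennreal a * (\<integral>\<^sup>+x\<in>V. ennreal (?F \<rho>0 \<mu>0 x) \<partial>lborel)
        + ennreal b * (\<integral>\<^sup>+x\<in>V. ennreal (?F \<rho>1 \<mu>1 x) \<partial>lborel)"
      by (simp only: F0(4)[OF V] F1(4)[OF V])
    also have "\<dots> = (\<integral>\<^sup>+x. ennreal a * (ennreal (?F \<rho>0 \<mu>0 x) * indicator V x)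
        + ennreal b * (ennreal (?F \<rho>1 \<mu>1 x) * indicator V x) \<partial>lborel)"
      by (simp add: nn_integral_add nn_integral_cmult)
    also have "\<dots> = (\<integral>\<^sup>+x\<in>V. ennreal (a * ?F \<rho>0 \<mu>0 x + b * ?F \<rho>1 \<mu>1 x) \<partial>lborel)"
      unfolding mix_eq by (intro nn_integral_cong) (simp add: algebra_simps)
    finally show "(\<integral>\<^sup>+x\<in>V. ennreal (?F \<rho> \<mu> x) \<partial>lborel) =
        (\<integral>\<^sup>+x\<in>V. ennreal (a * ?F \<rho>0 \<mu>0 x + b * ?F \<rho>1 \<mu>1 x) \<partial>lborel)" .
  qed
  then have "AE x in lborel. ?F \<rho> \<mu> x - (a * ?F \<rho>0 \<mu>0 x + b * ?F \<rho>1 \<mu>1 x) = 0"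
    by eventually_elim (use ab F(2) F0(2) F1(2) in \<open>simp del: ennreal_plus\<close>)
  moreover have "isCont (\<lambda>x. ?F \<rho> \<mu> x - (a * ?F \<rho>0 \<mu>0 x + b * ?F \<rho>1 \<mu>1 x)) 0"
    by (intro continuous_intros F(1) F0(1) F1(1))
  ultimately have "?F \<rho> \<mu> 0 - (a * ?F \<rho>0 \<mu>0 0 + b * ?F \<rho>1 \<mu>1 0) = 0"
    using isCont_AE_eq_0 by blast
  then show ?thesis by (simp add: weighted_density_def)
qed

text \<open>Indicators of closed sets are limits of bounded continuous functions, and closed sets
  form a generator of the Borel sets stable under intersections. Being closed, the whole space
  settles the complements.\<close>

lemma finite_measure_mixture_eqI:
  fixes M M0 M1 :: "'a::metric_space measure"
  assumes fin: "finite_measure M" "finite_measure M0" "finite_measure M1"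
    and sets: "sets M = sets borel" "sets M0 = sets borel" "sets M1 = sets borel"
    and int: "\<And>\<phi>. continuous_on UNIV \<phi> \<Longrightarrow> (\<And>x. 0 \<le> \<phi> x) \<Longrightarrow> (\<And>x. \<phi> x \<le> 1) \<Longrightarrow>
      r * (\<integral>x. \<phi> x \<partial>M) = a * (\<integral>x. \<phi> x \<partial>M0) + b * (\<integral>x. \<phi> x \<partial>M1)"
    and B: "B \<in> sets borel"
  shows "r * measure M B = a * measure M0 B + b * measure M1 B"
proof -
  have space: "space M = UNIV" "space M0 = UNIV" "space M1 = UNIV"
    using sets by (auto dest: sets_eq_imp_space_eq)
  have closed: "r * measure M C = a * measure M0 C + b * measure M1 C" if "closed C" for C
  proof (cases "C = {}")
    case False
    \<comment> \<open>These functions decrease to the indicator of \<open>C\<close>. The empty set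
      is treated apart, because \<open>infdist x {}\<close> is 0 by convention.\<close>
    define \<phi> where "\<phi> = (\<lambda>(n::nat) x. max 0 (1 - real n * infdist x C))"
    have \<phi>_cont: "continuous_on UNIV (\<phi> n)" for n
      unfolding \<phi>_def by (intro continuous_intros)
    have lim: "(\<lambda>n. \<phi> n x) \<longlonglongrightarrow> indicator C x" for x
    proof (cases "x \<in> C")
      case True
      then show ?thesis by (simp add: \<phi>_def)
    next
      case False
      then have d: "0 < infdist x C"
        using infdist_pos_not_in_closed[OF \<open>closed C\<close> \<open>C \<noteq> {}\<close>] by simp
      obtain N where N: "1 < real N * infdist x C"
        using ex_less_of_nat_mult[OF d, of 1] by blast
      have "\<phi> n x = indicator C x" if "N \<le> n" for n
      proof -
        have "real N * infdist x C \<le> real n * infdist x C" using that d by (intro mult_right_mono) auto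
        then show ?thesis using N False by (simp add: \<phi>_def)
      qed
      then show ?thesis by (intro tendsto_eventually) (auto simp: eventually_sequentially)
    qed
    have int_lim: "(\<lambda>n. \<integral>x. \<phi> n x \<partial>N) \<longlonglongrightarrow> measure N C"
      if "finite_measure N" "sets N = sets borel" for N
    proof -
      interpret finite_measure N by fact
      have "(\<lambda>n. \<integral>x. \<phi> n x \<partial>N) \<longlonglongrightarrow> (\<integral>x. indicator C x \<partial>N)"
      proof (rule integral_dominated_convergence[where w = "\<lambda>_. 1"])
        show "\<phi> n \<in> borel_measurable N" for n
          using borel_measurable_continuous_onI[OF \<phi>_cont] that(2) by (simp cong: measurable_cong_sets)
        have "C \<in> sets N" using \<open>closed C\<close> that(2) by simp
        then show "(indicator C :: 'a \<Rightarrow> real) \<in> borel_measurable N" by (rule borel_measurable_indicator)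
      qed (use lim in \<open>auto simp: \<phi>_def infdist_nonneg\<close>)
      then show ?thesis using sets_eq_imp_space_eq[OF that(2)] by simp
    qed
    have "(\<lambda>n. r * (\<integral>x. \<phi> n x \<partial>M)) \<longlonglongrightarrow> r * measure M C"
      by (intro tendsto_intros int_lim fin sets)
    moreover have "(\<lambda>n. a * (\<integral>x. \<phi> n x \<partial>M0) + b * (\<integral>x. \<phi> n x \<partial>M1)) \<longlonglongrightarrow>
        a * measure M0 C + b * measure M1 C"
      by (intro tendsto_intros int_lim fin sets)
    moreover have "r * (\<integral>x. \<phi> n x \<partial>M) = a * (\<integral>x. \<phi> n x \<partial>M0) + b * (\<integral>x. \<phi> n x \<partial>M1)" for n
      by (rule int[OF \<phi>_cont]) (auto simp: \<phi>_def infdist_nonneg)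
    ultimately show ?thesis using LIMSEQ_unique by simp
  qed simp
  have "Int_stable (Collect closed :: 'a set set)" by (auto simp: Int_stable_def)
  moreover have "Collect closed \<subseteq> Pow (UNIV :: 'a set)" by simp
  moreover have "B \<in> sigma_sets UNIV (Collect closed)" using B by (simp add: borel_eq_closed)
  ultimately show ?thesis
  proof (induction rule: sigma_sets_induct_disjoint)
    case (compl C)
    then have C: "C \<in> sets borel" by (simp add: borel_eq_closed)
    have diff: "measure N (UNIV - C) = measure N UNIV - measure N C"
      if "finite_measure N" "sets N = sets borel" for N
      using finite_measure.finite_measure_compl[OF that(1), of C] C that(2) sets_eq_imp_space_eq[OF that(2)]
      by simp
    then show ?case
      unfolding diff[OF fin(1) sets(1)] diff[OF fin(2) sets(2)] diff[OF fin(3) sets(3)]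
      using compl(2) closed[OF closed_UNIV] by (simp add: right_diff_distrib)
  next
    case (union C)
    then have C: "range C \<subseteq> sets borel" by (auto simp: borel_eq_closed)
    have sums: "(\<lambda>i. measure N (C i)) sums measure N (\<Union>i. C i)"
      if "finite_measure N" "sets N = sets borel" for N
      using finite_measure.finite_measure_UNION[OF that(1), of C] C union(1) that(2) by simp
    have "(\<lambda>i. r * measure M (C i)) sums (r * measure M (\<Union>i. C i))"
      by (intro sums_mult sums fin sets)
    moreover have "(\<lambda>i. a * measure M0 (C i) + b * measure M1 (C i)) sums
        (a * measure M0 (\<Union>i. C i) + b * measure M1 (\<Union>i. C i))"
      by (intro sums_add sums_mult sums fin sets)
    ultimately show ?case using union(3) sums_unique2 by simp
  qed (use closed in auto)
qed

text \<open>Used in two ways: for the mixed field itself, and with \<open>a = 1\<close>,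
  \<open>b = 0\<close> to see that density times weighted law depends neither on the versions nor on
  the copy chosen.\<close>

lemma zKROK_mixture_measure:
  fixes A :: "('a::{t2_space, second_countable_topology}, 'm::finite) chart set"
    and W :: "'w \<Rightarrow> 'a \<Rightarrow> real^1" and W0 :: "'w0 \<Rightarrow> 'a \<Rightarrow> real^1" and W1 :: "'w1 \<Rightarrow> 'a \<Rightarrow> real^1"
  assumes A: "smooth_manifold A" and g: "riemannian_metric A g"
    and Z: "zKROK_with A g Q W \<rho> \<mu>" and Z0: "zKROK_with A g Q0 W0 \<rho>0 \<mu>0"
    and Z1: "zKROK_with A g Q1 W1 \<rho>1 \<mu>1" and ab: "0 \<le> a" "0 \<le> b"
    and law: "\<And>B. B \<in> sets (C1_borel A) \<Longrightarrow> emeasure (distr Q (C1_borel A) W) B =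
      ennreal a * emeasure (distr Q0 (C1_borel A) W0) B + ennreal b * emeasure (distr Q1 (C1_borel A) W1) B"
    and S: "S \<in> sets borel"
  shows "\<rho> p 0 * measure (weighted_law A g p (\<mu> p 0)) S =
    a * (\<rho>0 p 0 * measure (weighted_law A g p (\<mu>0 p 0)) S) +
    b * (\<rho>1 p 0 * measure (weighted_law A g p (\<mu>1 p 0)) S)"
proof -
  have fin: "finite_measure (weighted_law A g p (\<nu> p 0))"
    if "zKROK_with A g R Y \<sigma> \<nu>" for R and Y :: "'x \<Rightarrow> 'a \<Rightarrow> real^1" and \<sigma> \<nu>
  proof -
    have "sets (\<nu> p 0) = sets (C1_borel A)"
      using that unfolding zKROK_with_def regular_cond_prob_def by blast
    then have "covector A p \<in> borel_measurable (density (\<nu> p 0) (\<lambda>f. ennreal (J A g p f)))"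
      using measurable_covector[OF A, of p] by (simp cong: measurable_cong_sets)
    moreover have "finite_measure (density (\<nu> p 0) (\<lambda>f. ennreal (J A g p f)))"
      using that unfolding zKROK_with_def by blast
    ultimately show ?thesis
      unfolding weighted_law_def by (intro finite_measure.finite_measure_distr)
  qed
  have "\<rho> p 0 * measure (weighted_law A g p (\<mu> p 0)) S =
    (a * \<rho>0 p 0) * measure (weighted_law A g p (\<mu>0 p 0)) S +
    (b * \<rho>1 p 0) * measure (weighted_law A g p (\<mu>1 p 0)) S"
  proof (rule finite_measure_mixture_eqI[OF fin[OF Z] fin[OF Z0] fin[OF Z1] _ _ _ _ S])
    fix \<phi> :: "real^'m \<Rightarrow> real"
    assume \<phi>: "continuous_on UNIV \<phi>" "\<And>v. 0 \<le> \<phi> v" "\<And>v. \<phi> v \<le> 1"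
    show "\<rho> p 0 * (\<integral>v. \<phi> v \<partial>weighted_law A g p (\<mu> p 0)) =
      (a * \<rho>0 p 0) * (\<integral>v. \<phi> v \<partial>weighted_law A g p (\<mu>0 p 0)) +
      (b * \<rho>1 p 0) * (\<integral>v. \<phi> v \<partial>weighted_law A g p (\<mu>1 p 0))"
      using zKROK_mixture_integral[OF A g Z Z0 Z1 ab law \<phi>] by (simp add: mult.assoc)
  qed (simp_all add: weighted_law_def)
  then show ?thesis by (simp add: mult.assoc)
qed

subsection \<open>Densities as limits of determinantal sums\<close>

text \<open>For given \<open>y\<close> exactly one list survives, the one with entries
  \<open>y j\<close>. The expansion writes the determinant of random rows with finitely many values
  as a sum of products over rows, which a product measure integrates factor by factor.\<close>

lemma sum_lists_rows:
  fixes y :: "'m::finite \<Rightarrow> real^'m" and c :: "'m \<Rightarrow> real"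
  assumes fin: "finite I" and y: "\<And>j. y j \<in> I"
  shows "(\<Sum>L\<in>{L. set L \<subseteq> I \<and> length L = CARD('m)}. 
      (\<Prod>j\<in>UNIV. c j * indicator {L ! list_pos j} (y j)) * abs_list_det L) =
    (\<Prod>j\<in>UNIV. c j) * \<bar>det (\<chi> j. y j)\<bar>"
proof -
  let ?A = "{L. set L \<subseteq> I \<and> length L = CARD('m)}"
  define L0 where "L0 = map (\<lambda>n. y (inv_into UNIV list_pos n)) [0..<CARD('m)]"
  have inv: "inv_into UNIV list_pos (list_pos j) = j" for j :: 'm
    by (intro inv_into_f_f) (auto simp: inj_on_def)
  have L0: "L0 ! list_pos j = y j" "L0 \<in> ?A" for j
    using y by (auto simp: L0_def inv)
  have "(\<Prod>j\<in>UNIV. c j * indicator {L ! list_pos j} (y j)) = 0" if "L \<in> ?A - {L0}" for L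
  proof -
    have "\<exists>n<CARD('m). L ! n \<noteq> L0 ! n"
      using that L0(2) nth_equalityI[of L L0] by auto
    then obtain j where "L ! list_pos j \<noteq> y j" by (metis L0(1) list_pos_surj)
    then show ?thesis by (intro prod_zero) (auto intro!: exI[of _ j])
  qed
  moreover have "finite ?A" using finite_lists_length_eq[OF fin] by simp
  ultimately have "(\<Sum>L\<in>?A. (\<Prod>j\<in>UNIV. c j * indicator {L ! list_pos j} (y j)) * abs_list_det L) =
      (\<Sum>L\<in>{L0}. (\<Prod>j\<in>UNIV. c j * indicator {L ! list_pos j} (y j)) * abs_list_det L)"
    using L0(2) by (intro sum.mono_neutral_right) auto
  also have "\<dots> = (\<Prod>j\<in>UNIV. c j) * \<bar>det (\<chi> j. y j)\<bar>"
    using L0 by (simp add: abs_list_det_def list_det_def)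
  finally show ?thesis .
qed

definition conorm :: "real^'m^'m \<Rightarrow> real^'m::finite \<Rightarrow> real" where
  "conorm G v = sqrt (v \<bullet> (G *v v))"

lemma abs_det_scaled_rows:
  fixes u :: "'m::finite \<Rightarrow> real^'m" and c :: "'m \<Rightarrow> real"
  assumes "\<And>j. 0 \<le> c j"
  shows "(\<Prod>j\<in>UNIV. c j) * \<bar>det (\<chi> j. u j)\<bar> = \<bar>det (\<chi> j. c j *\<^sub>R u j)\<bar>"
  using det_rows_mul[of c u] assms by (simp add: scalar_mult_eq_scaleR abs_mult prod_nonneg)

text \<open>By homogeneity the norm of each row is moved into the measure; the normalized rows are
  bounded and are approximated by the simple functions \<open>s n\<close>. Their determinant
  integrates to the \<open>multisum\<close> of the cell weights. A single \<open>w\<close> suffices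
  because the copies share their law.\<close>

lemma intersection_density_limit:
  fixes A :: "('a::{t2_space, second_countable_topology}, 'm::finite) chart set"
    and \<rho> :: "'m \<Rightarrow> 'a \<Rightarrow> real^1 \<Rightarrow> real" and \<mu> :: "'m \<Rightarrow> 'a \<Rightarrow> real^1 \<Rightarrow> ('a \<Rightarrow> real^1) measure"
    and g :: "('a, 'm) chart \<Rightarrow> 'a \<Rightarrow> real^'m^'m" and p :: 'a
    and s :: "nat \<Rightarrow> real^'m \<Rightarrow> real^'m"
  defines "G \<equiv> matrix_inv (g (base_chart A p) p)"
  assumes A: "smooth_manifold A" and g: "riemannian_metric A g"
    and prob: "\<And>j. prob_space (\<mu> j p 0)" and sets: "\<And>j. sets (\<mu> j p 0) = sets (C1_borel A)"
    and fin: "\<And>j. finite_measure (density (\<mu> j p 0) (\<lambda>f. ennreal (J A g p f)))"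
    and w: "\<And>j S. S \<in> sets borel \<Longrightarrow> \<rho> j p 0 * measure (weighted_law A g p (\<mu> j p 0)) S = w S"
    and s: "\<And>n. simple_function borel (s n)" "\<And>v. (\<lambda>n. s n v) \<longlonglongrightarrow> v /\<^sub>R conorm G v"
      "\<And>n v. norm (s n v) \<le> R"
  shows "(\<lambda>n. sqrt (det G) * multisum (range (s n)) (\<lambda>v. w (s n -` {v})) abs_list_det CARD('m) [])
    \<longlonglongrightarrow> intersection_density A g \<rho> \<mu> p"
proof -
  define M where "M = (\<lambda>j. \<mu> j p 0)"
  define D where "D = (covector A p :: ('a \<Rightarrow> real^1) \<Rightarrow> real^'m)"
  define j where "j = (J A g p :: ('a \<Rightarrow> real^1) \<Rightarrow> real)"
  interpret P: prob_space "M i" for i unfolding M_def by (rule prob)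
  interpret product_sigma_finite M by standard
  have M_sets [measurable_cong]: "sets (M i) = sets (C1_borel A)" for i by (simp add: M_def sets)
  have M_space: "space (M i) = C1 A" for i using sets_eq_imp_space_eq[OF M_sets] by simp
  have D_meas [measurable]: "D \<in> borel_measurable (C1_borel A)"
    unfolding D_def by (rule measurable_covector[OF A])
  have j_meas [measurable]: "j \<in> borel_measurable (C1_borel A)"
    unfolding j_def by (rule J_measurable[OF A])
  have s_meas [measurable]: "s n \<in> borel_measurable borel" for n
    using borel_measurable_simple_function[OF s(1)] .
  have j0: "0 \<le> j f" for f unfolding j_def by (rule J_nonneg[OF A g])
  have j_eq: "j f = conorm G (D f)" for f
    by (simp add: j_def D_def conorm_def G_def J_real_field)
  have j_int: "integrable (M i) j" for i
  proof (rule integrableI_nonneg)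
    interpret F: finite_measure "density (M i) (\<lambda>f. ennreal (j f))" unfolding M_def j_def by (rule fin)
    have "(\<integral>\<^sup>+f. ennreal (j f) \<partial>M i) = emeasure (density (M i) (\<lambda>f. ennreal (j f))) (space (M i))"
      by (subst emeasure_density) (auto intro!: nn_integral_cong)
    then show "(\<integral>\<^sup>+f. ennreal (j f) \<partial>M i) < \<infinity>" using F.emeasure_finite by (simp add: less_top[symmetric])
  qed (use j0 in \<open>auto simp: M_sets cong: measurable_cong_sets\<close>)
  let ?\<Pi> = "\<Pi>\<^sub>M i\<in>UNIV. M i"
  \<comment> \<open>The integrand with normalized rows replaced by \<open>s n\<close>: the factors
    \<open>j (x i)\<close> restore the norms.\<close>
  define \<Phi> where "\<Phi> = (\<lambda>n x. (\<Prod>i\<in>UNIV. j (x i)) * \<bar>det (\<chi> i. s n (D (x i)))\<bar>)"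
  have cell: "(\<integral>f. j f * indicator {v} (s n (D f)) \<partial>M i) = measure (weighted_law A g p (M i)) (s n -` {v})"
    for n i v
  proof -
    let ?N = "density (M i) (\<lambda>f. ennreal (j f))"
    have S: "s n -` {v} \<in> sets borel" using simple_functionD(2)[OF s(1), of n "{v}"] by simp
    have "measure (weighted_law A g p (M i)) (s n -` {v}) = measure ?N (D -` (s n -` {v}) \<inter> space ?N)"
      unfolding weighted_law_def D_def[symmetric] j_def[symmetric]
      using S by (intro measure_distr) simp_all
    also have "\<dots> = (\<integral>f. indicator (D -` (s n -` {v}) \<inter> space ?N) f \<partial>?N)"
      by simp
    also have "\<dots> = (\<integral>f. j f * indicator (D -` (s n -` {v}) \<inter> space (M i)) f \<partial>M i)"
      using j0 S by (subst integral_density) (auto intro!: measurable_sets)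
    also have "\<dots> = (\<integral>f. j f * indicator {v} (s n (D f)) \<partial>M i)"
      by (intro Bochner_Integration.integral_cong) (auto simp: indicator_def)
    finally show ?thesis by simp
  qed
  have cell_int: "integrable (M i) (\<lambda>f. j f * indicator {v} (s n (D f)))" for n i v
  proof (rule Bochner_Integration.integrable_bound[OF j_int])
    show "(\<lambda>f. j f * indicator {v} (s n (D f))) \<in> borel_measurable (M i)" by measurable
  qed (use j0 in \<open>auto simp: indicator_def\<close>)
  have simple_integral: "(\<integral>x. \<Phi> n x \<partial>?\<Pi>) * (\<Prod>i\<in>UNIV. \<rho> i p 0) =
      multisum (range (s n)) (\<lambda>v. w (s n -` {v})) abs_list_det CARD('m) []" for n
  proof -
    let ?A = "{L. set L \<subseteq> range (s n) \<and> length L = CARD('m)}"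
    have fr: "finite (range (s n))" using simple_functionD(1)[OF s(1), of n] by simp
    have "\<Phi> n x = (\<Sum>L\<in>?A. (\<Prod>i\<in>UNIV. j (x i) * indicator {L ! list_pos i} (s n (D (x i)))) * abs_list_det L)" for x
      unfolding \<Phi>_def by (rule sum_lists_rows[OF fr, symmetric]) simp
    then have "(\<integral>x. \<Phi> n x \<partial>?\<Pi>) = (\<Sum>L\<in>?A.
        (\<integral>x. (\<Prod>i\<in>UNIV. j (x i) * indicator {L ! list_pos i} (s n (D (x i)))) \<partial>?\<Pi>) * abs_list_det L)"
      by (simp add: product_integrable_prod[OF finite cell_int])
    also have "\<dots> = (\<Sum>L\<in>?A. (\<Prod>i\<in>UNIV. measure (weighted_law A g p (M i)) (s n -` {L ! list_pos i})) * abs_list_det L)"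
      by (simp add: product_integral_prod[OF finite cell_int] cell)
    finally have "(\<integral>x. \<Phi> n x \<partial>?\<Pi>) * (\<Prod>i\<in>UNIV. \<rho> i p 0) = (\<Sum>L\<in>?A.
        (\<Prod>i\<in>UNIV. \<rho> i p 0 * measure (weighted_law A g p (M i)) (s n -` {L ! list_pos i})) * abs_list_det L)"
      by (simp add: sum_distrib_left prod.distrib mult_ac)
    also have "\<dots> = (\<Sum>L\<in>?A. prod_list (map (\<lambda>v. w (s n -` {v})) L) * abs_list_det (L @ []))"
    proof (intro sum.cong refl)
      fix L assume "L \<in> ?A"
      moreover have "s n -` {v} \<in> sets borel" for v using simple_functionD(2)[OF s(1), of n "{v}"] by simp
      ultimately show "(\<Prod>i\<in>UNIV. \<rho> i p 0 * measure (weighted_law A g p (M i)) (s n -` {L ! list_pos i})) * abs_list_det L =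
          prod_list (map (\<lambda>v. w (s n -` {v})) L) * abs_list_det (L @ [])"
        by (simp add: prod_list_map_list_pos M_def w)
    qed
    finally show ?thesis by (simp add: multisum_eq_sum_lists[OF fr])
  qed
  have nth_meas [measurable]: "(\<lambda>v :: real^'m. v $ k) \<in> borel_measurable borel" for k
    by (intro borel_measurable_continuous_onI continuous_intros)
  have comp_meas [measurable]: "(\<lambda>x. x i) \<in> measurable ?\<Pi> (C1_borel A)" for i
    using measurable_component_singleton[of i UNIV M] measurable_cong_sets[OF refl M_sets[of i], of ?\<Pi>] by simp
  \<comment> \<open>Determinants of rows bounded by \<open>R\<close> are uniformly bounded, and the
    product of the \<open>j (x i)\<close> is integrable because each factor is.\<close>
  have "(\<lambda>n. \<integral>x. \<Phi> n x \<partial>?\<Pi>) \<longlonglongrightarrow> (\<integral>x. \<bar>det (\<chi> i. D (x i))\<bar> \<partial>?\<Pi>)"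
  proof (rule integral_dominated_convergence[where
        w = "\<lambda>x. (\<Prod>i\<in>UNIV. j (x i)) * (fact CARD('m) * R ^ CARD('m))"])
    show "(\<lambda>x. \<bar>det (\<chi> i. D (x i))\<bar>) \<in> borel_measurable ?\<Pi>"
      "\<Phi> n \<in> borel_measurable ?\<Pi>" for n
      unfolding \<Phi>_def det_def vec_lambda_beta by measurable
    show "integrable ?\<Pi> (\<lambda>x. (\<Prod>i\<in>UNIV. j (x i)) * (fact CARD('m) * R ^ CARD('m)))"
      by (intro integrable_mult_left product_integrable_prod) (simp_all add: j_int)
    have "\<bar>det (\<chi> i. s n (D (x i)))\<bar> \<le> fact CARD('m) * R ^ CARD('m)" for n x
    proof -
      have "(\<Prod>i\<in>(UNIV :: 'm set). norm (s n (D (x i)))) \<le> (\<Prod>i\<in>(UNIV :: 'm set). R)"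
        by (intro prod_mono) (auto simp: s(3))
      then have "fact CARD('m) * (\<Prod>i\<in>(UNIV :: 'm set). norm (s n (D (x i)))) \<le> fact CARD('m) * R ^ CARD('m)"
        by (intro mult_left_mono) auto
      then show ?thesis
        by (rule order_trans[rotated]) (use abs_det_le_prod_norm[of "\<chi> i. s n (D (x i))"] in simp)
    qed
    then show "AE x in ?\<Pi>. norm (\<Phi> n x) \<le> (\<Prod>i\<in>UNIV. j (x i)) * (fact CARD('m) * R ^ CARD('m))" for n
      unfolding \<Phi>_def by (intro AE_I2) (auto simp: abs_mult prod_nonneg j0 abs_prod intro!: mult_left_mono)
    have "(\<lambda>n. \<Phi> n x) \<longlonglongrightarrow> \<bar>det (\<chi> i. D (x i))\<bar>" for x
    proof -
      have "(\<lambda>n. \<Phi> n x) \<longlonglongrightarrow>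
          (\<Prod>i\<in>UNIV. j (x i)) * \<bar>det (\<chi> i. D (x i) /\<^sub>R conorm G (D (x i)))\<bar>"
        unfolding \<Phi>_def det_def vec_lambda_beta by (intro tendsto_intros s(2))
      moreover have "(\<Prod>i\<in>UNIV. j (x i)) * \<bar>det (\<chi> i. D (x i) /\<^sub>R conorm G (D (x i)))\<bar> =
          \<bar>det (\<chi> i. j (x i) *\<^sub>R (D (x i) /\<^sub>R conorm G (D (x i))))\<bar>"
        by (rule abs_det_scaled_rows[OF j0])
      moreover have "(\<lambda>i. j (x i) *\<^sub>R (D (x i) /\<^sub>R conorm G (D (x i)))) = (\<lambda>i. D (x i))"
      proof
        fix i
        have "0 < conorm G (D (x i))" if "D (x i) \<noteq> 0"
          unfolding conorm_def G_def
          using posdef_matrix_inv[OF riemannian_metric_posdef[OF g A, where p = p] that] by simp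
        then show "j (x i) *\<^sub>R (D (x i) /\<^sub>R conorm G (D (x i))) = D (x i)"
          by (cases "D (x i) = 0") (auto simp: j_eq)
      qed
      ultimately show ?thesis by simp
    qed
    then show "AE x in ?\<Pi>. (\<lambda>n. \<Phi> n x) \<longlonglongrightarrow> \<bar>det (\<chi> i. D (x i))\<bar>" by simp
  qed
  then have "(\<lambda>n. sqrt (det G) * ((\<integral>x. \<Phi> n x \<partial>?\<Pi>) * (\<Prod>i\<in>UNIV. \<rho> i p 0))) \<longlonglongrightarrow>
      sqrt (det G) * ((\<integral>x. \<bar>det (\<chi> i. D (x i))\<bar> \<partial>?\<Pi>) * (\<Prod>i\<in>UNIV. \<rho> i p 0))"
    by (intro tendsto_intros)
  moreover have "(\<integral>x. J A g p (concat_field x) \<partial>?\<Pi>) = (\<integral>x. sqrt (det G) * \<bar>det (\<chi> i. D (x i))\<bar> \<partial>?\<Pi>)"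
  proof (rule Bochner_Integration.integral_cong[OF refl])
    fix x assume "x \<in> space ?\<Pi>"
    then have "x i \<in> C1 A" for i by (auto simp: space_PiM M_space PiE_iff)
    then show "J A g p (concat_field x) = sqrt (det G) * \<bar>det (\<chi> i. D (x i))\<bar>"
      by (simp add: J_concat_field[OF A] G_def D_def)
  qed
  ultimately show ?thesis
    unfolding simple_integral intersection_density_def M_def[symmetric] by (simp add: mult_ac)
qed

text \<open>At \<open>v = 0\<close> the normalized vector is \<open>0\<close>, as division by zero gives \<open>0\<close>.\<close>

lemma simple_directions:
  fixes G :: "real^'m^'m::finite"
  assumes pos: "\<And>v. v \<noteq> 0 \<Longrightarrow> 0 < v \<bullet> (G *v v)"
  obtains s :: "nat \<Rightarrow> real^'m \<Rightarrow> real^'m" and R where "\<And>n. simple_function borel (s n)"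
    "\<And>v. (\<lambda>n. s n v) \<longlonglongrightarrow> v /\<^sub>R conorm G v" "\<And>n v. norm (s n v) \<le> R"
proof -
  have "(\<lambda>v. v /\<^sub>R conorm G v) \<in> borel_measurable borel"
  proof (rule borel_measurable_scaleR)
    have "conorm G \<in> borel_measurable borel"
      unfolding conorm_def
      by (intro borel_measurable_continuous_onI continuous_intros matrix_vector_mult_linear_continuous_on)
    then show "(\<lambda>v. inverse (conorm G v)) \<in> borel_measurable borel" by measurable
  qed simp
  from borel_measurable_implies_sequence_metric[OF this, of 0] obtain s where
    s: "\<And>n. simple_function borel (s n)" "\<And>v. (\<lambda>n. s n v) \<longlonglongrightarrow> v /\<^sub>R conorm G v"
      "\<And>n v. norm (s n v) \<le> 2 * norm (v /\<^sub>R conorm G v)"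
    by auto
  \<comment> \<open>Normalized directions have Euclidean norm at most \<open>C\<close>, and the
    approximating sequence at most doubles it.\<close>
  obtain C where C: "0 < C" "\<And>v. norm v \<le> C * conorm G v"
    using posdef_norm_bound[OF pos] unfolding conorm_def by blast
  have "norm (s n v) \<le> 2 * C" for n v
  proof (cases "v = 0")
    case False
    then have "0 < conorm G v" using pos by (simp add: conorm_def)
    then have "norm (v /\<^sub>R conorm G v) \<le> C"
      using C(2)[of v] by (simp add: field_simps)
    then show ?thesis using s(3)[of n v] by linarith
  next
    case True
    then show ?thesis using s(3)[of n v] C(1) by simp
  qed
  then show thesis using that s(1,2) by blast
qed

text \<open>On each value of \<open>\<epsilon>\<close> the mixed field coincides with one of the
  two, and independence factors each piece. \<open>X0\<close> and \<open>X1\<close> may depend on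
  each other.\<close>

lemma mixture_law:
  fixes A :: "('a::topological_space, 'm::finite) chart set" and X0 X1 :: "'w \<Rightarrow> 'a \<Rightarrow> real^'k::finite"
  assumes P: "prob_space P"
    and X0 [measurable]: "X0 \<in> measurable P (C1_borel A)" and X1 [measurable]: "X1 \<in> measurable P (C1_borel A)"
    and Xt: "Xt \<in> measurable P (C1_borel A)"
    and \<epsilon>: "\<epsilon> \<in> measurable P (count_space {0, 1::real})"
    and indep: "prob_space.indep_set P
      (sets (vimage_algebra (space P) \<epsilon> (count_space {0, 1})))
      (sets (vimage_algebra (space P) (\<lambda>w. (X0 w, X1 w)) (C1_borel A \<Otimes>\<^sub>M C1_borel A)))"
    and p0: "measure P {w \<in> space P. \<epsilon> w = 0} = 1 - t"
    and p1: "measure P {w \<in> space P. \<epsilon> w = 1} = t"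
    and Xt_def: "Xt = (\<lambda>w p. (1 - \<epsilon> w) *\<^sub>R X0 w p + \<epsilon> w *\<^sub>R X1 w p)"
    and t: "0 \<le> t" "t \<le> 1" and B [measurable]: "B \<in> sets (C1_borel A)"
  shows "emeasure (distr P (C1_borel A) Xt) B =
    ennreal (1 - t) * emeasure (distr P (C1_borel A) X0) B + ennreal t * emeasure (distr P (C1_borel A) X1) B"
proof -
  interpret prob_space P by (rule P)
  define E where "E = (\<lambda>e. {w \<in> space P. \<epsilon> w = e})"
  define S where "S = (\<lambda>Y. Y -` B \<inter> space P)"
  have E01: "\<epsilon> w = 0 \<or> \<epsilon> w = 1" if "w \<in> space P" for w
    using measurable_space[OF \<epsilon> that] by auto
  have split: "S Xt = (E 0 \<inter> S X0) \<union> (E 1 \<inter> S X1)"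
  proof (rule set_eqI)
    fix w
    have "Xt w = X0 w" if "\<epsilon> w = 0" using that by (simp add: Xt_def)
    moreover have "Xt w = X1 w" if "\<epsilon> w = 1" using that by (simp add: Xt_def)
    ultimately show "w \<in> S Xt \<longleftrightarrow> w \<in> (E 0 \<inter> S X0) \<union> (E 1 \<inter> S X1)"
      using E01[of w] by (auto simp: S_def E_def)
  qed
  have E_alg: "E e \<in> sets (vimage_algebra (space P) \<epsilon> (count_space {0, 1}))" if "e \<in> {0, 1}" for e
  proof -
    have "\<epsilon> -` {e} \<inter> space P \<in> sets (vimage_algebra (space P) \<epsilon> (count_space {0, 1}))"
      using that by (intro in_vimage_algebra) simp
    moreover have "\<epsilon> -` {e} \<inter> space P = E e" by (auto simp: E_def)
    ultimately show ?thesis by simp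
  qed
  have sp: "Y w \<in> space (C1_borel A)" if "Y \<in> {X0, X1}" "w \<in> space P" for Y w
    using that measurable_space[OF X0] measurable_space[OF X1] by blast
  let ?V = "vimage_algebra (space P) (\<lambda>w. (X0 w, X1 w)) (C1_borel A \<Otimes>\<^sub>M C1_borel A)"
  have "(\<lambda>w. (X0 w, X1 w)) -` (B \<times> space (C1_borel A)) \<inter> space P \<in> sets ?V"
    "(\<lambda>w. (X0 w, X1 w)) -` (space (C1_borel A) \<times> B) \<inter> space P \<in> sets ?V"
    by (rule in_vimage_algebra; measurable)+
  moreover have "(\<lambda>w. (X0 w, X1 w)) -` (B \<times> space (C1_borel A)) \<inter> space P = S X0"
    "(\<lambda>w. (X0 w, X1 w)) -` (space (C1_borel A) \<times> B) \<inter> space P = S X1"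
    using sp by (auto simp: S_def)
  ultimately have S_alg: "S X0 \<in> sets ?V" "S X1 \<in> sets ?V" by simp_all
  have E_meas: "E e \<in> events" if "e \<in> {0, 1}" for e
  proof -
    have "\<epsilon> -` {e} \<inter> space P \<in> events" using that by (intro measurable_sets[OF \<epsilon>]) simp
    moreover have "\<epsilon> -` {e} \<inter> space P = E e" by (auto simp: E_def)
    ultimately show ?thesis by simp
  qed
  have S_meas: "S X0 \<in> events" "S X1 \<in> events" unfolding S_def by measurable
  have "prob (S Xt) = prob (E 0 \<inter> S X0) + prob (E 1 \<inter> S X1)"
    unfolding split using E_meas S_meas by (intro finite_measure_Union) (auto simp: E_def)
  also have "\<dots> = (1 - t) * prob (S X0) + t * prob (S X1)"
    using indep_setD[OF indep E_alg S_alg(1), of 0] indep_setD[OF indep E_alg S_alg(2), of 1] p0 p1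
    by (simp add: E_def)
  finally have "ennreal (prob (S Xt)) = ennreal (1 - t) * ennreal (prob (S X0)) + ennreal t * ennreal (prob (S X1))"
    using t by (simp add: ennreal_mult)
  moreover have "emeasure (distr P (C1_borel A) Y) B = ennreal (prob (S Y))"
    if "Y \<in> measurable P (C1_borel A)" for Y
    using that by (simp add: emeasure_distr S_def emeasure_eq_measure)
  ultimately show ?thesis using X0 X1 Xt by simp
qed

theorem theorem5:
  fixes A :: "('a::{t2_space, second_countable_topology}, 'm::finite) chart set"
    and g :: "('a, 'm) chart \<Rightarrow> 'a \<Rightarrow> real^'m^'m"
    and P :: "'w measure"
    and X0 X1 Xt :: "'w \<Rightarrow> 'a \<Rightarrow> real^1"
    and \<epsilon> :: "'w \<Rightarrow> real"
    and t :: real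
    and Q0 :: "'w0 measure" and Q1 :: "'w1 measure" and Qt :: "'wt measure"
    and W0 :: "'m \<Rightarrow> 'w0 \<Rightarrow> 'a \<Rightarrow> real^1"
    and W1 :: "'m \<Rightarrow> 'w1 \<Rightarrow> 'a \<Rightarrow> real^1"
    and Wt :: "'m \<Rightarrow> 'wt \<Rightarrow> 'a \<Rightarrow> real^1"
    and \<rho>0 \<rho>1 \<rho>t :: "'m \<Rightarrow> 'a \<Rightarrow> real^1 \<Rightarrow> real"
    and \<mu>0 \<mu>1 \<mu>t :: "'m \<Rightarrow> 'a \<Rightarrow> real^1 \<Rightarrow> ('a \<Rightarrow> real^1) measure"
  assumes "smooth_manifold A" and "riemannian_metric A g"
    and "prob_space P"
    and "zKROK A g P X0" and "zKROK A g P X1"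
    and "0 \<le> t" and "t \<le> 1"
    and "\<epsilon> \<in> measurable P (count_space {0, 1})"
    and "prob_space.indep_set P
           (sets (vimage_algebra (space P) \<epsilon> (count_space {0, 1})))
           (sets (vimage_algebra (space P) (\<lambda>w. (X0 w, X1 w)) (C1_borel A \<Otimes>\<^sub>M C1_borel A)))"
    and "measure P {w \<in> space P. \<epsilon> w = 0} = 1 - t"
    and "measure P {w \<in> space P. \<epsilon> w = 1} = t"
    and "Xt = (\<lambda>w p. (1 - \<epsilon> w) *\<^sub>R X0 w p + \<epsilon> w *\<^sub>R X1 w p)"
    and "zKROK A g P Xt"
    and "iid_copies A P X0 Q0 W0" and "\<And>j. zKROK_with A g Q0 (W0 j) (\<rho>0 j) (\<mu>0 j)"
    and "iid_copies A P X1 Q1 W1" and "\<And>j. zKROK_with A g Q1 (W1 j) (\<rho>1 j) (\<mu>1 j)"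
    and "iid_copies A P Xt Qt Wt" and "\<And>j. zKROK_with A g Qt (Wt j) (\<rho>t j) (\<mu>t j)"
  shows "\<forall>p. intersection_density A g \<rho>t \<mu>t p \<ge>
           rpow (intersection_density A g \<rho>0 \<mu>0 p) (1 - t) *
           rpow (intersection_density A g \<rho>1 \<mu>1 p) t"
proof
  fix p
  note A = assms(1) and g = assms(2) and t = assms(6,7)
    and Z0 = assms(15) and Z1 = assms(17) and Zt = assms(19)
  let ?C = "C1_borel A :: ('a \<Rightarrow> real^1) measure"
  have law0: "distr Q0 ?C (W0 j) = distr P ?C X0" and law1: "distr Q1 ?C (W1 j) = distr P ?C X1"
    and lawt: "distr Qt ?C (Wt j) = distr P ?C Xt" for j
    using assms(14,16,18) unfolding iid_copies_def by auto
  have X: "X0 \<in> measurable P ?C" "X1 \<in> measurable P ?C" "Xt \<in> measurable P ?C"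
    using assms(4,5,13) unfolding zKROK_def zKROK_with_def by blast+
  note law = mixture_law[OF assms(3) X assms(8-12) t]
  \<comment> \<open>An arbitrary reference copy, whose weights stand for those of all the
    others.\<close>
  define k :: 'm where "k = undefined"
  define w where "w = (\<lambda>(\<rho> :: 'm \<Rightarrow> 'a \<Rightarrow> real^1 \<Rightarrow> real)
    (\<mu> :: 'm \<Rightarrow> 'a \<Rightarrow> real^1 \<Rightarrow> ('a \<Rightarrow> real^1) measure) S. \<rho> k p 0 * measure (weighted_law A g p (\<mu> k p 0)) S)"
  \<comment> \<open>The degenerate mixture \<open>a = 1\<close>, \<open>b = 0\<close> compares copy
    \<open>j\<close> with copy \<open>k\<close>, although their versions \<open>\<rho>0\<close>,
    \<open>\<mu>0\<close> may differ.\<close>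
  have w0: "\<rho>0 j p 0 * measure (weighted_law A g p (\<mu>0 j p 0)) S = w \<rho>0 \<mu>0 S" if "S \<in> sets borel" for j S
    using zKROK_mixture_measure[OF A g Z0[of j] Z0[of k] Z0[of k], of 1 0 S p] that
    by (simp add: w_def law0)
  have w1: "\<rho>1 j p 0 * measure (weighted_law A g p (\<mu>1 j p 0)) S = w \<rho>1 \<mu>1 S" if "S \<in> sets borel" for j S
    using zKROK_mixture_measure[OF A g Z1[of j] Z1[of k] Z1[of k], of 1 0 S p] that
    by (simp add: w_def law1)
  have wt: "\<rho>t j p 0 * measure (weighted_law A g p (\<mu>t j p 0)) S =
      (1 - t) * w \<rho>0 \<mu>0 S + t * w \<rho>1 \<mu>1 S" if "S \<in> sets borel" for j S
    unfolding w_def using t that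
    by (intro zKROK_mixture_measure[OF A g Zt[of j] Z0[of k] Z1[of k]]) (simp_all add: law0 law1 lawt law)
  have w_nn: "0 \<le> w \<rho>0 \<mu>0 S" "0 \<le> w \<rho>1 \<mu>1 S" for S
    using Z0[of k] Z1[of k] by (auto simp: w_def zKROK_with_def)
  define G where "G = matrix_inv (g (base_chart A p) p)"
  have G: "0 < v \<bullet> (G *v v)" if "v \<noteq> 0" for v
    unfolding G_def by (rule posdef_matrix_inv[OF riemannian_metric_posdef[OF g A] that])
  obtain s R where s: "\<And>n. simple_function borel (s n)"
    "\<And>v. (\<lambda>n. s n v) \<longlonglongrightarrow> v /\<^sub>R conorm G v" "\<And>n v. norm (s n v) \<le> R"
    using simple_directions[OF G] by blast
  define c where "c = sqrt (det G)"
  have c: "0 < c" using posdef_det_pos[OF G] by (simp add: c_def)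
  define F where "F = (\<lambda>w n. multisum (range (s n)) (\<lambda>v. w (s n -` {v})) abs_list_det CARD('m) [])"
  have prob: "prob_space (\<mu> p 0)" and sets: "sets (\<mu> p 0) = sets ?C"
    and fin: "finite_measure (density (\<mu> p 0) (\<lambda>f. ennreal (J A g p f)))"
    if "zKROK_with A g Q W \<rho> \<mu>" for Q and W :: "'x \<Rightarrow> 'a \<Rightarrow> real^1" and \<rho> \<mu>
    using that unfolding zKROK_with_def regular_cond_prob_def by blast+
  have lim0: "(\<lambda>n. c * F (w \<rho>0 \<mu>0) n) \<longlonglongrightarrow> intersection_density A g \<rho>0 \<mu>0 p"
    unfolding F_def c_def G_def
    by (rule intersection_density_limit[where R = R and w = "w \<rho>0 \<mu>0"])
      (fact A g prob[OF Z0] sets[OF Z0] fin[OF Z0] w0 s[unfolded G_def])+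
  have lim1: "(\<lambda>n. c * F (w \<rho>1 \<mu>1) n) \<longlonglongrightarrow> intersection_density A g \<rho>1 \<mu>1 p"
    unfolding F_def c_def G_def
    by (rule intersection_density_limit[where R = R and w = "w \<rho>1 \<mu>1"])
      (fact A g prob[OF Z1] sets[OF Z1] fin[OF Z1] w1 s[unfolded G_def])+
  have limt: "(\<lambda>n. c * F (\<lambda>S. (1 - t) * w \<rho>0 \<mu>0 S + t * w \<rho>1 \<mu>1 S) n) \<longlonglongrightarrow> intersection_density A g \<rho>t \<mu>t p"
    unfolding F_def c_def G_def
    by (rule intersection_density_limit[where R = R and w = "\<lambda>S. (1 - t) * w \<rho>0 \<mu>0 S + t * w \<rho>1 \<mu>1 S"])
      (fact A g prob[OF Zt] sets[OF Zt] fin[OF Zt] wt s[unfolded G_def])+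
  have F_nn: "0 \<le> F (w \<rho>0 \<mu>0) n" "0 \<le> F (w \<rho>1 \<mu>1) n" for n
    unfolding F_def by (intro multisum_nonneg w_nn; simp add: abs_list_det_def)+
  have d_nn: "0 \<le> intersection_density A g \<rho>0 \<mu>0 p" "0 \<le> intersection_density A g \<rho>1 \<mu>1 p"
    using c F_nn by (auto intro!: LIMSEQ_le_const[OF lim0] LIMSEQ_le_const[OF lim1])
  \<comment> \<open>At the endpoints one exponent is 0 and \<open>powr\<close> is discontinuous at
    base 0; there two of the limits coincide, and \<open>rpow\<close> reads \<open>0\<close> to the
    power \<open>0\<close> as 1.\<close>
  consider "t = 0" | "t = 1" | "0 < t" "t < 1" using t by fastforce
  then show "intersection_density A g \<rho>t \<mu>t p \<ge>
      rpow (intersection_density A g \<rho>0 \<mu>0 p) (1 - t) * rpow (intersection_density A g \<rho>1 \<mu>1 p) t"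
  proof cases
    case 1
    then show ?thesis using LIMSEQ_unique[OF limt] lim0 d_nn by (simp add: rpow_def)
  next
    case 2
    then show ?thesis using LIMSEQ_unique[OF limt] lim1 d_nn by (simp add: rpow_def)
  next
    case 3
    have "intersection_density A g \<rho>0 \<mu>0 p powr (1 - t) * intersection_density A g \<rho>1 \<mu>1 p powr t
        \<le> intersection_density A g \<rho>t \<mu>t p"
    proof (rule LIMSEQ_le[OF _ limt])
      show "(\<lambda>n. (c * F (w \<rho>0 \<mu>0) n) powr (1 - t) * (c * F (w \<rho>1 \<mu>1) n) powr t) \<longlonglongrightarrow>
          intersection_density A g \<rho>0 \<mu>0 p powr (1 - t) * intersection_density A g \<rho>1 \<mu>1 p powr t"
        using 3 c F_nn by (intro tendsto_mult tendsto_powr' lim0 lim1 tendsto_const disjI2 conjI) auto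
      have "(c * F (w \<rho>0 \<mu>0) n) powr (1 - t) * (c * F (w \<rho>1 \<mu>1) n) powr t
          \<le> c * F (\<lambda>S. (1 - t) * w \<rho>0 \<mu>0 S + t * w \<rho>1 \<mu>1 S) n" for n
      proof -
        \<comment> \<open>The exponents add up to 1, so the metric constant passes through the
          inequality unchanged.\<close>
        have "c powr (1 - t) * c powr t = c"
          using c powr_add[of c "1 - t" t] by simp
        moreover have "(c * F (w \<rho>0 \<mu>0) n) powr (1 - t) * (c * F (w \<rho>1 \<mu>1) n) powr t =
            (c powr (1 - t) * c powr t) * (F (w \<rho>0 \<mu>0) n powr (1 - t) * F (w \<rho>1 \<mu>1) n powr t)"
          using c F_nn by (simp add: powr_mult)
        ultimately have "(c * F (w \<rho>0 \<mu>0) n) powr (1 - t) * (c * F (w \<rho>1 \<mu>1) n) powr t =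
            c * (F (w \<rho>0 \<mu>0) n powr (1 - t) * F (w \<rho>1 \<mu>1) n powr t)"
          by simp
        also have "\<dots> \<le> c * F (\<lambda>S. (1 - t) * w \<rho>0 \<mu>0 S + t * w \<rho>1 \<mu>1 S) n"
          unfolding F_def using c 3 simple_functionD(1)[OF s(1), of n]
          by (intro mult_left_mono multisum_abs_list_det_log_concave) (simp_all add: w_nn)
        finally show ?thesis .
      qed
      then show "\<exists>N. \<forall>n\<ge>N. (c * F (w \<rho>0 \<mu>0) n) powr (1 - t) * (c * F (w \<rho>1 \<mu>1) n) powr t
          \<le> c * F (\<lambda>S. (1 - t) * w \<rho>0 \<mu>0 S + t * w \<rho>1 \<mu>1 S) n" by (intro exI[of _ 0]) simp
    qed
    then show ?thesis using 3 by (simp add: rpow_def)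
  qed
qed

end
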